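(* Let $X$ be an $\mathbb{R}^d$-valued random variable whose law is compactly supported in $B_{\mathbb{R}^d}(0,R)$ for a given $R>0$ and elliptic: for any unit vector $e\in\mathbb{R}^d$, $\mathrm{Var}(\langle X,e\rangle)>0$. Let $Y$ take values in $\{-1,1\}$ with $\mathbb{P}[Y=1\mid X=x]=\frac{1}{1+e^{-\langle x,\theta^\star\rangle}}$ for some $\theta^\star\in\mathbb{R}^d$, and let $$f(\theta)=\mathbb{E}\left[\log\left(1+e^{-Y\langle X,\theta\rangle}\right)\right],\qquad\theta\in\mathbb{R}^d.$$ Then: (i) $f$ is convex with $D^2f$ bounded and Lipschitz. Moreover, $D^2f(\theta^\star)$ is invertible, and $\liminf_{|\theta|\to+\infty}|\nabla f(\theta)|>0$ and $\limsup_{|\theta|\to+\infty}|\nabla f(\theta)|<+\infty$. (ii) Let $(X_n,Y_n)_{n\ge0}$ be i.i.d. copies of $(X,Y)$, $\gamma_n=\gamma n^{-3/4}$ with $\gamma>0$, $\theta_0\in\mathbb{R}^d$, and $$\theta_{n+1}=\theta_n+\gamma_{n+1}\frac{Y_nX_n}{1+e^{Y_n\langle\theta_n,X_n\rangle}},\qquad\hat\theta_n=\frac1n\sum_{k=1}^n\theta_k.$$ Then $$\exists\,C>0\quad\forall n\ge1\qquad\mathbb{E}|\hat\theta_n-\theta^\star|^2\le\frac{\mathrm{Tr}(\Sigma^\star)}{n}+Cn^{-5/4}.$$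
   Context: $\Sigma^\star=\{D^2f(\theta^\star)\}^{-1}S^\star\{D^2f(\theta^\star)\}^{-1}$, where $S^\star=S(\theta^\star)$ and $S(\theta)$ is the covariance matrix of the stochastic gradient noise at $\theta$: $S(\theta)=\mathrm{Cov}\left(\frac{YX}{1+e^{Y\langle\theta,X\rangle}}\right)$; equivalently, writing $\theta_{n+1}=\theta_n-\gamma_{n+1}\nabla f(\theta_n)+\gamma_{n+1}\Delta M_{n+1}$ and $\mathcal{F}_n=\sigma(\theta_1,\dots,\theta_n)$, $\mathbb{E}[\Delta M_{n+1}\Delta M_{n+1}^T\mid\mathcal{F}_n]=S(\theta_n)$. $|\cdot|$ is the Euclidean norm, $D^2f$ the Hessian. *)

theory Defs
  imports "HOL-Probability.Probability"
begin

(* Meaningful where f is differentiable (the vector D is then unique). *)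
definition grad :: "(real ^ 'd \<Rightarrow> real) \<Rightarrow> real ^ 'd \<Rightarrow> real ^ 'd" where
  "grad f \<theta> = (THE D. GDERIV f \<theta> :> D)"

definition hess :: "(real ^ 'd \<Rightarrow> real) \<Rightarrow> real ^ 'd \<Rightarrow> real ^ 'd ^ 'd" where
  "hess f \<theta> = jacobian (grad f) (at \<theta>)"

definition cov_matrix :: "'a measure \<Rightarrow> ('a \<Rightarrow> real ^ 'd) \<Rightarrow> real ^ 'd ^ 'd" where
  "cov_matrix M Z =
     (\<chi> i j. \<integral>\<omega>. (Z \<omega> $ i - (\<integral>\<omega>'. Z \<omega>' $ i \<partial>M)) * (Z \<omega> $ j - (\<integral>\<omega>'. Z \<omega>' $ j \<partial>M)) \<partial>M)"

definition logistic_risk :: "'a measure \<Rightarrow> ('a \<Rightarrow> real ^ 'd) \<Rightarrow> ('a \<Rightarrow> real) \<Rightarrow> real ^ 'd \<Rightarrow> real" where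
  "logistic_risk M X Y \<theta> = (\<integral>\<omega>. ln (1 + exp (- (Y \<omega> * (X \<omega> \<bullet> \<theta>)))) \<partial>M)"

(* Minus the gradient in \<theta> of the loss ln (1 + exp (- y * (x \<bullet> \<theta>))) of one observation. *)
definition logistic_step :: "real ^ 'd \<Rightarrow> real \<Rightarrow> real ^ 'd \<Rightarrow> real ^ 'd" where
  "logistic_step x y \<theta> = (y / (1 + exp (y * (\<theta> \<bullet> x)))) *\<^sub>R x"

definition noise_cov ::
  "'a measure \<Rightarrow> ('a \<Rightarrow> real ^ 'd) \<Rightarrow> ('a \<Rightarrow> real) \<Rightarrow> real ^ 'd \<Rightarrow> real ^ 'd ^ 'd" where
  "noise_cov M X Y \<theta> = cov_matrix M (\<lambda>\<omega>. logistic_step (X \<omega>) (Y \<omega>) \<theta>)"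

definition asymptotic_cov ::
  "'a measure \<Rightarrow> ('a \<Rightarrow> real ^ 'd) \<Rightarrow> ('a \<Rightarrow> real) \<Rightarrow> real ^ 'd \<Rightarrow> real ^ 'd ^ 'd" where
  "asymptotic_cov M X Y \<theta> =
     matrix_inv (hess (logistic_risk M X Y) \<theta>) ** noise_cov M X Y \<theta> **
     matrix_inv (hess (logistic_risk M X Y) \<theta>)"

(* The update from time n to n + 1 uses observation n and step size \<gamma> (n + 1). *)
primrec logistic_sgd ::
  "(nat \<Rightarrow> real) \<Rightarrow> real ^ 'd \<Rightarrow> (nat \<Rightarrow> real ^ 'd) \<Rightarrow> (nat \<Rightarrow> real) \<Rightarrow> nat \<Rightarrow> real ^ 'd" where
  "logistic_sgd \<gamma> \<theta>0 x y 0 = \<theta>0"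
| "logistic_sgd \<gamma> \<theta>0 x y (Suc n) =
     logistic_sgd \<gamma> \<theta>0 x y n
       + \<gamma> (Suc n) *\<^sub>R logistic_step (x n) (y n) (logistic_sgd \<gamma> \<theta>0 x y n)"

definition averaged_sgd ::
  "(nat \<Rightarrow> real) \<Rightarrow> real ^ 'd \<Rightarrow> (nat \<Rightarrow> real ^ 'd) \<Rightarrow> (nat \<Rightarrow> real) \<Rightarrow> nat \<Rightarrow> real ^ 'd" where
  "averaged_sgd \<gamma> \<theta>0 x y n = (1 / real n) *\<^sub>R (\<Sum>k=1..n. logistic_sgd \<gamma> \<theta>0 x y k)"

definition iid_copies :: "'a measure \<Rightarrow> (nat \<Rightarrow> 'a \<Rightarrow> 'b::topological_space) \<Rightarrow> ('a \<Rightarrow> 'b) \<Rightarrow> bool" where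
  "iid_copies M Zs Z \<longleftrightarrow>
     prob_space.indep_vars M (\<lambda>_. borel) Zs UNIV \<and>
     (\<forall>n. distr M borel (Zs n) = distr M borel Z)"

end

(*
  Write e_n for the error of the SGD iterate, A for the Hessian at the minimiser, D_n for the
  martingale increments of the noise and r_n = O(|e_n|^2) for the remainder of the linearised
  gradient. Solving the recursion for A e_k and summing by parts gives

    A (sum_{k<=n} e_k) = (sum_{k<=n} D_k) + (boundary terms) - (sum_{k<=n} r_k).

  The martingale sum contributes Tr(Sigma)/n after division by n^2. The remainders are of order
  n^(1/4) in L^2 once E|e_n|^4 = O(gamma_n^2) is known; since the drift is only linear at infinity,
  this comes from the weighted Lyapunov function |e|^4 exp(sqrt(1+|e|^2)), the weight turning the
  weak drift into a contraction. The boundary terms are of order n^(3/8), so Cauchy-Schwarz would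
  only bound their correlation with the martingale sum by n^(7/8); but the matrix
  E[(sum_{k<n} D_k) e_n^T] itself satisfies a contracting recursion and stays bounded, which
  gives the required order n^(3/4).
*)
theory Submission
  imports Defs
begin

text \<open>The exponent 3/4 is a balance. With steps of order n^(-a) the summed remainders have L^2
  size n^(1-a), so pairing them with a martingale sum of size n^(1/2) costs n^(3/2-a), while the
  boundary terms have second moment n^a; both are n^(3/4) at a = 3/4. The correlation matrix stays
  bounded because each step contracts it by a factor 1 - O(gamma_n) and adds a source O(gamma_n): a
  product of equal-time noises, and the correlation with r_n, of size n^(1/2) n^(-3/4). The weak
  drift is intrinsic: the gradient is bounded, so its inner product with e is at most linear in |e|.
  The weight helps since its logarithmic derivative e / sqrt(1+|e|^2) has length near 1 far out,
  where the drift then causes relative decay at a constant rate; near 0 the fourth power does the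
  same. The noise is handled without conditional expectations, by orthogonality to bounded functions
  of the past. As the start is deterministic and increments are bounded, all variables at a fixed
  time are essentially bounded, so integrability is free. The leading constant is exact because the
  noise is compared with the noise at the minimiser, at a cost linear in |e_n|.\<close>

section \<open>Powers and recursive inequalities\<close>

text \<open>Concavity: Young's inequality bounds y^p x^(1-p) by p y + (1-p) x, and multiplying by
  x^(p-1) produces the tangent at \<open>x\<close>.\<close>

lemma powr_le_tangent:
  fixes x y p :: real
  assumes "0 \<le> p" "p \<le> 1" "0 < x" "0 \<le> y"
  shows "y powr p \<le> x powr p + p * x powr (p - 1) * (y - x)"
proof (cases "y = 0")
  case True
  have "x powr p = x powr (p - 1) * x"
    using assms by (simp add: powr_mult_base mult.commute)
  then have "x powr p + p * x powr (p - 1) * (y - x) = (1 - p) * x powr p"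
    using True by (simp add: algebra_simps)
  then show ?thesis using True assms by simp
next
  case False
  with assms have y: "y > 0" by simp
  have "y powr p = y powr p * x powr (1 - p) * x powr (p - 1)"
    using assms by (simp add: mult.assoc flip: powr_add)
  also have "\<dots> \<le> (p * y + (1 - p) * x) * x powr (p - 1)"
    using Youngs_inequality_0[of p "1 - p" y x] assms y by (intro mult_right_mono) auto
  also have "\<dots> = x * x powr (p - 1) + p * x powr (p - 1) * (y - x)"
    by (simp add: algebra_simps)
  also have "x * x powr (p - 1) = x powr p"
    using assms by (simp add: powr_mult_base)
  finally show ?thesis .
qed

text \<open>Discrete integral comparison: by the tangent inequality for the power 1 - q, each
  summand is at most an increment of n^(1-q) / (1-q), and the increments telescope.\<close>

lemma sum_powr_le:
  fixes q :: real
  assumes "0 \<le> q" "q < 1"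
  shows "(\<Sum>k=1..n. real k powr - q) \<le> real n powr (1 - q) / (1 - q)"
proof (induction n)
  case (Suc n)
  have "real n powr (1 - q) \<le> real (Suc n) powr (1 - q) - (1 - q) * real (Suc n) powr - q"
    using powr_le_tangent[of "1 - q" "real (Suc n)" "real n"] assms by simp
  then have "(1 - q) * real (Suc n) powr - q \<le> real (Suc n) powr (1 - q) - real n powr (1 - q)"
    by simp
  then have "real (Suc n) powr - q \<le> (real (Suc n) powr (1 - q) - real n powr (1 - q)) / (1 - q)"
    using assms by (subst pos_le_divide_eq) (simp_all add: mult.commute)
  with Suc show ?case by (simp add: diff_divide_distrib)
qed simp

text \<open>Follows from ln (x+1) <= ln x + 1/x and exp (-t) >= 1 - t. It limits the relative loss
  of a power rate over one step to s / x.\<close>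

lemma powr_add_one_ge:
  fixes x s :: real
  assumes "x > 0" "s \<ge> 0"
  shows "x powr - s * (1 - s / x) \<le> (x + 1) powr - s"
proof -
  have "ln (x + 1) \<le> ln x + 1 / x"
    using assms ln_le_minus_one[of "(x + 1) / x"] by (simp add: ln_div field_simps)
  then have "s * ln (x + 1) \<le> s * (ln x + 1 / x)"
    using assms by (intro mult_left_mono)
  then have "- s * ln x + - (s / x) \<le> - s * ln (x + 1)"
    by (simp add: algebra_simps)
  then have "exp (- s * ln x) * exp (- (s / x)) \<le> exp (- s * ln (x + 1))"
    by (simp flip: exp_add)
  moreover have "exp (- s * ln x) * (1 - s / x) \<le> exp (- s * ln x) * exp (- (s / x))"
    using exp_ge_add_one_self[of "- (s / x)"] by (intro mult_left_mono) auto
  ultimately have "exp (- s * ln x) * (1 - s / x) \<le> exp (- s * ln (x + 1))" by (rule order_trans[rotated])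
  then show ?thesis using assms by (simp add: powr_def)
qed

text \<open>Chung's lemma. With N = n + 1, the rate N^(-\<alpha>) loses only a fraction \<alpha>/N
  per step, which for \<beta> < 1 is eventually below half of the contraction c N^(-\<beta>); the
  other half absorbs the source. The case \<alpha> = 0 gives plain boundedness.\<close>

lemma recursion_rate:
  fixes x :: "nat \<Rightarrow> real" and \<alpha> \<beta> c K :: real
  assumes \<beta>: "0 < \<beta>" "\<beta> < 1" and "\<alpha> \<ge> 0" "c > 0"
    and rec: "\<forall>\<^sub>F n in sequentially.
      x (Suc n) \<le> (1 - c * real (Suc n) powr - \<beta>) * x n + K * real (Suc n) powr - (\<alpha> + \<beta>)"
  obtains K' where "K' > 0" "\<And>n. x n \<le> K' * real (Suc n) powr - \<alpha>"
proof -
  have lim: "((\<lambda>n. real (Suc n) powr - p) \<longlongrightarrow> 0) sequentially" if "p > 0" for p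
    using that tendsto_neg_powr[OF _ filterlim_compose[OF filterlim_real_sequentially filterlim_Suc], of "- p"] by simp
  have "\<forall>\<^sub>F n in sequentially. c * real (Suc n) powr - \<beta> < 1"
    using order_tendstoD(2)[OF tendsto_mult_right_zero[OF lim[OF \<beta>(1)], of c], of 1] by simp
  moreover have "\<forall>\<^sub>F n in sequentially. \<alpha> * real (Suc n) powr - (1 - \<beta>) < c / 2"
    using order_tendstoD(2)[OF tendsto_mult_right_zero[OF lim[of "1 - \<beta>"], of \<alpha>], of "c/2"] \<beta> \<open>c > 0\<close>
    by simp
  ultimately have "\<forall>\<^sub>F n in sequentially. c * real (Suc n) powr - \<beta> < 1 \<and>
      \<alpha> * real (Suc n) powr - (1 - \<beta>) < c / 2 \<and>
      x (Suc n) \<le> (1 - c * real (Suc n) powr - \<beta>) * x n + K * real (Suc n) powr - (\<alpha> + \<beta>)"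
    using rec by eventually_elim (intro conjI)
  then obtain n0 where n0: "\<And>n. n \<ge> n0 \<Longrightarrow> c * real (Suc n) powr - \<beta> < 1 \<and>
      \<alpha> * real (Suc n) powr - (1 - \<beta>) < c / 2 \<and>
      x (Suc n) \<le> (1 - c * real (Suc n) powr - \<beta>) * x n + K * real (Suc n) powr - (\<alpha> + \<beta>)"
    unfolding eventually_sequentially by blast
  \<comment> \<open>The 1 gives positivity, 2|K|/c lets half of the contraction absorb the source,
    and the finite sum makes the bound true up to \<open>n0\<close>, before the asymptotic
    inequalities are available.\<close>
  define K' where "K' = 1 + 2 * \<bar>K\<bar> / c + (\<Sum>k\<le>n0. \<bar>x k\<bar> * real (Suc k) powr \<alpha>)"
  have sum0: "(\<Sum>k\<le>n0. \<bar>x k\<bar> * real (Suc k) powr \<alpha>) \<ge> 0" by (intro sum_nonneg) auto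
  have K'pos: "K' > 0" and K'K: "\<bar>K\<bar> \<le> K' * (c / 2)"
    using \<open>c > 0\<close> sum0 unfolding K'_def by (auto simp: field_simps intro!: add_pos_nonneg)
  have init: "x n \<le> K' * real (Suc n) powr - \<alpha>" if "n \<le> n0" for n
  proof -
    have "\<bar>x n\<bar> * real (Suc n) powr \<alpha> \<le> (\<Sum>k\<le>n0. \<bar>x k\<bar> * real (Suc k) powr \<alpha>)"
      using that by (intro member_le_sum) auto
    also have "\<dots> \<le> K'" using \<open>c > 0\<close> by (simp add: K'_def)
    finally have "\<bar>x n\<bar> * real (Suc n) powr \<alpha> * real (Suc n) powr - \<alpha> \<le> K' * real (Suc n) powr - \<alpha>"
      by (intro mult_right_mono) auto
    moreover have "\<bar>x n\<bar> * real (Suc n) powr \<alpha> * real (Suc n) powr - \<alpha> = \<bar>x n\<bar>"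
      by (simp add: mult.assoc flip: powr_add)
    ultimately show ?thesis by linarith
  qed
  have "x n \<le> K' * real (Suc n) powr - \<alpha>" if "n \<ge> n0" for n
    using that
  proof (induction n rule: dec_induct)
    case base
    then show ?case using init by simp
  next
    case (step n)
    define y where "y = real (Suc n)"
    have y: "y > 0" by (simp add: y_def)
    have n: "c * y powr - \<beta> < 1" "\<alpha> * y powr - (1 - \<beta>) < c / 2"
      "x (Suc n) \<le> (1 - c * y powr - \<beta>) * x n + K * y powr - (\<alpha> + \<beta>)"
      using n0[OF step.hyps(1)] unfolding y_def by auto
    have "\<alpha> / y = (\<alpha> * y powr - (1 - \<beta>)) * y powr - \<beta>"
    proof -
      have "y powr - (1 - \<beta>) * y powr - \<beta> = inverse y"
        using y powr_minus[of y 1] by (simp flip: powr_add)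
      then show ?thesis by (simp only: mult.assoc divide_inverse)
    qed
    also have "\<dots> \<le> c / 2 * y powr - \<beta>" using n(2) by (intro mult_right_mono) auto
    finally have key: "\<alpha> / y \<le> c / 2 * y powr - \<beta>" .
    have "x (Suc n) \<le> (1 - c * y powr - \<beta>) * x n + K * y powr - (\<alpha> + \<beta>)" by (fact n)
    also have "\<dots> \<le> (1 - c * y powr - \<beta>) * (K' * y powr - \<alpha>) + (K' * (c / 2)) * y powr - (\<alpha> + \<beta>)"
      using n(1) step.IH K'K unfolding y_def by (intro add_mono mult_left_mono mult_right_mono) auto
    also have "y powr - (\<alpha> + \<beta>) = y powr - \<alpha> * y powr - \<beta>"
      by (simp flip: powr_add)
    also have "(1 - c * y powr - \<beta>) * (K' * y powr - \<alpha>) + K' * (c / 2) * (y powr - \<alpha> * y powr - \<beta>)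
        = K' * (y powr - \<alpha> * (1 - c / 2 * y powr - \<beta>))"
      by (simp add: algebra_simps)
    also have "\<dots> \<le> K' * (y powr - \<alpha> * (1 - \<alpha> / y))"
      using K'pos key by (intro mult_left_mono) auto
    also have "\<dots> \<le> K' * (y + 1) powr - \<alpha>"
      using K'pos powr_add_one_ge[OF y \<open>\<alpha> \<ge> 0\<close>] by (intro mult_left_mono) auto
    finally show ?case by (simp add: y_def add_ac)
  qed
  then have "x n \<le> K' * real (Suc n) powr - \<alpha>" for n
    using init[of n] by (cases "n \<le> n0") auto
  with K'pos that show ?thesis by blast
qed

section \<open>Stochastic approximation with bounded noise\<close>

text \<open>The state is an error, so the root of the mean field \<open>G\<close> sits at 0
  (\<open>G 0 = 0\<close> follows from \<open>G_expansion\<close>). As \<open>g\<close> is bounded,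
  \<open>v \<bullet> G v\<close> grows at most linearly, and \<open>drift\<close> asks for no more:
  quadratic near the root, linear at infinity.\<close>

locale robbins_monro = prob_space M
  for M :: "'a measure" +
  fixes N :: "'b measure" and Z :: "nat \<Rightarrow> 'a \<Rightarrow> 'b" and \<nu> :: "'b measure"
    and g :: "'b \<Rightarrow> 'e::euclidean_space \<Rightarrow> 'e" and G A :: "'e \<Rightarrow> 'e"
    and e0 :: 'e and \<gamma> R L c \<mu> :: real
  assumes indep: "indep_vars (\<lambda>_. N) Z UNIV"
    and law: "distr M N (Z n) = \<nu>"
    and g_measurable [measurable]: "(\<lambda>(z, v). g z v) \<in> borel_measurable (N \<Otimes>\<^sub>M borel)"
    and g_bounded: "AE z in \<nu>. \<forall>v. norm (g z v) \<le> R"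
    and g_lipschitz: "AE z in \<nu>. \<forall>v. norm (g z v - g z 0) \<le> L * norm v"
    and G_eq: "G v = - (\<integral>z. g z v \<partial>\<nu>)"
    and G_continuous: "continuous_on UNIV G"
    and drift: "c * ((norm v)^2 / sqrt (1 + (norm v)^2)) \<le> v \<bullet> G v"
    and G_expansion: "norm (G v - A v) \<le> L * (norm v)^2"
    and A_linear: "linear A"
    and A_symmetric: "A v \<bullet> w = v \<bullet> A w"
    and A_coercive: "\<mu> * (norm v)^2 \<le> v \<bullet> A v"
    and pos: "\<gamma> > 0" "R > 0" "L > 0" "c > 0" "\<mu> > 0"
begin

abbreviation E :: "('a \<Rightarrow> real) \<Rightarrow> real" where
  "E \<equiv> expectation"

definition step :: "nat \<Rightarrow> real" where
  "step n = \<gamma> * real n powr (- 3 / 4)"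

primrec iter :: "nat \<Rightarrow> 'a \<Rightarrow> 'e" where
  "iter 0 \<omega> = e0"
| "iter (Suc n) \<omega> = iter n \<omega> + step (Suc n) *\<^sub>R g (Z n \<omega>) (iter n \<omega>)"

definition noise :: "nat \<Rightarrow> 'a \<Rightarrow> 'e" where
  "noise n \<omega> = g (Z n \<omega>) (iter n \<omega>) + G (iter n \<omega>)"

text \<open>Generated by the first \<open>n\<close> observations rather than by the iterates;
  pulling back the joint map into the product space lets independence of blocks of \<open>Z\<close>
  be used directly. \<open>iter n\<close> is measurable here, \<open>noise n\<close> from
  \<open>past (Suc n)\<close> on.\<close>

definition past :: "nat \<Rightarrow> 'a measure" where
  "past n = vimage_algebra (space M) (\<lambda>\<omega>. \<lambda>i\<in>{..<n}. Z i \<omega>) (\<Pi>\<^sub>M i\<in>{..<n}. N)"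

lemma iter_0: "iter 0 = (\<lambda>_. e0)"
  by auto

lemma iter_Suc_noise: "iter (Suc n) \<omega> = iter n \<omega> + step (Suc n) *\<^sub>R (noise n \<omega> - G (iter n \<omega>))"
  by (simp add: noise_def)

section \<open>Measurability relative to the observations seen so far\<close>

lemma Z_measurable [measurable]: "Z n \<in> M \<rightarrow>\<^sub>M N"
  using indep by (simp add: indep_vars_def2)

lemma space_past [simp]: "space (past n) = space M"
  by (simp add: past_def)

lemma sets_past_subset: "sets (past n) \<subseteq> sets M"
  unfolding past_def by (rule sets_image_in_sets) auto

lemma measurable_past_M: "P \<in> past n \<rightarrow>\<^sub>M K \<Longrightarrow> P \<in> M \<rightarrow>\<^sub>M K"
  using sets_past_subset[of n] by (auto simp: measurable_def)

lemma Z_measurable_past: "i < n \<Longrightarrow> Z i \<in> past n \<rightarrow>\<^sub>M N"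
proof -
  assume i: "i < n"
  have "(\<lambda>\<omega>. \<lambda>i\<in>{..<n}. Z i \<omega>) \<in> M \<rightarrow>\<^sub>M (\<Pi>\<^sub>M i\<in>{..<n}. N)"
    by (rule measurable_restrict) (rule Z_measurable)
  then have "(\<lambda>\<omega>. \<lambda>i\<in>{..<n}. Z i \<omega>) \<in> past n \<rightarrow>\<^sub>M (\<Pi>\<^sub>M i\<in>{..<n}. N)"
    unfolding past_def by (intro measurable_vimage_algebra1 funcsetI) (rule measurable_space)
  from measurable_compose[OF this measurable_component_singleton[of i]]
  have "(\<lambda>\<omega>. (\<lambda>i\<in>{..<n}. Z i \<omega>) i) \<in> past n \<rightarrow>\<^sub>M N" using i by auto
  then show ?thesis using i by simp
qed

lemma g_measurable_compose:
  assumes "P \<in> K \<rightarrow>\<^sub>M N" "Q \<in> borel_measurable K"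
  shows "(\<lambda>x. g (P x) (Q x)) \<in> borel_measurable K"
  using measurable_compose[OF measurable_Pair[OF assms] g_measurable] by simp

lemma G_measurable [measurable]: "G \<in> borel_measurable borel"
  using G_continuous by (rule borel_measurable_continuous_onI)

lemma iter_measurable_past: "k \<le> n \<Longrightarrow> iter k \<in> borel_measurable (past n)"
proof (induction k)
  case (Suc k)
  then have [measurable]: "iter k \<in> borel_measurable (past n)"
    and "Z k \<in> past n \<rightarrow>\<^sub>M N" by (auto intro: Z_measurable_past)
  note [measurable] = g_measurable_compose[OF this(2) this(1)]
  show ?case by simp
qed (simp add: iter_0)

lemma noise_measurable_past: "k < n \<Longrightarrow> noise k \<in> borel_measurable (past n)"
proof -
  assume "k < n"
  then have [measurable]: "iter k \<in> borel_measurable (past n)"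
    and "Z k \<in> past n \<rightarrow>\<^sub>M N" by (auto intro: Z_measurable_past iter_measurable_past)
  note [measurable] = g_measurable_compose[OF this(2) this(1)]
  show ?thesis unfolding noise_def[abs_def] by measurable
qed

lemma iter_measurable [measurable]: "iter n \<in> borel_measurable M"
  using iter_measurable_past[of n n] by (auto intro: measurable_past_M)

lemma noise_measurable [measurable]: "noise n \<in> borel_measurable M"
  using noise_measurable_past[of n "Suc n"] by (auto intro: measurable_past_M)

lemma prob_space_law: "prob_space \<nu>"
  using prob_space_distr[OF Z_measurable[of 0]] law[of 0] by simp

lemma sets_law [measurable_cong]: "sets \<nu> = sets N"
  using law[of 0] by auto

lemma AE_Z: "AE z in \<nu>. Q z \<Longrightarrow> AE \<omega> in M. Q (Z n \<omega>)"
  using AE_distrD[OF Z_measurable, of Q n] unfolding law .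

text \<open>The bound may depend on the time index and is never quantitative: the class only serves
  to discharge integrability, since it contains the iterates and the noise and is closed under
  continuous operations.\<close>

definition bdd_rv :: "('a \<Rightarrow> 'v::{second_countable_topology, banach}) \<Rightarrow> bool" where
  "bdd_rv P \<longleftrightarrow> P \<in> borel_measurable M \<and> (\<exists>K. AE \<omega> in M. norm (P \<omega>) \<le> K)"

named_theorems bdd_rv_intros

lemma bdd_rvI: "P \<in> borel_measurable M \<Longrightarrow> AE \<omega> in M. norm (P \<omega>) \<le> K \<Longrightarrow> bdd_rv P"
  unfolding bdd_rv_def by blast

lemma bdd_rv_measurable [measurable_dest]: "bdd_rv P \<Longrightarrow> P \<in> borel_measurable M"
  by (simp add: bdd_rv_def)

lemma bdd_rv_integrable: "bdd_rv P \<Longrightarrow> integrable M P"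
  unfolding bdd_rv_def by (auto intro: integrable_const_bound)

lemma bdd_rv_const [bdd_rv_intros, simp]: "bdd_rv (\<lambda>_. k)"
  by (rule bdd_rvI[of _ "norm k"]) auto

text \<open>A continuous map is bounded on the compact product of two balls. The rules for sums,
  products and inner products are instances.\<close>

lemma bdd_rv_continuous2:
  fixes P :: "'a \<Rightarrow> 'v::euclidean_space" and Q :: "'a \<Rightarrow> 'w::euclidean_space"
    and h :: "'v \<times> 'w \<Rightarrow> 'u::{second_countable_topology, banach}"
  assumes "continuous_on UNIV h" "bdd_rv P" "bdd_rv Q"
  shows "bdd_rv (\<lambda>\<omega>. h (P \<omega>, Q \<omega>))"
proof -
  from assms obtain K1 K2 where K: "AE \<omega> in M. norm (P \<omega>) \<le> K1" "AE \<omega> in M. norm (Q \<omega>) \<le> K2"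
    by (auto simp: bdd_rv_def)
  have "compact (h ` (cball 0 K1 \<times> cball 0 K2))"
    using assms(1) by (intro compact_continuous_image compact_Times) (auto intro: continuous_on_subset)
  then have "bounded (h ` (cball 0 K1 \<times> cball 0 K2))"
    by (rule compact_imp_bounded)
  then obtain K where K': "\<And>x. x \<in> cball 0 K1 \<times> cball 0 K2 \<Longrightarrow> norm (h x) \<le> K"
    unfolding bounded_iff by blast
  have [measurable]: "P \<in> borel_measurable M" "Q \<in> borel_measurable M"
    using assms by auto
  show ?thesis
  proof (rule bdd_rvI)
    show "(\<lambda>\<omega>. h (P \<omega>, Q \<omega>)) \<in> borel_measurable M"
      using borel_measurable_continuous_on[OF assms(1), of "\<lambda>\<omega>. (P \<omega>, Q \<omega>)"] by simp
    show "AE \<omega> in M. norm (h (P \<omega>, Q \<omega>)) \<le> K"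
      using K by eventually_elim (rule K', auto)
  qed
qed

lemma bdd_rv_continuous:
  fixes P :: "'a \<Rightarrow> 'v::euclidean_space"
  assumes "continuous_on UNIV h" "bdd_rv P"
  shows "bdd_rv (\<lambda>\<omega>. h (P \<omega>))"
  using bdd_rv_continuous2[where h = "\<lambda>x. h (fst x)" and P = P and Q = P, OF _ assms(2,2)]
    continuous_on_compose2[OF assms(1) continuous_on_fst[OF continuous_on_id]] by auto

lemma bdd_rv_add [bdd_rv_intros]:
  fixes P Q :: "'a \<Rightarrow> 'v::euclidean_space"
  shows "bdd_rv P \<Longrightarrow> bdd_rv Q \<Longrightarrow> bdd_rv (\<lambda>\<omega>. P \<omega> + Q \<omega>)"
  by (rule bdd_rv_continuous2[of "\<lambda>x. fst x + snd x" P Q, unfolded fst_conv snd_conv]) (assumption | intro continuous_intros)+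

lemma bdd_rv_diff [bdd_rv_intros]:
  fixes P Q :: "'a \<Rightarrow> 'v::euclidean_space"
  shows "bdd_rv P \<Longrightarrow> bdd_rv Q \<Longrightarrow> bdd_rv (\<lambda>\<omega>. P \<omega> - Q \<omega>)"
  by (rule bdd_rv_continuous2[of "\<lambda>x. fst x - snd x" P Q, unfolded fst_conv snd_conv]) (assumption | intro continuous_intros)+

lemma bdd_rv_scaleR [bdd_rv_intros]:
  fixes Q :: "'a \<Rightarrow> 'v::euclidean_space"
  shows "bdd_rv P \<Longrightarrow> bdd_rv Q \<Longrightarrow> bdd_rv (\<lambda>\<omega>. P \<omega> *\<^sub>R Q \<omega>)"
  by (rule bdd_rv_continuous2[of "\<lambda>x. fst x *\<^sub>R snd x" P Q, unfolded fst_conv snd_conv]) (assumption | intro continuous_intros)+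

lemma bdd_rv_mult [bdd_rv_intros]:
  fixes P Q :: "'a \<Rightarrow> real"
  shows "bdd_rv P \<Longrightarrow> bdd_rv Q \<Longrightarrow> bdd_rv (\<lambda>\<omega>. P \<omega> * Q \<omega>)"
  by (rule bdd_rv_continuous2[of "\<lambda>x. fst x * snd x" P Q, unfolded fst_conv snd_conv]) (assumption | intro continuous_intros)+

lemma bdd_rv_inner [bdd_rv_intros]:
  fixes P Q :: "'a \<Rightarrow> 'v::euclidean_space"
  shows "bdd_rv P \<Longrightarrow> bdd_rv Q \<Longrightarrow> bdd_rv (\<lambda>\<omega>. P \<omega> \<bullet> Q \<omega>)"
  by (rule bdd_rv_continuous2[of "\<lambda>x. fst x \<bullet> snd x" P Q, unfolded fst_conv snd_conv]) (assumption | intro continuous_intros)+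

lemma bdd_rv_norm [bdd_rv_intros]:
  fixes P :: "'a \<Rightarrow> 'v::euclidean_space"
  shows "bdd_rv P \<Longrightarrow> bdd_rv (\<lambda>\<omega>. norm (P \<omega>))"
  by (rule bdd_rv_continuous[of norm P]) (assumption | intro continuous_intros)+

lemma bdd_rv_power [bdd_rv_intros]:
  fixes P :: "'a \<Rightarrow> real"
  shows "bdd_rv P \<Longrightarrow> bdd_rv (\<lambda>\<omega>. P \<omega> ^ n)"
  by (rule bdd_rv_continuous[of "\<lambda>x. x ^ n" P]) (assumption | intro continuous_intros)+

lemma bdd_rv_linear:
  fixes P :: "'a \<Rightarrow> 'v::euclidean_space" and B :: "'v \<Rightarrow> 'w::euclidean_space"
  shows "linear B \<Longrightarrow> bdd_rv P \<Longrightarrow> bdd_rv (\<lambda>\<omega>. B (P \<omega>))"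
  by (rule bdd_rv_continuous) (auto intro: linear_continuous_on simp: linear_conv_bounded_linear)

lemma bdd_rv_sum [bdd_rv_intros]:
  fixes P :: "'i \<Rightarrow> 'a \<Rightarrow> 'v::euclidean_space"
  shows "(\<And>i. i \<in> I \<Longrightarrow> bdd_rv (P i)) \<Longrightarrow> bdd_rv (\<lambda>\<omega>. \<Sum>i\<in>I. P i \<omega>)"
  by (induction I rule: infinite_finite_induct) (auto intro: bdd_rv_add bdd_rv_const)

section \<open>Almost sure bounds on updates and noise, and orthogonality of the noise to the
  past\<close>

lemma integrable_g: "integrable \<nu> (\<lambda>z. g z v)"
proof -
  interpret \<nu>: prob_space \<nu> by (rule prob_space_law)
  show ?thesis
    using g_bounded by (intro \<nu>.integrable_const_bound[of _ R]) (auto intro: g_measurable_compose)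
qed

lemma norm_G_le: "norm (G v) \<le> R"
proof -
  interpret \<nu>: prob_space \<nu> by (rule prob_space_law)
  have "norm (\<integral>z. g z v \<partial>\<nu>) \<le> (\<integral>z. norm (g z v) \<partial>\<nu>)" by (rule integral_norm_bound)
  also have "\<dots> \<le> (\<integral>z. R \<partial>\<nu>)"
    using g_bounded integrable_g by (intro integral_mono_AE) auto
  finally show ?thesis by (simp add: G_eq \<nu>.prob_space)
qed

lemma G_0 [simp]: "G 0 = 0"
  using G_expansion[of 0] linear_0[OF A_linear] by simp

lemma AE_g: "AE \<omega> in M. \<forall>n v. norm (g (Z n \<omega>) v) \<le> R \<and> norm (g (Z n \<omega>) v - g (Z n \<omega>) 0) \<le> L * norm v"
proof -
  have "AE \<omega> in M. (\<forall>v. norm (g (Z n \<omega>) v) \<le> R) \<and> (\<forall>v. norm (g (Z n \<omega>) v - g (Z n \<omega>) 0) \<le> L * norm v)" for n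
    using AE_Z[OF g_bounded, of n] AE_Z[OF g_lipschitz, of n] by eventually_elim simp
  then have "AE \<omega> in M. \<forall>n. (\<forall>v. norm (g (Z n \<omega>) v) \<le> R) \<and> (\<forall>v. norm (g (Z n \<omega>) v - g (Z n \<omega>) 0) \<le> L * norm v)"
    unfolding AE_all_countable by blast
  then show ?thesis by eventually_elim blast
qed

lemma AE_noise: "AE \<omega> in M. \<forall>n. norm (noise n \<omega>) \<le> 2 * R"
  using AE_g
proof eventually_elim
  case (elim \<omega>)
  show ?case
  proof
    fix n
    have "norm (noise n \<omega>) \<le> norm (g (Z n \<omega>) (iter n \<omega>)) + norm (G (iter n \<omega>))"
      unfolding noise_def by (rule norm_triangle_ineq)
    also have "\<dots> \<le> R + R" using elim norm_G_le by (intro add_mono) auto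
    finally show "norm (noise n \<omega>) \<le> 2 * R" by simp
  qed
qed

lemma bdd_rv_noise [bdd_rv_intros]: "bdd_rv (noise n)"
  using AE_noise by (intro bdd_rvI[of _ "2 * R"]) auto

lemma bdd_rv_G [bdd_rv_intros]: "bdd_rv P \<Longrightarrow> bdd_rv (\<lambda>\<omega>. G (P \<omega>))"
  by (rule bdd_rv_continuous[OF G_continuous])

lemma bdd_rv_iter [bdd_rv_intros]: "bdd_rv (iter n)"
proof (induction n)
  case (Suc n)
  then have "bdd_rv (\<lambda>\<omega>. iter n \<omega> + step (Suc n) *\<^sub>R (noise n \<omega> - G (iter n \<omega>)))"
    by (intro bdd_rv_intros)
  then show ?case unfolding iter_Suc_noise[symmetric] by simp
qed (simp add: iter_0 bdd_rv_const)

text \<open>Preimages under \<open>P\<close> lie in the sigma-algebra of the block of indices below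
  \<open>n\<close>, preimages under \<open>Z n\<close> in that of the block {n}, and the two blocks
  are independent. Comparing the measures on rectangles is enough.\<close>

lemma distr_past_Z:
  assumes P: "P \<in> past n \<rightarrow>\<^sub>M K"
  shows "distr M (K \<Otimes>\<^sub>M N) (\<lambda>\<omega>. (P \<omega>, Z n \<omega>)) = distr M K P \<Otimes>\<^sub>M \<nu>"
proof (rule pair_measure_eqI[symmetric])
  let ?H = "\<lambda>\<omega>. \<lambda>i\<in>{..<n}. Z i \<omega>" and ?H' = "\<lambda>\<omega>. \<lambda>i\<in>{n}. Z i \<omega>"
  note [measurable] = measurable_past_M[OF P]
  interpret \<nu>: prob_space \<nu> by (rule prob_space_law)
  interpret D: prob_space "distr M K P" by (rule prob_space_distr) simp
  show "sigma_finite_measure (distr M K P)" "sigma_finite_measure \<nu>" ..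
  show "sets (distr M K P \<Otimes>\<^sub>M \<nu>) = sets (distr M (K \<Otimes>\<^sub>M N) (\<lambda>\<omega>. (P \<omega>, Z n \<omega>)))"
    unfolding sets_distr by (intro sets_pair_measure_cong) (auto simp: sets_law)
  fix S T assume "S \<in> sets (distr M K P)" "T \<in> sets \<nu>"
  then have [measurable]: "S \<in> sets K" "T \<in> sets N" by (auto simp: sets_law)
  have "indep_var (\<Pi>\<^sub>M i\<in>{..<n}. N) ?H (\<Pi>\<^sub>M i\<in>{n}. N) ?H'"
    using indep by (rule indep_var_restrict) auto
  then have *: "indep_set (sets (past n)) (sigma_sets (space M) {?H' -` A \<inter> space M | A. A \<in> sets (\<Pi>\<^sub>M i\<in>{n}. N)})"
    unfolding indep_var_eq past_def sets_vimage_algebra by simp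
  have "(\<lambda>x. x n) -` T \<inter> space (\<Pi>\<^sub>M i\<in>{n}. N) \<in> sets (\<Pi>\<^sub>M i\<in>{n}. N)"
    by (rule measurable_sets[OF measurable_component_singleton]) auto
  then have "?H' -` ((\<lambda>x. x n) -` T \<inter> space (\<Pi>\<^sub>M i\<in>{n}. N)) \<inter> space M
      \<in> sigma_sets (space M) {?H' -` A \<inter> space M | A. A \<in> sets (\<Pi>\<^sub>M i\<in>{n}. N)}"
    by (intro sigma_sets.Basic) blast
  moreover have "?H' -` ((\<lambda>x. x n) -` T \<inter> space (\<Pi>\<^sub>M i\<in>{n}. N)) \<inter> space M = Z n -` T \<inter> space M"
    using measurable_space[OF Z_measurable[of n]] by (auto simp: space_PiM PiE_iff)
  ultimately have Z: "Z n -` T \<inter> space M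
      \<in> sigma_sets (space M) {?H' -` A \<inter> space M | A. A \<in> sets (\<Pi>\<^sub>M i\<in>{n}. N)}" by simp
  have "P -` S \<inter> space M \<in> sets (past n)"
    using measurable_sets[OF P, of S] by simp
  from indep_setD[OF * this Z]
  have "prob ((P -` S \<inter> space M) \<inter> (Z n -` T \<inter> space M)) = prob (P -` S \<inter> space M) * prob (Z n -` T \<inter> space M)" .
  moreover have "(P -` S \<inter> space M) \<inter> (Z n -` T \<inter> space M) = (\<lambda>\<omega>. (P \<omega>, Z n \<omega>)) -` (S \<times> T) \<inter> space M"
    by auto
  ultimately show "emeasure (distr M K P) S * emeasure \<nu> T
      = emeasure (distr M (K \<Otimes>\<^sub>M N) (\<lambda>\<omega>. (P \<omega>, Z n \<omega>))) (S \<times> T)"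
    unfolding law[of n, symmetric] by (simp add: emeasure_distr emeasure_eq_measure ennreal_mult)
qed

text \<open>The martingale difference property, phrased by testing against \<open>P\<close>.
  Freezing \<open>P\<close> and \<open>iter n\<close> and integrating over \<open>Z n\<close> first
  (Fubini for the product law) turns \<open>g\<close> into \<open>- G\<close>, which cancels the
  centering in \<open>noise\<close>.\<close>

lemma expectation_past_noise:
  assumes P: "P \<in> borel_measurable (past n)" and b: "bdd_rv P"
  shows "E (\<lambda>\<omega>. P \<omega> \<bullet> noise n \<omega>) = 0"
proof -
  define H where "H \<omega> = (P \<omega>, iter n \<omega>)" for \<omega>
  have HP: "H \<in> past n \<rightarrow>\<^sub>M borel \<Otimes>\<^sub>M borel"
    unfolding H_def[abs_def] using P iter_measurable_past[of n n] by simp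
  note [measurable] = measurable_past_M[OF HP]
  define q where "q = (\<lambda>(h :: 'e \<times> 'e, z). fst h \<bullet> g z (snd h))"
  have [measurable]: "(\<lambda>x. g (snd x) (snd (fst x))) \<in> borel_measurable ((borel \<Otimes>\<^sub>M borel) \<Otimes>\<^sub>M N)"
    by (rule g_measurable_compose) auto
  have q [measurable]: "q \<in> borel_measurable ((borel \<Otimes>\<^sub>M borel) \<Otimes>\<^sub>M N)"
    unfolding q_def by (simp add: case_prod_beta)
  interpret \<nu>: prob_space \<nu> by (rule prob_space_law)
  interpret D: prob_space "distr M (borel \<Otimes>\<^sub>M borel) H" by (rule prob_space_distr) simp
  interpret pair_sigma_finite "distr M (borel \<Otimes>\<^sub>M borel) H" \<nu> ..
  have eq: "distr M ((borel \<Otimes>\<^sub>M borel) \<Otimes>\<^sub>M N) (\<lambda>\<omega>. (H \<omega>, Z n \<omega>)) = distr M (borel \<Otimes>\<^sub>M borel) H \<Otimes>\<^sub>M \<nu>"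
    by (rule distr_past_Z[OF HP])
  have "bdd_rv (\<lambda>\<omega>. P \<omega> \<bullet> (noise n \<omega> - G (iter n \<omega>)))"
    using b by (intro bdd_rv_intros)
  then have int: "integrable M (\<lambda>\<omega>. q (H \<omega>, Z n \<omega>))"
    unfolding q_def H_def noise_def by (auto dest: bdd_rv_integrable)
  then have int': "integrable (distr M (borel \<Otimes>\<^sub>M borel) H \<Otimes>\<^sub>M \<nu>) q"
    unfolding eq[symmetric] by (subst integrable_distr_eq) auto
  have "E (\<lambda>\<omega>. q (H \<omega>, Z n \<omega>)) = (\<integral>x. q x \<partial>(distr M (borel \<Otimes>\<^sub>M borel) H \<Otimes>\<^sub>M \<nu>))"
    unfolding eq[symmetric] by (subst integral_distr) auto
  also have "\<dots> = (\<integral>h. (\<integral>z. q (h, z) \<partial>\<nu>) \<partial>distr M (borel \<Otimes>\<^sub>M borel) H)"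
    using integral_fst'[OF int'] by simp
  also have "\<dots> = (\<integral>h. - (fst h \<bullet> G (snd h)) \<partial>distr M (borel \<Otimes>\<^sub>M borel) H)"
    using integrable_g by (simp add: q_def G_eq)
  also have "\<dots> = E (\<lambda>\<omega>. - (P \<omega> \<bullet> G (iter n \<omega>)))"
    by (subst integral_distr) (auto simp: H_def)
  finally have *: "E (\<lambda>\<omega>. q (H \<omega>, Z n \<omega>)) = - E (\<lambda>\<omega>. P \<omega> \<bullet> G (iter n \<omega>))"
    by simp
  have "E (\<lambda>\<omega>. P \<omega> \<bullet> noise n \<omega>) = E (\<lambda>\<omega>. q (H \<omega>, Z n \<omega>) + P \<omega> \<bullet> G (iter n \<omega>))"
    by (simp add: q_def H_def noise_def inner_add_right)
  also have "\<dots> = E (\<lambda>\<omega>. q (H \<omega>, Z n \<omega>)) + E (\<lambda>\<omega>. P \<omega> \<bullet> G (iter n \<omega>))"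
    using b by (intro Bochner_Integration.integral_add int bdd_rv_integrable bdd_rv_intros)
  finally show ?thesis using * by simp
qed

end

section \<open>A weighted Lyapunov function\<close>

text \<open>A smooth substitute for the norm that never drops below 1. It is the denominator in
  \<open>drift\<close>, and its exponential is the Lyapunov weight.\<close>

definition radius :: "'e::real_inner \<Rightarrow> real" where
  "radius v = sqrt (1 + (norm v)^2)"

lemma radius_ge_1: "1 \<le> radius v"
  by (simp add: radius_def)

lemma radius_neq_0: "radius v \<noteq> 0"
  using radius_ge_1[of v] by linarith

lemma radius_square: "(radius v)^2 = 1 + (norm v)^2"
  by (simp add: radius_def)

lemma norm_le_radius: "norm v \<le> radius v"
  unfolding radius_def by (rule real_le_rsqrt) simp

text \<open>For t = -s < 0 the claim amounts to 1 <= (1 - s + s^2) exp s. Multiplying out with the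
  quadratic Taylor minorant of exp s cancels the terms linear in s and leaves only nonnegative ones
  besides 1.\<close>

lemma exp_le_quadratic:
  fixes t :: real
  assumes "\<bar>t\<bar> \<le> 1"
  shows "exp t \<le> 1 + t + t^2"
proof (cases "t \<ge> 0")
  case True
  then show ?thesis using assms exp_bound[of t] by simp
next
  case False
  define s where "s = - t"
  have s: "s > 0" using False by (simp add: s_def)
  have "1 + s + s^2 / 2 \<le> exp s" using s by (intro exp_lower_Taylor_quadratic) simp
  then have "(1 - s + s^2) * (1 + s + s^2 / 2) \<le> (1 - s + s^2) * exp s"
    by (intro mult_left_mono) (use s sum_squares_bound[of s 1] in \<open>simp_all\<close>)
  moreover have "(1 - s + s^2) * (1 + s + s^2 / 2) = 1 + s^2 / 2 + s ^ 3 / 2 + s ^ 4 / 2"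
    by (simp add: field_simps power2_eq_square power3_eq_cube power4_eq_xxxx)
  moreover have "s^2 / 2 + s ^ 3 / 2 + s ^ 4 / 2 \<ge> 0" using s by simp
  ultimately have "1 \<le> (1 - s + s^2) * exp s" by linarith
  then have "exp (- s) \<le> (1 - s + s^2) * exp s * exp (- s)"
    by (simp add: mult_le_cancel_right1)
  then show ?thesis by (simp add: s_def mult.assoc flip: exp_add)
qed

lemma norm_add_scaleR_square:
  fixes x \<xi> :: "'e::real_inner"
  shows "(norm (x + s *\<^sub>R \<xi>))^2 = (norm x)^2 + 2 * s * (x \<bullet> \<xi>) + (s * norm \<xi>)^2"
  unfolding power_mult_distrib power2_norm_eq_inner
  by (simp add: inner_add_left inner_add_right inner_commute power2_eq_square[of s] algebra_simps)

text \<open>The square root lies below its tangent: \<open>t\<close> is chosen so that the squared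
  radius grows by exactly \<open>2 * radius x * t\<close>, and adding t^2 completes the
  square.\<close>

lemma radius_add_le:
  fixes x \<xi> :: "'e::real_inner"
  assumes "norm \<xi> \<le> R"
  shows "radius (x + s *\<^sub>R \<xi>) \<le> radius x + s * (x \<bullet> \<xi>) / radius x + (s * R)^2 / 2"
proof -
  define t where "t = s * (x \<bullet> \<xi>) / radius x + (s * norm \<xi>)^2 / (2 * radius x)"
  have r: "radius x > 0" using radius_ge_1[of x] by linarith
  have "(radius (x + s *\<^sub>R \<xi>))^2 = (radius x)^2 + 2 * s * (x \<bullet> \<xi>) + (s * norm \<xi>)^2"
    unfolding radius_square norm_add_scaleR_square by simp
  also have "2 * s * (x \<bullet> \<xi>) + (s * norm \<xi>)^2 = 2 * radius x * t"
    using r by (simp add: t_def field_simps)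
  then have "(radius x)^2 + 2 * s * (x \<bullet> \<xi>) + (s * norm \<xi>)^2 = (radius x)^2 + 2 * radius x * t"
    by simp
  also have "\<dots> \<le> (radius x + t)^2" by (simp add: power2_sum)
  finally have sq: "(radius (x + s *\<^sub>R \<xi>))^2 \<le> (radius x + t)^2" .
  \<comment> \<open>Taking roots needs \<open>radius x + t \<ge> 0\<close>; it holds because twice
    the radius times this number is a sum of two squared radii.\<close>
  have "2 * radius x * (radius x + t) = (radius x)^2 + ((radius x)^2 + 2 * radius x * t)"
    by (simp add: algebra_simps power2_eq_square)
  also have "\<dots> = (radius x)^2 + (radius (x + s *\<^sub>R \<xi>))^2"
    using \<open>(radius (x + s *\<^sub>R \<xi>))^2 = _\<close> \<open>_ = (radius x)^2 + 2 * radius x * t\<close> by simp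
  also have "\<dots> \<ge> 0" by simp
  finally have "radius x + t \<ge> 0" using r by (simp add: zero_le_mult_iff)
  with sq have "radius (x + s *\<^sub>R \<xi>) \<le> radius x + t" by (rule power2_le_imp_le)
  moreover have "(s * norm \<xi>)^2 / (2 * radius x) \<le> (s * R)^2 / 2"
  proof -
    have "(s * norm \<xi>)^2 \<le> (s * R)^2"
      unfolding power_mult_distrib using assms by (intro mult_left_mono power_mono) auto
    moreover have "(s * norm \<xi>)^2 / (2 * radius x) \<le> (s * norm \<xi>)^2 / 2"
      using radius_ge_1[of x] by (intro divide_left_mono) auto
    ultimately show ?thesis by simp
  qed
  ultimately show ?thesis by (simp add: t_def)
qed

lemma inner_div_radius_le:
  fixes x \<xi> :: "'e::real_inner"
  assumes "norm \<xi> \<le> R" "0 \<le> s"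
  shows "\<bar>s * (x \<bullet> \<xi>) / radius x\<bar> \<le> s * R"
proof -
  have "\<bar>x \<bullet> \<xi>\<bar> \<le> norm x * norm \<xi>" by (rule Cauchy_Schwarz_ineq2)
  also have "\<dots> \<le> radius x * R"
    using assms norm_le_radius[of x] radius_ge_1[of x] by (intro mult_mono) auto
  finally have "\<bar>x \<bullet> \<xi>\<bar> / radius x \<le> R"
    using radius_ge_1[of x] by (simp add: pos_divide_le_eq mult.commute)
  then have "s * (\<bar>x \<bullet> \<xi>\<bar> / radius x) \<le> s * R" using assms by (intro mult_left_mono)
  then show ?thesis using assms radius_ge_1[of x] by (simp add: abs_mult)
qed

lemma exp_radius_step:
  fixes x \<xi> :: "'e::real_inner"
  assumes "norm \<xi> \<le> R" "0 \<le> s" "s * R \<le> 1 / 2"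
  shows "exp (radius (x + s *\<^sub>R \<xi>)) \<le> exp (radius x) * (1 + s * (x \<bullet> \<xi>) / radius x + 3 * (s * R)^2)"
proof -
  define a where "a = s * (x \<bullet> \<xi>) / radius x"
  define \<rho> where "\<rho> = s * R"
  have "R \<ge> 0" using assms(1) norm_ge_zero order_trans by blast
  then have \<rho>: "0 \<le> \<rho>" "\<rho> \<le> 1 / 2" using assms by (auto simp: \<rho>_def)
  have a: "\<bar>a\<bar> \<le> \<rho>" unfolding a_def \<rho>_def using assms by (intro inner_div_radius_le)
  have \<rho>2: "\<rho>^2 \<le> \<rho> / 2" using \<rho> mult_left_mono[OF \<rho>(2,1)] by (simp add: power2_eq_square)
  define t where "t = a + \<rho>^2 / 2"
  \<comment> \<open>5/4 comes from \<rho> + \<rho>^2/2 with \<rho> <= 1/2. In the end \<rho>^2/2 and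
    t^2 <= 25/16 \<rho>^2 are rounded up together to 3 \<rho>^2.\<close>
  have t: "\<bar>t\<bar> \<le> 5 / 4 * \<rho>" using a \<rho>2 zero_le_power2[of \<rho>] unfolding t_def by linarith
  have "t^2 \<le> (5 / 4 * \<rho>)^2" using t \<rho> by (metis abs_le_square_iff abs_of_nonneg abs_ge_zero order_trans)
  then have t2: "t^2 \<le> 25 / 16 * \<rho>^2" by (simp add: power_mult_distrib power2_eq_square)
  have "exp (radius (x + s *\<^sub>R \<xi>)) \<le> exp (radius x + t)"
    using radius_add_le[OF assms(1), of x s] by (simp add: t_def a_def \<rho>_def)
  also have "\<dots> = exp (radius x) * exp t" by (rule exp_add)
  also have "\<dots> \<le> exp (radius x) * (1 + t + t^2)"
    using t \<rho> by (intro mult_left_mono exp_le_quadratic) auto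
  also have "\<dots> \<le> exp (radius x) * (1 + a + 3 * \<rho>^2)"
    using t2 zero_le_power2[of \<rho>] unfolding t_def by (intro mult_left_mono) (linarith, simp)
  finally show ?thesis by (simp add: a_def \<rho>_def)
qed

text \<open>The first order term in s is kept exactly, with 4|x|^2 from differentiating the fourth
  power and |x|^4 / radius from the weight, because there the noise averages out and the drift acts.
  The rest is of order (s R)^2 or smaller.\<close>

lemma fourth_power_weighted_step:
  fixes x \<xi> :: "'e::real_inner"
  assumes "norm \<xi> \<le> R" "0 \<le> s" "s * R \<le> 1 / 2"
  shows "norm (x + s *\<^sub>R \<xi>) ^ 4 * exp (radius (x + s *\<^sub>R \<xi>))
    \<le> exp (radius x) * (norm x ^ 4 + s * (x \<bullet> \<xi>) * (4 * (norm x)^2 + norm x ^ 4 / radius x)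
        + 10 * (s * R)^2 * norm x ^ 4 + 21 * (s * R)^2 * (norm x)^2 + 7 * (s * R) ^ 4)"
proof -
  define u where "u = (norm x)^2"
  define b where "b = s * (x \<bullet> \<xi>)"
  define \<rho> where "\<rho> = s * R"
  define q where "q = (s * norm \<xi>)^2"
  define r where "r = radius x"
  define a where "a = b / r"
  have u: "u \<ge> 0" by (simp add: u_def)
  have r: "r \<ge> 1" using radius_ge_1 by (simp add: r_def)
  have "R \<ge> 0" using assms(1) norm_ge_zero order_trans by blast
  then have \<rho>: "0 \<le> \<rho>" "\<rho> \<le> 1 / 2" using assms by (auto simp: \<rho>_def)
  have \<rho>2: "\<rho>^2 \<le> 1 / 4" using power_mono[OF \<rho>(2,1), of 2] by (simp add: power2_eq_square)
  have a: "\<bar>a\<bar> \<le> \<rho>" unfolding a_def b_def r_def \<rho>_def using assms by (intro inner_div_radius_le)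
  have q: "0 \<le> q" "q \<le> \<rho>^2"
    unfolding q_def \<rho>_def power_mult_distrib using assms by (auto intro!: mult_left_mono power_mono)
  have "\<bar>b\<bar> \<le> s * (norm x * norm \<xi>)"
    using assms Cauchy_Schwarz_ineq2[of x \<xi>] by (simp add: b_def abs_mult mult_left_mono)
  also have "\<dots> \<le> s * (norm x * R)" using assms by (intro mult_left_mono) auto
  finally have b: "\<bar>b\<bar> \<le> \<rho> * norm x" by (simp add: \<rho>_def mult_ac)
  have "b^2 \<le> (\<rho> * norm x)^2" using b by (metis abs_le_square_iff abs_of_nonneg abs_ge_zero order_trans)
  then have b2: "b^2 \<le> \<rho>^2 * u" by (simp add: u_def power_mult_distrib)
  have nx: "norm x \<le> (1 + u) / 2" using sum_squares_bound[of "norm x" 1] by (simp add: u_def)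
  have q2: "q^2 \<le> \<rho> ^ 4" using power_mono[OF q(2,1), of 2] by simp
  have "norm (x + s *\<^sub>R \<xi>) ^ 4 = ((norm (x + s *\<^sub>R \<xi>))^2)^2" by simp
  also have "(norm (x + s *\<^sub>R \<xi>))^2 = u + 2 * b + q"
    unfolding norm_add_scaleR_square by (simp add: u_def b_def q_def)
  also have "(u + 2 * b + q)^2 = u^2 + 4 * u * b + 4 * b^2 + q^2 + 2 * u * q + 2 * (2 * b * q)"
    by (simp add: algebra_simps power2_eq_square)
  also have "\<dots> \<le> u^2 + 4 * u * b + 4 * b^2 + q^2 + 2 * u * q + 2 * (b^2 + q^2)"
    using sum_squares_bound[of b q] by simp
  also have "\<dots> \<le> u^2 + 4 * u * b + 8 * (\<rho>^2 * u) + 3 * \<rho> ^ 4"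
    using b2 q2 mult_left_mono[OF q(2) u] by (simp add: algebra_simps)
  finally have n4: "norm (x + s *\<^sub>R \<xi>) ^ 4 \<le> u^2 + 4 * u * b + 8 * (\<rho>^2 * u) + 3 * \<rho> ^ 4" .
  define F where "F = 1 + a + 3 * \<rho>^2"
  have F: "0 \<le> F" "F \<le> 9 / 4" using a \<rho> \<rho>2 zero_le_power2[of \<rho>] unfolding F_def by linarith+
  have e: "exp (radius (x + s *\<^sub>R \<xi>)) \<le> exp r * F"
    using exp_radius_step[OF assms, of x] by (simp add: F_def a_def b_def r_def \<rho>_def)
  have "norm (x + s *\<^sub>R \<xi>) ^ 4 * exp (radius (x + s *\<^sub>R \<xi>)) \<le> norm (x + s *\<^sub>R \<xi>) ^ 4 * (exp r * F)"
    by (intro mult_left_mono e) auto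
  also have "\<dots> \<le> (u^2 + 4 * u * b + 8 * (\<rho>^2 * u) + 3 * \<rho> ^ 4) * (exp r * F)"
    using F by (intro mult_right_mono n4) auto
  also have "\<dots> = exp r * ((u^2 + 4 * u * b) * F + (8 * (\<rho>^2 * u) + 3 * \<rho> ^ 4) * F)"
    by (simp add: algebra_simps)
  also have "\<dots> \<le> exp r * (u^2 + b * (4 * u + u^2 / r) + 10 * \<rho>^2 * u^2 + 21 * \<rho>^2 * u + 7 * \<rho> ^ 4)"
  proof (rule mult_left_mono)
    \<comment> \<open>Constants: 8 * 9/4 = 18 and 3 * 9/4 <= 7 arise here. Below, 21 = 18 + 3
      multiplies \<rho>^2 u, and 10 = 3 + 4 + 3 multiplies \<rho>^2 u^2, coming from u^2 * 3
      \<rho>^2, from 4 u b a and from 12 \<rho>^2 u b.\<close>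
    have "(8 * (\<rho>^2 * u) + 3 * \<rho> ^ 4) * F \<le> (8 * (\<rho>^2 * u) + 3 * \<rho> ^ 4) * (9 / 4)"
      using u by (intro mult_left_mono F) auto
    also have "\<dots> \<le> 18 * \<rho>^2 * u + 7 * \<rho> ^ 4" using \<rho> by simp
    finally have 1: "(8 * (\<rho>^2 * u) + 3 * \<rho> ^ 4) * F \<le> 18 * \<rho>^2 * u + 7 * \<rho> ^ 4" .
    have "b^2 / r \<le> \<rho>^2 * u / 1"
      using b2 r u by (intro frac_le) auto
    then have "u * (b^2 / r) \<le> u * (\<rho>^2 * u)" using u by (intro mult_left_mono) auto
    then have 2: "u * b * a \<le> \<rho>^2 * u^2" by (simp add: a_def power2_eq_square mult_ac)
    have "b \<le> 1 / 2 * ((1 + u) / 2)"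
    proof -
      have "b \<le> \<rho> * norm x" using b by linarith
      also have "\<dots> \<le> 1 / 2 * ((1 + u) / 2)" using \<rho> nx by (intro mult_mono) auto
      finally show ?thesis .
    qed
    then have "(12 * \<rho>^2 * u) * b \<le> (12 * \<rho>^2 * u) * (1 / 2 * ((1 + u) / 2))"
      using u by (intro mult_left_mono) auto
    then have 3: "12 * \<rho>^2 * u * b \<le> 3 * \<rho>^2 * u + 3 * \<rho>^2 * u^2"
      by (simp add: algebra_simps power2_eq_square)
    have "(u^2 + 4 * u * b) * F = u^2 + b * (4 * u + u^2 / r) + 3 * \<rho>^2 * u^2 + 4 * (u * b * a) + 12 * \<rho>^2 * u * b"
      by (simp add: F_def a_def algebra_simps)
    also have "\<dots> \<le> u^2 + b * (4 * u + u^2 / r) + 10 * \<rho>^2 * u^2 + 3 * \<rho>^2 * u"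
      using 2 3 by linarith
    finally show "(u^2 + 4 * u * b) * F + (8 * (\<rho>^2 * u) + 3 * \<rho> ^ 4) * F
        \<le> u^2 + b * (4 * u + u^2 / r) + 10 * \<rho>^2 * u^2 + 21 * \<rho>^2 * u + 7 * \<rho> ^ 4"
      using 1 by linarith
  qed simp
  finally show ?thesis
    by (simp add: u_def b_def \<rho>_def r_def)
qed

section \<open>Exponential and fourth moments of the iterates\<close>

context robbins_monro
begin

lemma step_nonneg: "step n \<ge> 0"
  using pos by (simp add: step_def)

lemma eventually_step_le:
  assumes "\<epsilon> > 0"
  shows "\<forall>\<^sub>F n in sequentially. step (Suc n) \<le> \<epsilon>"
proof -
  have "((\<lambda>n. \<gamma> * real (Suc n) powr (- 3 / 4)) \<longlongrightarrow> 0) sequentially"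
    by (intro tendsto_mult_right_zero tendsto_neg_powr filterlim_compose[OF filterlim_real_sequentially filterlim_Suc]) simp
  from order_tendstoD(2)[OF this assms] show ?thesis
    unfolding step_def by (rule eventually_mono) simp
qed

definition weight :: "nat \<Rightarrow> 'a \<Rightarrow> real" where
  "weight n \<omega> = exp (radius (iter n \<omega>))"

lemma weight_ge_1: "1 \<le> weight n \<omega>"
  using radius_ge_1[of "iter n \<omega>"] by (simp add: weight_def)

lemma continuous_on_radius: "continuous_on S (radius :: 'e \<Rightarrow> real)"
  unfolding radius_def[abs_def] by (intro continuous_intros)

lemma bdd_rv_iter_continuous: "continuous_on UNIV h \<Longrightarrow> bdd_rv (\<lambda>\<omega>. h (iter n \<omega>))"
  by (rule bdd_rv_continuous[OF _ bdd_rv_iter])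

lemma bdd_rv_weight [bdd_rv_intros]: "bdd_rv (\<lambda>\<omega>. weight n \<omega>)"
  unfolding weight_def by (intro bdd_rv_iter_continuous continuous_intros continuous_on_radius)

lemma expectation_iter_noise:
  assumes "continuous_on UNIV h"
  shows "E (\<lambda>\<omega>. h (iter n \<omega>) * (iter n \<omega> \<bullet> noise n \<omega>)) = 0"
proof -
  have "(\<lambda>\<omega>. h (iter n \<omega>) *\<^sub>R iter n \<omega>) \<in> borel_measurable (past n)"
    using borel_measurable_continuous_on[OF assms iter_measurable_past[OF order_refl, of n]]
      iter_measurable_past[OF order_refl, of n] by measurable
  moreover have "bdd_rv (\<lambda>\<omega>. h (iter n \<omega>) *\<^sub>R iter n \<omega>)"
    using assms by (intro bdd_rv_intros bdd_rv_iter_continuous)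
  ultimately have "E (\<lambda>\<omega>. (h (iter n \<omega>) *\<^sub>R iter n \<omega>) \<bullet> noise n \<omega>) = 0"
    by (rule expectation_past_noise)
  then show ?thesis by simp
qed

lemma drift_radius: "c * ((norm v)^2 / radius v) \<le> v \<bullet> G v"
  using drift by (simp add: radius_def)

lemma AE_update: "AE \<omega> in M. norm (noise n \<omega> - G (iter n \<omega>)) \<le> R"
  using AE_g by eventually_elim (simp add: noise_def)

text \<open>The drift changes the weight by -s exp(r) (v . G v)/r to first order. Outside the unit
  ball \<open>drift\<close> makes this at most -(c/2) s exp(r); inside it the weight is at most exp
  2, which explains the constant source.\<close>

lemma weight_recursion:
  assumes s: "step (Suc n) * R \<le> 1 / 2"
  shows "E (weight (Suc n))
    \<le> (1 - c / 2 * step (Suc n) + 3 * (step (Suc n) * R)^2) * E (weight n) + c * exp 2 * step (Suc n)"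
proof -
  define s where "s = step (Suc n)"
  have s0: "s \<ge> 0" by (simp add: s_def step_nonneg)
  \<comment> \<open>\<open>h\<close> is the factor of
    \<open>iter n \<omega> \<bullet> noise n \<omega>\<close> in the expansion; it depends on the
    current iterate only, so the whole term has mean zero.\<close>
  define h where "h v = exp (radius v) * (s / radius v)" for v :: 'e
  have h: "continuous_on UNIV h"
    unfolding h_def[abs_def]
    by (intro continuous_intros continuous_on_radius ballI radius_neq_0)
  have "E (weight (Suc n)) \<le> E (\<lambda>\<omega>. (1 - c / 2 * s + 3 * (s * R)^2) * weight n \<omega>
      + c * exp 2 * s + h (iter n \<omega>) * (iter n \<omega> \<bullet> noise n \<omega>))"
  proof (rule integral_mono_AE)
    show "integrable M (weight (Suc n))"
      by (rule bdd_rv_integrable[OF bdd_rv_weight])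
    show "integrable M (\<lambda>\<omega>. (1 - c / 2 * s + 3 * (s * R)^2) * weight n \<omega>
      + c * exp 2 * s + h (iter n \<omega>) * (iter n \<omega> \<bullet> noise n \<omega>))"
      by (intro bdd_rv_integrable bdd_rv_intros bdd_rv_iter_continuous[OF h])
    show "AE \<omega> in M. weight (Suc n) \<omega> \<le> (1 - c / 2 * s + 3 * (s * R)^2) * weight n \<omega>
      + c * exp 2 * s + h (iter n \<omega>) * (iter n \<omega> \<bullet> noise n \<omega>)"
      using AE_update[of n]
    proof eventually_elim
      case (elim \<omega>)
      define v where "v = iter n \<omega>"
      define r where "r = radius v"
      have r: "r \<ge> 1" using radius_ge_1 by (simp add: r_def)
      have "weight (Suc n) \<omega> \<le> exp r * (1 + s * (v \<bullet> (noise n \<omega> - G v)) / r + 3 * (s * R)^2)"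
        using exp_radius_step[OF elim, of "step (Suc n)" "iter n \<omega>"] s s0
        unfolding weight_def iter_Suc_noise v_def r_def s_def by simp
      also have "\<dots> = (1 + 3 * (s * R)^2) * exp r + h v * (v \<bullet> noise n \<omega>) - s * (exp r * ((v \<bullet> G v) / r))"
        using r by (simp add: h_def r_def[symmetric] inner_diff_right field_simps)
      also have "exp r * ((v \<bullet> G v) / r) \<ge> c * (exp r / 2 - exp 2)"
      proof -
        have "c * ((norm v)^2 / r^2) = c * ((norm v)^2 / r) / r" by (simp add: power2_eq_square)
        also have "\<dots> \<le> (v \<bullet> G v) / r"
          using drift_radius[of v] r unfolding r_def by (intro divide_right_mono) auto
        finally have 1: "c * ((norm v)^2 / r^2) \<le> (v \<bullet> G v) / r" .
        have "exp r / 2 - exp 2 \<le> exp r * ((norm v)^2 / r^2)"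
        proof (cases "(norm v)^2 \<ge> 1")
          case True
          then have "1 / 2 \<le> (norm v)^2 / r^2"
            unfolding r_def radius_square by (subst pos_le_divide_eq) auto
          then have "exp r * (1 / 2) \<le> exp r * ((norm v)^2 / r^2)" by (intro mult_left_mono) auto
          then show ?thesis using exp_ge_zero[of "2::real"] by linarith
        next
          case False
          then have "r^2 \<le> 2^2" by (simp add: r_def radius_square)
          then have "r \<le> 2" by (rule power2_le_imp_le) simp
          then have "exp r \<le> exp 2" by simp
          moreover have "exp r / 2 \<le> exp r" by simp
          ultimately have "exp r / 2 - exp 2 \<le> 0" by linarith
          also have "0 \<le> exp r * ((norm v)^2 / r^2)" by simp
          finally show ?thesis .
        qed
        then have "c * (exp r / 2 - exp 2) \<le> c * (exp r * ((norm v)^2 / r^2))"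
          using pos by (intro mult_left_mono) auto
        also have "\<dots> = exp r * (c * ((norm v)^2 / r^2))" by simp
        also have "\<dots> \<le> exp r * ((v \<bullet> G v) / r)" by (intro mult_left_mono 1) auto
        finally show ?thesis .
      qed
      then have "(1 + 3 * (s * R)^2) * exp r + h v * (v \<bullet> noise n \<omega>) - s * (exp r * ((v \<bullet> G v) / r))
        \<le> (1 + 3 * (s * R)^2) * exp r + h v * (v \<bullet> noise n \<omega>) - s * (c * (exp r / 2 - exp 2))"
        using s0 by (intro diff_left_mono mult_left_mono)
      also have "\<dots> = (1 - c / 2 * s + 3 * (s * R)^2) * exp r + c * exp 2 * s + h v * (v \<bullet> noise n \<omega>)"
        by (simp add: algebra_simps)
      finally show ?case by (simp add: weight_def v_def r_def)
    qed
  qed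
  also have "\<dots> = (1 - c / 2 * s + 3 * (s * R)^2) * E (weight n) + c * exp 2 * s
      + E (\<lambda>\<omega>. h (iter n \<omega>) * (iter n \<omega> \<bullet> noise n \<omega>))"
  proof -
    have [simp]: "integrable M (\<lambda>\<omega>. h (iter n \<omega>) * (iter n \<omega> \<bullet> noise n \<omega>))" "integrable M (weight n)"
      by (intro bdd_rv_integrable bdd_rv_intros bdd_rv_iter_continuous[OF h] bdd_rv_weight)+
    show ?thesis by (simp add: prob_space)
  qed
  finally show ?thesis by (simp add: expectation_iter_noise[OF h] s_def)
qed

text \<open>Contraction and source are both of order \<open>step\<close>, so the rate exponent is 0.
  The bound is needed because the source of the fourth moment recursion is multiplied by the
  weight.\<close>

lemma expectation_weight_bounded:
  obtains K where "K > 0" "\<And>n. E (weight n) \<le> K"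
proof -
  \<comment> \<open>The first threshold permits the one-step expansion; the second makes 3 (s R)^2
    at most half of the contraction (c/2) s.\<close>
  have e: "\<forall>\<^sub>F n in sequentially. step (Suc n) \<le> 1 / (2 * R)"
      "\<forall>\<^sub>F n in sequentially. step (Suc n) \<le> c / (12 * R^2)"
    using pos by (auto intro: eventually_step_le)
  have "\<forall>\<^sub>F n in sequentially. E (weight (Suc n)) \<le>
    (1 - (c / 4 * \<gamma>) * real (Suc n) powr - (3 / 4)) * E (weight n) + (c * exp 2 * \<gamma>) * real (Suc n) powr - (0 + 3 / 4)"
    using e
  proof eventually_elim
    case (elim n)
    define s where "s = step (Suc n)"
    have s: "s \<ge> 0" "s \<le> c / (12 * R^2)" using elim by (auto simp: s_def step_nonneg)
    have sR: "step (Suc n) * R \<le> 1 / 2" using elim(1) pos by (simp add: field_simps)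
    have "s * s * (12 * R^2) \<le> s * c"
      using s pos mult_left_mono[OF s(2) s(1)] by (simp add: field_simps)
    then have *: "3 * (s * R)^2 \<le> c / 4 * s" by (simp add: power2_eq_square algebra_simps)
    have "E (weight (Suc n)) \<le> (1 - c / 2 * s + 3 * (s * R)^2) * E (weight n) + c * exp 2 * s"
      using weight_recursion[OF sR] by (simp add: s_def)
    also have "\<dots> \<le> (1 - c / 4 * s) * E (weight n) + c * exp 2 * s"
      using * by (intro add_right_mono mult_right_mono Bochner_Integration.integral_nonneg)
        (auto simp: weight_def)
    finally show ?case by (simp add: s_def step_def algebra_simps del: of_nat_Suc)
  qed
  then obtain K where "K > 0" "\<And>n. E (weight n) \<le> K * real (Suc n) powr - 0"
    by (rule recursion_rate[rotated 4]) (use pos in auto)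
  with that[of K] show ?thesis by simp
qed

text \<open>Drift times the derivative of the weighted fourth power contracts at rate c over the
  whole space. A quarter of c is then spent on the second order term that is only quadratic in the
  norm, which leaves 3c/4 and a source of order s^3.\<close>

lemma fourth_moment_recursion:
  assumes s: "step (Suc n) * R \<le> 1 / 2"
  shows "E (\<lambda>\<omega>. norm (iter (Suc n) \<omega>) ^ 4 * weight (Suc n) \<omega>)
    \<le> (1 - 3 * c / 4 * step (Suc n) + 10 * (step (Suc n) * R)^2) * E (\<lambda>\<omega>. norm (iter n \<omega>) ^ 4 * weight n \<omega>)
      + (441 * R ^ 4 / c * step (Suc n) ^ 3 + 7 * (step (Suc n) * R) ^ 4) * E (weight n)"
proof -
  define s where "s = step (Suc n)"
  have s0: "s \<ge> 0" by (simp add: s_def step_nonneg)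
  define V where "V n \<omega> = norm (iter n \<omega>) ^ 4 * weight n \<omega>" for n \<omega>
  define h where "h v = exp (radius v) * (s * (4 * (norm v)^2 + norm v ^ 4 / radius v))" for v :: 'e
  have h: "continuous_on UNIV h"
    unfolding h_def[abs_def]
    by (intro continuous_intros continuous_on_radius ballI radius_neq_0)
  have V [bdd_rv_intros]: "bdd_rv (\<lambda>\<omega>. V k \<omega>)" for k
    unfolding V_def by (intro bdd_rv_intros)
  define a b where "a = 1 - 3 * c / 4 * s + 10 * (s * R)^2" and "b = 441 * R ^ 4 / c * s ^ 3 + 7 * (s * R) ^ 4"
  have "E (V (Suc n)) \<le> E (\<lambda>\<omega>. a * V n \<omega> + b * weight n \<omega>
      + h (iter n \<omega>) * (iter n \<omega> \<bullet> noise n \<omega>))"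
  proof (rule integral_mono_AE)
    show "integrable M (V (Suc n))"
      by (rule bdd_rv_integrable[OF V])
    show "integrable M (\<lambda>\<omega>. a * V n \<omega> + b * weight n \<omega> + h (iter n \<omega>) * (iter n \<omega> \<bullet> noise n \<omega>))"
      by (intro bdd_rv_integrable bdd_rv_intros bdd_rv_iter_continuous[OF h])
    show "AE \<omega> in M. V (Suc n) \<omega> \<le> a * V n \<omega> + b * weight n \<omega> + h (iter n \<omega>) * (iter n \<omega> \<bullet> noise n \<omega>)"
      using AE_update[of n]
    proof eventually_elim
      case (elim \<omega>)
      define v where "v = iter n \<omega>"
      define r where "r = radius v"
      define u where "u = (norm v)^2"
      have u: "u \<ge> 0" and u2: "norm v ^ 4 = u^2" by (simp_all add: u_def)
      have r: "r \<ge> 1" using radius_ge_1 by (simp add: r_def)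
      have "V (Suc n) \<omega> \<le> exp r * (u^2 + s * (v \<bullet> (noise n \<omega> - G v)) * (4 * u + u^2 / r)
        + 10 * (s * R)^2 * u^2 + 21 * (s * R)^2 * u + 7 * (s * R) ^ 4)"
        using fourth_power_weighted_step[OF elim, of "step (Suc n)" "iter n \<omega>"] s s0
        unfolding V_def weight_def iter_Suc_noise v_def[symmetric] r_def[symmetric] s_def[symmetric] u_def[symmetric] u2
        by simp
      also have "\<dots> = h v * (v \<bullet> noise n \<omega>) + exp r * (u^2 - s * ((v \<bullet> G v) * (4 * u + u^2 / r))
        + 10 * (s * R)^2 * u^2 + 21 * (s * R)^2 * u + 7 * (s * R) ^ 4)"
        unfolding h_def u2 u_def[symmetric] r_def[symmetric] by (simp add: inner_diff_right algebra_simps)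
      also have "\<dots> \<le> h v * (v \<bullet> noise n \<omega>) + exp r * (a * u^2 + b)"
      proof (intro add_left_mono mult_left_mono)
        \<comment> \<open>With r^2 = 1 + u this shows 4/r + u/r^2 >= 1: near the root the term 4/r
          of the fourth power dominates, far away the term u/r^2 of the weight.\<close>
        have "1 \<le> (4 + u) / r^2"
          using u unfolding r_def radius_square u_def[symmetric] by simp
        also have "\<dots> = 4 / r^2 + u / r^2" by (simp add: add_divide_distrib)
        also have "4 / r^2 \<le> 4 / r"
          using r by (intro divide_left_mono) (auto simp: power2_eq_square)
        finally have "u^2 * 1 \<le> u^2 * (4 / r + u / r^2)" by (intro mult_left_mono) auto
        then have "c * u^2 \<le> c * (u^2 * (4 / r + u / r^2))" using pos by (intro mult_left_mono) auto
        also have "\<dots> = c * (u / r) * (4 * u + u^2 / r)"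
          using r by (simp add: field_simps power2_eq_square)
        also have "\<dots> \<le> (v \<bullet> G v) * (4 * u + u^2 / r)"
          using drift_radius[of v] u r unfolding r_def[symmetric] u_def[symmetric]
          by (intro mult_right_mono) auto
        finally have 1: "s * (c * u^2) \<le> s * ((v \<bullet> G v) * (4 * u + u^2 / r))"
          using s0 by (intro mult_left_mono)
        \<comment> \<open>Young's inequality trades the term s^2 u for s u^2, absorbed by the
          contraction, plus s^3; 441 is 21 squared.\<close>
        have "21 * s * R^2 * u \<le> c / 4 * u^2 + 441 * R ^ 4 / c * s^2"
        proof -
          have "0 \<le> (c / 2 * u - 21 * s * R^2)^2 / c" using pos by auto
          also have "\<dots> = c / 4 * u^2 + 441 * R ^ 4 / c * s^2 - 21 * s * R^2 * u"
            using pos by (simp add: power2_diff field_simps power2_eq_square power4_eq_xxxx)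
          finally show ?thesis by simp
        qed
        then have "s * (21 * s * R^2 * u) \<le> s * (c / 4 * u^2 + 441 * R ^ 4 / c * s^2)"
          using s0 by (intro mult_left_mono)
        then have 2: "21 * (s * R)^2 * u \<le> s * (c / 4 * u^2) + 441 * R ^ 4 / c * s ^ 3"
          by (simp add: algebra_simps power2_eq_square power3_eq_cube)
        have "a * u^2 + b = u^2 - s * (c * u^2) + s * (c / 4 * u^2) + 10 * (s * R)^2 * u^2
            + 441 * R ^ 4 / c * s ^ 3 + 7 * (s * R) ^ 4"
          by (simp add: a_def b_def algebra_simps)
        with 1 2 show "u^2 - s * ((v \<bullet> G v) * (4 * u + u^2 / r)) + 10 * (s * R)^2 * u^2
            + 21 * (s * R)^2 * u + 7 * (s * R) ^ 4 \<le> a * u^2 + b" by linarith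
      qed simp
      also have "\<dots> = a * V n \<omega> + b * weight n \<omega> + h v * (v \<bullet> noise n \<omega>)"
        unfolding V_def weight_def v_def[symmetric] u2 r_def by (simp add: algebra_simps)
      finally show ?case by (simp add: v_def)
    qed
  qed
  also have "\<dots> = a * E (V n) + b * E (weight n)
      + E (\<lambda>\<omega>. h (iter n \<omega>) * (iter n \<omega> \<bullet> noise n \<omega>))"
  proof -
    have [simp]: "integrable M (\<lambda>\<omega>. h (iter n \<omega>) * (iter n \<omega> \<bullet> noise n \<omega>))" "integrable M (weight n)"
       "integrable M (V n)"
      by (intro bdd_rv_integrable bdd_rv_intros bdd_rv_iter_continuous[OF h] bdd_rv_weight V)+
    show ?thesis by simp
  qed
  finally show ?thesis by (simp add: expectation_iter_noise[OF h] s_def a_def b_def V_def[abs_def])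
qed

lemma fourth_moment_bound:
  obtains K where "K > 0" "\<And>n. E (\<lambda>\<omega>. norm (iter n \<omega>) ^ 4) \<le> K * real (Suc n) powr - (3 / 2)"
proof -
  define V where "V n \<omega> = norm (iter n \<omega>) ^ 4 * weight n \<omega>" for n \<omega>
  have V [bdd_rv_intros]: "bdd_rv (\<lambda>\<omega>. V k \<omega>)" for k
    unfolding V_def by (intro bdd_rv_intros)
  obtain KW where KW: "KW > 0" "\<And>n. E (weight n) \<le> KW"
    using expectation_weight_bounded by blast
  define C where "C = 441 * R ^ 4 / c + 7 * \<gamma> * R ^ 4"
  \<comment> \<open>c / (40 R^2) lowers the contraction constant from 3c/4 to c/2, and step <=
    \<gamma> reduces the fourth power of the step to its third power.\<close>
  have e: "\<forall>\<^sub>F n in sequentially. step (Suc n) \<le> 1 / (2 * R)"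
      "\<forall>\<^sub>F n in sequentially. step (Suc n) \<le> c / (40 * R^2)"
      "\<forall>\<^sub>F n in sequentially. step (Suc n) \<le> \<gamma>"
    using pos by (auto intro: eventually_step_le)
  have "\<forall>\<^sub>F n in sequentially. E (V (Suc n)) \<le>
    (1 - (c / 2 * \<gamma>) * real (Suc n) powr - (3 / 4)) * E (V n)
      + (C * \<gamma> ^ 3 * KW) * real (Suc n) powr - (3 / 2 + 3 / 4)"
    using e
  proof eventually_elim
    case (elim n)
    define s where "s = step (Suc n)"
    have s: "s \<ge> 0" "s \<le> c / (40 * R^2)" "s \<le> \<gamma>" using elim by (auto simp: s_def step_nonneg)
    have sR: "step (Suc n) * R \<le> 1 / 2" using elim(1) pos by (simp add: field_simps)
    have "s * s * (40 * R^2) \<le> s * c"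
      using s pos mult_left_mono[OF s(2) s(1)] by (simp add: field_simps)
    then have *: "10 * (s * R)^2 \<le> c / 4 * s" by (simp add: power2_eq_square algebra_simps)
    have s3: "s ^ 3 = \<gamma> ^ 3 * real (Suc n) powr - (3 / 2 + 3 / 4)"
      by (simp add: s_def step_def power_mult_distrib powr_power)
    have "(s * R) ^ 4 = s * (s ^ 3 * R ^ 4)" by (simp add: power_mult_distrib power4_eq_xxxx power3_eq_cube)
    also have "\<dots> \<le> \<gamma> * (s ^ 3 * R ^ 4)" using s by (intro mult_right_mono) auto
    finally have s4: "441 * R ^ 4 / c * s ^ 3 + 7 * (s * R) ^ 4 \<le> C * s ^ 3"
      by (simp add: C_def algebra_simps)
    have "E (V (Suc n)) \<le> (1 - 3 * c / 4 * s + 10 * (s * R)^2) * E (V n)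
        + (441 * R ^ 4 / c * s ^ 3 + 7 * (s * R) ^ 4) * E (weight n)"
      using fourth_moment_recursion[OF sR] by (simp add: s_def V_def[abs_def])
    also have "\<dots> \<le> (1 - c / 2 * s) * E (V n) + (C * s ^ 3) * KW"
    proof (rule add_mono)
      have "0 \<le> E (V n)" and *: "0 \<le> E (weight n)"
        by (auto simp: weight_def V_def intro!: Bochner_Integration.integral_nonneg)
      then show "(1 - 3 * c / 4 * s + 10 * (s * R)^2) * E (V n) \<le> (1 - c / 2 * s) * E (V n)"
        using \<open>10 * (s * R)^2 \<le> _\<close> by (intro mult_right_mono) auto
      show "(441 * R ^ 4 / c * s ^ 3 + 7 * (s * R) ^ 4) * E (weight n) \<le> C * s ^ 3 * KW"
        using pos s * by (intro mult_mono s4 KW) (auto simp: C_def)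
    qed
    also have "\<dots> = (1 - (c / 2 * \<gamma>) * real (Suc n) powr - (3 / 4)) * E (V n)
      + (C * \<gamma> ^ 3 * KW) * real (Suc n) powr - (3 / 2 + 3 / 4)"
      unfolding s3 by (simp add: s_def step_def)
    finally show ?case by simp
  qed
  then obtain K where K: "K > 0" "\<And>n. E (V n) \<le> K * real (Suc n) powr - (3 / 2)"
    by (rule recursion_rate[rotated 4]) (use pos in auto)
  have "E (\<lambda>\<omega>. norm (iter n \<omega>) ^ 4) \<le> E (V n)" for n
  proof (rule integral_mono)
    show "integrable M (\<lambda>\<omega>. norm (iter n \<omega>) ^ 4)" "integrable M (V n)"
      by (intro bdd_rv_integrable bdd_rv_intros V)+
    show "norm (iter n \<omega>) ^ 4 \<le> V n \<omega>" for \<omega>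
      using mult_left_mono[OF weight_ge_1[of n \<omega>], of "norm (iter n \<omega>) ^ 4"] by (simp add: V_def)
  qed
  with K that show ?thesis by (meson order_trans)
qed

end

section \<open>Moments and correlation with the martingale part\<close>

lemma le_mult_square_plus_inverse:
  fixes p x :: real
  assumes "p > 0"
  shows "x \<le> p * x^2 + inverse p"
proof -
  have "0 \<le> p * ((x - inverse p)^2 + x^2 + (inverse p)^2)" using assms by auto
  also have "\<dots> = 2 * (p * x^2 - x + inverse p)"
    using assms by (simp add: power2_diff field_simps power2_eq_square)
  finally show ?thesis by simp
qed

context robbins_monro
begin

text \<open>Minkowski's inequality in L^2, with \<open>w k\<close> bounding the L^2 norm of
  \<open>x k\<close>. Cauchy-Schwarz with these weights gives it pointwise before any expectation is
  taken.\<close>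

lemma expectation_minkowski:
  fixes x :: "nat \<Rightarrow> 'a \<Rightarrow> 'v::euclidean_space"
  assumes x: "\<And>k. k \<in> I \<Longrightarrow> bdd_rv (x k)" and w: "\<And>k. k \<in> I \<Longrightarrow> 0 < w k"
    and le: "\<And>k. k \<in> I \<Longrightarrow> E (\<lambda>\<omega>. (norm (x k \<omega>))^2) \<le> (w k)^2"
  shows "E (\<lambda>\<omega>. (norm (\<Sum>k\<in>I. x k \<omega>))^2) \<le> (\<Sum>k\<in>I. w k)^2"
proof -
  have bdd: "bdd_rv (\<lambda>\<omega>. (norm (x k \<omega>))^2 / w k)" if "k \<in> I" for k
    unfolding divide_inverse using x[OF that] by (intro bdd_rv_intros)
  have "(norm (\<Sum>k\<in>I. x k \<omega>))^2 \<le> (\<Sum>k\<in>I. w k) * (\<Sum>k\<in>I. (norm (x k \<omega>))^2 / w k)" for \<omega>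
  proof -
    have "(norm (\<Sum>k\<in>I. x k \<omega>))^2 \<le> (\<Sum>k\<in>I. norm (x k \<omega>))^2"
      by (intro power_mono norm_sum) auto
    also have "\<dots> = (\<Sum>k\<in>I. sqrt (w k) * (norm (x k \<omega>) / sqrt (w k)))^2"
      using w by (intro arg_cong[where f = "\<lambda>x. x^2"] sum.cong) (auto simp: order.strict_implies_not_eq[symmetric])
    also have "\<dots> \<le> (\<Sum>k\<in>I. (sqrt (w k))^2) * (\<Sum>k\<in>I. (norm (x k \<omega>) / sqrt (w k))^2)"
      by (rule Cauchy_Schwarz_ineq_sum)
    also have "\<dots> = (\<Sum>k\<in>I. w k) * (\<Sum>k\<in>I. (norm (x k \<omega>))^2 / w k)"
      using w by (intro arg_cong2[where f = "(*)"] sum.cong) (auto simp: power_divide less_imp_le)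
    finally show ?thesis .
  qed
  then have "E (\<lambda>\<omega>. (norm (\<Sum>k\<in>I. x k \<omega>))^2)
      \<le> E (\<lambda>\<omega>. (\<Sum>k\<in>I. w k) * (\<Sum>k\<in>I. (norm (x k \<omega>))^2 / w k))"
    using x bdd by (intro integral_mono bdd_rv_integrable bdd_rv_intros)
  also have "\<dots> = (\<Sum>k\<in>I. w k) * (\<Sum>k\<in>I. E (\<lambda>\<omega>. (norm (x k \<omega>))^2 / w k))"
    using bdd_rv_integrable[OF bdd] by simp
  also have "\<dots> \<le> (\<Sum>k\<in>I. w k) * (\<Sum>k\<in>I. w k)"
  proof (intro mult_left_mono sum_mono sum_nonneg)
    fix k assume k: "k \<in> I"
    have "E (\<lambda>\<omega>. (norm (x k \<omega>))^2 / w k) \<le> (w k)^2 / w k"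
      using le[OF k] w[OF k] by (simp add: divide_right_mono)
    then show "E (\<lambda>\<omega>. (norm (x k \<omega>))^2 / w k) \<le> w k"
      using w[OF k] by (simp add: power2_eq_square)
  qed (use w in \<open>auto intro: less_imp_le\<close>)
  finally show ?thesis by (simp add: power2_eq_square)
qed

text \<open>Replaces Jensen's inequality: in P <= p P^2 + 1/p the choice p = (n+1)^q gives both
  terms the order (n+1)^(-q).\<close>

lemma expectation_le_of_square:
  assumes P: "bdd_rv P" and K: "E (\<lambda>\<omega>. (P \<omega>)^2) \<le> K * real (Suc n) powr - (2 * q)"
  shows "E P \<le> (K + 1) * real (Suc n) powr - q"
proof -
  define p where "p = real (Suc n) powr q"
  have p: "p > 0" by (simp add: p_def)
  have pw: "p * real (Suc n) powr - (2 * q) = real (Suc n) powr - q" "inverse p = real (Suc n) powr - q"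
    by (simp add: p_def flip: powr_add del: of_nat_Suc, simp add: p_def powr_minus del: of_nat_Suc)
  have [simp]: "integrable M (\<lambda>\<omega>. (P \<omega>)^2)" using P by (intro bdd_rv_integrable bdd_rv_intros)
  have "E P \<le> E (\<lambda>\<omega>. p * (P \<omega>)^2 + inverse p)"
    using P by (intro integral_mono le_mult_square_plus_inverse p bdd_rv_integrable bdd_rv_intros)
  also have "\<dots> = p * E (\<lambda>\<omega>. (P \<omega>)^2) + inverse p"
    by (simp add: prob_space)
  also have "\<dots> \<le> p * (K * real (Suc n) powr - (2 * q)) + inverse p"
    using p by (intro add_right_mono mult_left_mono K) auto
  also have "\<dots> = (K + 1) * real (Suc n) powr - q"
    using pw by (simp add: algebra_simps del: of_nat_Suc)
  finally show ?thesis .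
qed

lemma second_moment_bound:
  obtains K where "K > 0" "\<And>n. E (\<lambda>\<omega>. (norm (iter n \<omega>))^2) \<le> K * real (Suc n) powr - (3 / 4)"
proof -
  obtain K where K: "K > 0" "\<And>n. E (\<lambda>\<omega>. norm (iter n \<omega>) ^ 4) \<le> K * real (Suc n) powr - (3 / 2)"
    using fourth_moment_bound by blast
  have "E (\<lambda>\<omega>. (norm (iter n \<omega>))^2) \<le> (K + 1) * real (Suc n) powr - (3 / 4)" for n
    using K(2)[of n] by (intro expectation_le_of_square bdd_rv_intros) simp
  with that[of "K + 1"] K show ?thesis by simp
qed

lemma first_moment_bound:
  obtains K where "K > 0" "\<And>n. E (\<lambda>\<omega>. norm (iter n \<omega>)) \<le> K * real (Suc n) powr - (3 / 8)"
proof -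
  obtain K where K: "K > 0" "\<And>n. E (\<lambda>\<omega>. (norm (iter n \<omega>))^2) \<le> K * real (Suc n) powr - (3 / 4)"
    using second_moment_bound by blast
  have "E (\<lambda>\<omega>. norm (iter n \<omega>)) \<le> (K + 1) * real (Suc n) powr - (3 / 8)" for n
    using K(2)[of n] by (intro expectation_le_of_square bdd_rv_intros) simp
  with that[of "K + 1"] K show ?thesis by simp
qed

text \<open>The sum starts at 1 because the average starts at the first iterate, and stops before
  \<open>n\<close> so that \<open>mart n\<close> is measurable for \<open>past n\<close>.\<close>

definition mart :: "nat \<Rightarrow> 'a \<Rightarrow> 'e" where
  "mart n \<omega> = (\<Sum>k\<in>{1..<n}. noise k \<omega>)"

lemma mart_Suc: "n \<ge> 1 \<Longrightarrow> mart (Suc n) \<omega> = mart n \<omega> + noise n \<omega>"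
  by (simp add: mart_def)

lemma mart_measurable_past: "mart n \<in> borel_measurable (past n)"
  unfolding mart_def[abs_def] by (intro borel_measurable_sum noise_measurable_past) auto

lemma bdd_rv_mart [bdd_rv_intros]: "bdd_rv (\<lambda>\<omega>. mart n \<omega>)"
  unfolding mart_def by (intro bdd_rv_intros)

lemma linear_measurable_past:
  fixes B :: "'e \<Rightarrow> 'v::euclidean_space"
  assumes "linear B" "P \<in> borel_measurable (past n)"
  shows "(\<lambda>\<omega>. B (P \<omega>)) \<in> borel_measurable (past n)"
  by (rule borel_measurable_continuous_on[OF _ assms(2)])
    (use assms in \<open>auto intro: linear_continuous_on simp: linear_conv_bounded_linear\<close>)

text \<open>Orthogonality of martingale increments. The adjoint moves \<open>B\<close> onto the past
  factor, so that \<open>expectation_past_noise\<close> kills the mixed term.\<close>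

lemma second_moment_mart:
  fixes B :: "'e \<Rightarrow> 'v::euclidean_space"
  assumes B: "linear B"
  shows "E (\<lambda>\<omega>. (norm (B (mart n \<omega>)))^2) = (\<Sum>k\<in>{1..<n}. E (\<lambda>\<omega>. (norm (B (noise k \<omega>)))^2))"
proof (induction n)
  case 0
  then show ?case by (simp add: mart_def linear_0[OF B])
next
  case (Suc n)
  show ?case
  proof (cases "n = 0")
    case True
    then show ?thesis by (simp add: mart_def linear_0[OF B])
  next
    case False
    note [bdd_rv_intros] = bdd_rv_linear[OF B] bdd_rv_linear[OF adjoint_linear[OF B]]
    have [simp]: "integrable M (\<lambda>\<omega>. (norm (B (mart n \<omega>)))^2)" "integrable M (\<lambda>\<omega>. (norm (B (noise n \<omega>)))^2)"
      "integrable M (\<lambda>\<omega>. adjoint B (B (mart n \<omega>)) \<bullet> noise n \<omega>)"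
      by (intro bdd_rv_integrable bdd_rv_intros)+
    have "(norm (B (mart (Suc n) \<omega>)))^2
        = (norm (B (mart n \<omega>)))^2 + 2 * (adjoint B (B (mart n \<omega>)) \<bullet> noise n \<omega>) + (norm (B (noise n \<omega>)))^2" for \<omega>
      using False adjoint_works[OF B, of "noise n \<omega>" "B (mart n \<omega>)"]
      unfolding power2_norm_eq_inner
      by (simp add: mart_Suc linear_add[OF B] inner_add_left inner_add_right inner_commute)
    then have "E (\<lambda>\<omega>. (norm (B (mart (Suc n) \<omega>)))^2) = E (\<lambda>\<omega>. (norm (B (mart n \<omega>)))^2)
        + 2 * E (\<lambda>\<omega>. adjoint B (B (mart n \<omega>)) \<bullet> noise n \<omega>) + E (\<lambda>\<omega>. (norm (B (noise n \<omega>)))^2)"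
      by simp
    also have "E (\<lambda>\<omega>. adjoint B (B (mart n \<omega>)) \<bullet> noise n \<omega>) = 0"
      using linear_measurable_past[OF linear_compose[OF B adjoint_linear[OF B]] mart_measurable_past[of n]]
      by (intro expectation_past_noise bdd_rv_intros) (simp add: comp_def)
    finally show ?thesis using Suc False by simp
  qed
qed

lemma second_moment_noise_le: "E (\<lambda>\<omega>. (norm (noise k \<omega>))^2) \<le> 4 * R^2"
proof -
  have "E (\<lambda>\<omega>. (norm (noise k \<omega>))^2) \<le> E (\<lambda>\<omega>. 4 * R^2)"
  proof (intro integral_mono_AE bdd_rv_integrable bdd_rv_intros)
    show "AE \<omega> in M. (norm (noise k \<omega>))^2 \<le> 4 * R^2"
      using AE_noise
    proof eventually_elim
      case (elim \<omega>)
      then have "(norm (noise k \<omega>))^2 \<le> (2 * R)^2" by (intro power_mono) auto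
      then show ?case by (simp add: power_mult_distrib)
    qed
  qed
  then show ?thesis by (simp add: prob_space)
qed

lemma second_moment_mart_le: "E (\<lambda>\<omega>. (norm (mart n \<omega>))^2) \<le> 4 * R^2 * real n"
proof -
  have "E (\<lambda>\<omega>. (norm (mart n \<omega>))^2) = (\<Sum>k\<in>{1..<n}. E (\<lambda>\<omega>. (norm (noise k \<omega>))^2))"
    using second_moment_mart[OF linear_ident] .
  also have "\<dots> \<le> (\<Sum>k\<in>{1..<n}. 4 * R^2)" by (intro sum_mono second_moment_noise_le)
  also have "\<dots> = 4 * R^2 * real (n - 1)" by simp
  also have "\<dots> \<le> 4 * R^2 * real n" by (intro mult_left_mono) auto
  finally show ?thesis .
qed

lemma norm_G_le_norm: "norm (G v) \<le> L * norm v"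
proof -
  interpret \<nu>: prob_space \<nu> by (rule prob_space_law)
  note int = integrable_g
  have "norm (G v) = norm (\<integral>z. g z v - g z 0 \<partial>\<nu>)"
    using int G_eq[of 0] by (simp add: G_eq[of v])
  also have "\<dots> \<le> (\<integral>z. norm (g z v - g z 0) \<partial>\<nu>)" by (rule integral_norm_bound)
  also have "\<dots> \<le> (\<integral>z. L * norm v \<partial>\<nu>)"
    using g_lipschitz int by (intro integral_mono_AE) auto
  finally show ?thesis by (simp add: \<nu>.prob_space)
qed

text \<open>\<open>g (Z k \<omega>) 0\<close> is the noise at the root since \<open>G 0 = 0\<close>,
  and its law does not depend on \<open>k\<close>. The difference of squares is a product: one
  factor is at most 2 \<beta> L |e| by Lipschitz continuity, the other at most 5 \<beta> R by
  boundedness.\<close>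

lemma second_moment_noise_near_root:
  fixes B :: "'e \<Rightarrow> 'v::euclidean_space"
  assumes B: "linear B" and \<beta>: "\<And>v. norm (B v) \<le> \<beta> * norm v" "\<beta> \<ge> 0"
  shows "E (\<lambda>\<omega>. (norm (B (noise k \<omega>)))^2)
    \<le> (\<integral>z. (norm (B (g z 0)))^2 \<partial>\<nu>) + 10 * \<beta>^2 * R * L * E (\<lambda>\<omega>. norm (iter k \<omega>))"
proof -
  have gm: "(\<lambda>z. g z 0) \<in> borel_measurable N" by (rule g_measurable_compose) auto
  have Bm: "(\<lambda>z. B (g z 0)) \<in> borel_measurable N"
    by (rule borel_measurable_continuous_on[OF _ gm])
      (use B in \<open>auto intro: linear_continuous_on simp: linear_conv_bounded_linear\<close>)
  have b0: "bdd_rv (\<lambda>\<omega>. g (Z k \<omega>) 0)"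
  proof (rule bdd_rvI)
    show "(\<lambda>\<omega>. g (Z k \<omega>) 0) \<in> borel_measurable M" by (rule measurable_compose[OF Z_measurable gm])
    show "AE \<omega> in M. norm (g (Z k \<omega>) 0) \<le> R" using AE_g by eventually_elim simp
  qed
  note [bdd_rv_intros] = bdd_rv_linear[OF B] b0
  have "E (\<lambda>\<omega>. (norm (B (noise k \<omega>)))^2)
      \<le> E (\<lambda>\<omega>. (norm (B (g (Z k \<omega>) 0)))^2 + 10 * \<beta>^2 * R * L * norm (iter k \<omega>))"
  proof (rule integral_mono_AE)
    show "AE \<omega> in M. (norm (B (noise k \<omega>)))^2 \<le> (norm (B (g (Z k \<omega>) 0)))^2 + 10 * \<beta>^2 * R * L * norm (iter k \<omega>)"
      using AE_g AE_noise
    proof eventually_elim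
      case (elim \<omega>)
      define p where "p = g (Z k \<omega>) 0"
      define d where "d = noise k \<omega> - p"
      define e where "e = iter k \<omega>"
      have p: "norm p \<le> R" using elim(1) by (simp add: p_def)
      have "norm d \<le> norm (noise k \<omega>) + norm p" unfolding d_def by (rule norm_triangle_ineq4)
      then have d3: "norm d \<le> 3 * R" using p elim(2)[rule_format, of k] by simp
      have "d = (g (Z k \<omega>) e - g (Z k \<omega>) 0) + G e" by (simp add: d_def p_def e_def noise_def)
      also have "norm \<dots> \<le> norm (g (Z k \<omega>) e - g (Z k \<omega>) 0) + norm (G e)" by (rule norm_triangle_ineq)
      also have "\<dots> \<le> L * norm e + L * norm e" using elim(1) norm_G_le_norm by (intro add_mono) auto
      finally have d: "norm d \<le> 2 * L * norm e" by simp
      have Bd: "norm (B d) \<le> \<beta> * (2 * L * norm e)" "norm (B d) \<le> \<beta> * (3 * R)" "norm (B p) \<le> \<beta> * R"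
        using \<beta>(1)[of d] \<beta>(1)[of p] mult_left_mono[OF d \<beta>(2)] mult_left_mono[OF d3 \<beta>(2)] mult_left_mono[OF p \<beta>(2)]
        by linarith+
      have "B (noise k \<omega>) = B p + B d" by (simp add: d_def linear_diff[OF B])
      then have "(norm (B (noise k \<omega>)))^2 \<le> (norm (B p) + norm (B d))^2"
        by (auto intro: power_mono norm_triangle_ineq)
      also have "\<dots> = (norm (B p))^2 + norm (B d) * (2 * norm (B p) + norm (B d))"
        by (simp add: power2_sum power2_eq_square algebra_simps)
      also have "norm (B d) * (2 * norm (B p) + norm (B d)) \<le> (\<beta> * (2 * L * norm e)) * (2 * (\<beta> * R) + \<beta> * (3 * R))"
        using Bd \<beta> pos by (intro mult_mono add_mono) auto
      also have "\<dots> = 10 * \<beta>^2 * R * L * norm e" by (simp add: algebra_simps power2_eq_square)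
      finally show ?case by (simp add: p_def e_def)
    qed
  qed (intro bdd_rv_integrable bdd_rv_intros)+
  also have "\<dots> = E (\<lambda>\<omega>. (norm (B (g (Z k \<omega>) 0)))^2) + 10 * \<beta>^2 * R * L * E (\<lambda>\<omega>. norm (iter k \<omega>))"
  proof -
    have [simp]: "integrable M (\<lambda>\<omega>. (norm (B (g (Z k \<omega>) 0)))^2)" "integrable M (\<lambda>\<omega>. norm (iter k \<omega>))"
      by (intro bdd_rv_integrable bdd_rv_intros)+
    show ?thesis by simp
  qed
  also have "E (\<lambda>\<omega>. (norm (B (g (Z k \<omega>) 0)))^2) = (\<integral>z. (norm (B (g z 0)))^2 \<partial>\<nu>)"
    unfolding law[of k, symmetric] using Bm by (subst integral_distr) auto
  finally show ?thesis .
qed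

section \<open>Linearised dynamics and the correlation of the iterates with the martingale\<close>

definition remainder :: "nat \<Rightarrow> 'a \<Rightarrow> 'e" where
  "remainder n \<omega> = G (iter n \<omega>) - A (iter n \<omega>)"

lemma bdd_rv_remainder [bdd_rv_intros]: "bdd_rv (\<lambda>\<omega>. remainder n \<omega>)"
  unfolding remainder_def by (intro bdd_rv_intros bdd_rv_linear[OF A_linear])

lemma norm_remainder_le: "norm (remainder n \<omega>) \<le> L * (norm (iter n \<omega>))^2"
  unfolding remainder_def by (rule G_expansion)

text \<open>Expand the square: for s <= \<mu>/a^2, where a bounds \<open>A\<close>, the quadratic
  term eats at most half of the gain 2 s \<mu>, and 1 - s \<mu> <= (1 - s \<mu>/2)^2. The condition
  s <= 1/\<mu> keeps the factor nonnegative so that roots may be taken.\<close>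

lemma contraction:
  obtains \<epsilon> where "\<epsilon> > 0" "\<And>s v. 0 \<le> s \<Longrightarrow> s \<le> \<epsilon> \<Longrightarrow> norm (v - s *\<^sub>R A v) \<le> (1 - \<mu> / 2 * s) * norm v"
proof -
  obtain a where a: "a > 0" "\<And>v. norm (A v) \<le> a * norm v"
    using linear_bounded_pos[OF A_linear] by blast
  define \<epsilon> where "\<epsilon> = min (\<mu> / a^2) (1 / \<mu>)"
  show ?thesis
  proof (rule that)
    show "\<epsilon> > 0" using a pos by (simp add: \<epsilon>_def)
    fix s :: real and v assume s: "0 \<le> s" "s \<le> \<epsilon>"
    have s1: "s * a^2 \<le> \<mu>" "s * \<mu> \<le> 1" using s a pos by (auto simp: \<epsilon>_def field_simps)
    have "(norm (v - s *\<^sub>R A v))^2 = (norm v)^2 - 2 * s * (v \<bullet> A v) + s * s * (norm (A v))^2"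
      using norm_add_scaleR_square[of v "- s" "A v"] by (simp add: power_mult_distrib power2_eq_square[of s])
    also have "\<dots> \<le> (norm v)^2 - 2 * s * (\<mu> * (norm v)^2) + s * s * (a^2 * (norm v)^2)"
    proof -
      have "(norm (A v))^2 \<le> (a * norm v)^2" using a by (intro power_mono) auto
      then have "s * s * (norm (A v))^2 \<le> s * s * (a^2 * (norm v)^2)"
        by (intro mult_left_mono) (auto simp: power_mult_distrib)
      moreover have "2 * s * (\<mu> * (norm v)^2) \<le> 2 * s * (v \<bullet> A v)"
        using s by (intro mult_left_mono A_coercive) auto
      ultimately show ?thesis by linarith
    qed
    also have "\<dots> = (1 - 2 * s * \<mu> + s * (s * a^2)) * (norm v)^2" by (simp add: algebra_simps)
    also have "\<dots> \<le> (1 - 2 * s * \<mu> + s * \<mu>) * (norm v)^2"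
      using s s1 by (intro mult_right_mono add_left_mono mult_left_mono) auto
    also have "\<dots> \<le> (1 - \<mu> / 2 * s)^2 * (norm v)^2"
      by (intro mult_right_mono) (auto simp: power2_diff power_mult_distrib algebra_simps)
    finally have "(norm (v - s *\<^sub>R A v))^2 \<le> ((1 - \<mu> / 2 * s) * norm v)^2" by (simp add: power_mult_distrib)
    then show "norm (v - s *\<^sub>R A v) \<le> (1 - \<mu> / 2 * s) * norm v"
      by (rule power2_le_imp_le) (use s1 in \<open>auto simp: mult.commute\<close>)
  qed
qed

text \<open>The bilinear form of the matrix E[mart iter^T]; testing against vectors avoids matrices
  over a general Euclidean space.\<close>

definition cross :: "nat \<Rightarrow> 'e \<Rightarrow> 'e \<Rightarrow> real" where
  "cross n u v = E (\<lambda>\<omega>. (u \<bullet> mart n \<omega>) * (v \<bullet> iter n \<omega>))"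

text \<open>Multiplying out the two updates leaves a linear part, where symmetry moves
  \<open>A\<close> onto \<open>v\<close>, a remainder part and a product of equal-time noises. The
  last two have bounded expectation and carry a factor \<open>step (Suc n)\<close>.\<close>

lemma cross_recursion:
  assumes n: "n \<ge> 1" and K: "E (\<lambda>\<omega>. norm (iter n \<omega>) ^ 4) \<le> K * real (Suc n) powr - (3 / 2)" "K \<ge> 0"
  shows "\<bar>cross (Suc n) u v\<bar> \<le> \<bar>cross n u (v - step (Suc n) *\<^sub>R A v)\<bar>
    + step (Suc n) * (4 * R^2 + L * (4 * R^2 + K)) * (norm u * norm v)"
proof -
  define s where "s = step (Suc n)"
  have s: "s \<ge> 0" by (simp add: s_def step_nonneg)
  note meas = mart_measurable_past[of n] iter_measurable_past[OF order_refl, of n]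
  have Gm: "(\<lambda>\<omega>. G (iter n \<omega>)) \<in> borel_measurable (past n)"
    by (rule measurable_compose[OF meas(2) G_measurable])
  \<comment> \<open>\<open>P1\<close> and \<open>P2\<close> collect the terms with exactly one
    factor \<open>noise n\<close>, paired with a vector known at time \<open>n\<close>; both have
    mean zero.\<close>
  define P1 where "P1 \<omega> = (u \<bullet> mart n \<omega>) *\<^sub>R v" for \<omega>
  define P2 where "P2 \<omega> = (v \<bullet> (iter n \<omega> - s *\<^sub>R G (iter n \<omega>))) *\<^sub>R u" for \<omega>
  have P: "E (\<lambda>\<omega>. P1 \<omega> \<bullet> noise n \<omega>) = 0" "E (\<lambda>\<omega>. P2 \<omega> \<bullet> noise n \<omega>) = 0"
    unfolding P1_def P2_def using meas Gm by (intro expectation_past_noise bdd_rv_intros; measurable)+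
  define c1 where "c1 \<omega> = (u \<bullet> mart n \<omega>) * ((v - s *\<^sub>R A v) \<bullet> iter n \<omega>)" for \<omega>
  define c2 where "c2 \<omega> = (u \<bullet> mart n \<omega>) * (v \<bullet> remainder n \<omega>)" for \<omega>
  define c5 where "c5 \<omega> = (u \<bullet> noise n \<omega>) * (v \<bullet> noise n \<omega>)" for \<omega>
  have [simp]: "integrable M c1" "integrable M c2" "integrable M c5"
     "integrable M (\<lambda>\<omega>. P1 \<omega> \<bullet> noise n \<omega>)" "integrable M (\<lambda>\<omega>. P2 \<omega> \<bullet> noise n \<omega>)"
    unfolding c1_def c2_def c5_def P1_def P2_def by (intro bdd_rv_integrable bdd_rv_intros)+
  have "(u \<bullet> mart (Suc n) \<omega>) * (v \<bullet> iter (Suc n) \<omega>)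
      = c1 \<omega> - s * c2 \<omega> + s * (P1 \<omega> \<bullet> noise n \<omega>) + P2 \<omega> \<bullet> noise n \<omega> + s * c5 \<omega>" for \<omega>
    unfolding c1_def c2_def P1_def P2_def c5_def mart_Suc[OF n] iter_Suc_noise remainder_def s_def[symmetric]
    by (simp add: inner_add_right inner_diff_right inner_diff_left A_symmetric algebra_simps)
  then have "cross (Suc n) u v = E c1 - s * E c2 + s * E c5"
    by (simp add: cross_def P)
  also have "\<bar>\<dots>\<bar> \<le> \<bar>E c1\<bar> + s * \<bar>E c2\<bar> + s * \<bar>E c5\<bar>"
    using s abs_mult[of s "E c2"] abs_mult[of s "E c5"] by simp
  also have "E c1 = cross n u (v - s *\<^sub>R A v)" by (simp add: c1_def[abs_def] cross_def)
  finally have split: "\<bar>cross (Suc n) u v\<bar>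
      \<le> \<bar>cross n u (v - s *\<^sub>R A v)\<bar> + s * \<bar>E c2\<bar> + s * \<bar>E c5\<bar>" .
  have c2: "\<bar>E c2\<bar> \<le> L * (4 * R^2 + K) * (norm u * norm v)"
  proof -
    have [simp]: "integrable M (\<lambda>\<omega>. (norm (mart n \<omega>))^2)" "integrable M (\<lambda>\<omega>. norm (iter n \<omega>) ^ 4)"
      by (intro bdd_rv_integrable bdd_rv_intros)+
    have "\<bar>E c2\<bar> \<le> E (\<lambda>\<omega>. \<bar>c2 \<omega>\<bar>)" by simp
    \<comment> \<open>The weights 1/n and n balance the product: E|mart|^2 is O(n) and E|iter|^4 is
      O(n^(-3/2)), so both terms stay bounded.\<close>
    also have "\<dots> \<le> E (\<lambda>\<omega>. norm u * norm v * L * ((norm (mart n \<omega>))^2 / n + n * norm (iter n \<omega>) ^ 4))"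
    proof (rule integral_mono)
      fix \<omega>
      have "\<bar>c2 \<omega>\<bar> \<le> (norm u * norm (mart n \<omega>)) * (norm v * (L * (norm (iter n \<omega>))^2))"
        unfolding c2_def abs_mult using Cauchy_Schwarz_ineq2[of v "remainder n \<omega>"]
          mult_left_mono[OF norm_remainder_le[of n \<omega>], of "norm v"]
        by (intro mult_mono Cauchy_Schwarz_ineq2) auto
      also have "\<dots> = norm u * norm v * L * (norm (mart n \<omega>) * (norm (iter n \<omega>))^2)" by simp
      also have "norm (mart n \<omega>) * (norm (iter n \<omega>))^2 \<le> (norm (mart n \<omega>))^2 / n + n * norm (iter n \<omega>) ^ 4"
      proof -
        have "0 \<le> ((norm (mart n \<omega>) - real n * (norm (iter n \<omega>))^2)^2 + (norm (mart n \<omega>))^2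
            + (real n * (norm (iter n \<omega>))^2)^2) / real n" by simp
        then show ?thesis using n by (simp add: field_simps power2_eq_square power4_eq_xxxx)
      qed
      finally show "\<bar>c2 \<omega>\<bar> \<le> norm u * norm v * L * ((norm (mart n \<omega>))^2 / n + n * norm (iter n \<omega>) ^ 4)"
        using pos by (simp add: mult_left_mono)
    qed simp_all
    also have "\<dots> = norm u * norm v * L * (E (\<lambda>\<omega>. (norm (mart n \<omega>))^2) / n + n * E (\<lambda>\<omega>. norm (iter n \<omega>) ^ 4))"
      by simp
    also have "\<dots> \<le> norm u * norm v * L * (4 * R^2 + K)"
    proof (intro mult_left_mono add_mono)
      show "E (\<lambda>\<omega>. (norm (mart n \<omega>))^2) / n \<le> 4 * R^2"
        using second_moment_mart_le[of n] n by (simp add: field_simps)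
      have "real n * E (\<lambda>\<omega>. norm (iter n \<omega>) ^ 4) \<le> real (Suc n) * (K * real (Suc n) powr - (3 / 2))"
        by (intro mult_mono K) (auto intro!: Bochner_Integration.integral_nonneg)
      also have "\<dots> = K * real (Suc n) powr - (1 / 2)"
        by (simp add: powr_mult_base del: of_nat_Suc)
      also have "\<dots> \<le> K * real (Suc n) powr 0"
        using K by (intro mult_left_mono powr_mono) auto
      finally show "real n * E (\<lambda>\<omega>. norm (iter n \<omega>) ^ 4) \<le> K" by simp
    qed (use pos in auto)
    finally show ?thesis by (simp add: mult_ac)
  qed
  have c5: "\<bar>E c5\<bar> \<le> 4 * R^2 * (norm u * norm v)"
  proof -
    have [simp]: "integrable M (\<lambda>\<omega>. (norm (noise n \<omega>))^2)"
      by (intro bdd_rv_integrable bdd_rv_intros)+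
    have "\<bar>E c5\<bar> \<le> E (\<lambda>\<omega>. \<bar>c5 \<omega>\<bar>)" by simp
    also have "\<dots> \<le> E (\<lambda>\<omega>. norm u * norm v * (norm (noise n \<omega>))^2)"
    proof (rule integral_mono)
      fix \<omega>
      have "\<bar>c5 \<omega>\<bar> \<le> (norm u * norm (noise n \<omega>)) * (norm v * norm (noise n \<omega>))"
        unfolding c5_def abs_mult by (intro mult_mono Cauchy_Schwarz_ineq2) auto
      then show "\<bar>c5 \<omega>\<bar> \<le> norm u * norm v * (norm (noise n \<omega>))^2" by (simp add: power2_eq_square mult_ac)
    qed simp_all
    also have "\<dots> \<le> norm u * norm v * (4 * R^2)"
      using second_moment_noise_le[of n] by (simp add: mult_left_mono)
    finally show ?thesis by (simp add: mult_ac)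
  qed
  show ?thesis using split mult_left_mono[OF c2 s] mult_left_mono[OF c5 s]
    unfolding s_def[symmetric] by (simp add: algebra_simps)
qed

text \<open>Once K >= 2 C/\<mu>, the contraction gains s K \<mu>/2 per step, at least the source s
  C, so a bound by K |u| |v| reproduces itself. \<open>S\<close> in \<open>K\<close> covers the
  indices before the step is small enough to contract.\<close>

lemma cross_bound:
  obtains K where "K > 0" "\<And>n u v. n \<ge> 1 \<Longrightarrow> \<bar>cross n u v\<bar> \<le> K * (norm u * norm v)"
proof -
  obtain K4 where K4: "K4 > 0" "\<And>n. E (\<lambda>\<omega>. norm (iter n \<omega>) ^ 4) \<le> K4 * real (Suc n) powr - (3 / 2)"
    using fourth_moment_bound by blast
  obtain \<epsilon> where \<epsilon>: "\<epsilon> > 0" "\<And>s v. 0 \<le> s \<Longrightarrow> s \<le> \<epsilon> \<Longrightarrow> norm (v - s *\<^sub>R A v) \<le> (1 - \<mu> / 2 * s) * norm v"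
    using contraction by blast
  from eventually_step_le[OF \<epsilon>(1)] obtain n0 where n0: "\<And>n. n \<ge> n0 \<Longrightarrow> step (Suc n) \<le> \<epsilon>"
    unfolding eventually_sequentially by blast
  define C where "C = 4 * R^2 + L * (4 * R^2 + K4)"
  define \<kappa> where "\<kappa> n = E (\<lambda>\<omega>. norm (mart n \<omega>) * norm (iter n \<omega>))" for n
  have \<kappa>: "\<kappa> n \<ge> 0" for n by (simp add: \<kappa>_def)
  define S where "S = (\<Sum>n\<le>Suc n0. \<kappa> n)"
  have S: "S \<ge> 0" unfolding S_def by (intro sum_nonneg \<kappa>)
  define K where "K = 1 + 2 * C / \<mu> + S"
  have C: "C \<ge> 0" using pos K4 by (simp add: C_def)
  have "K > 0" using C pos S by (simp add: K_def add_pos_nonneg)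
  moreover have "K * (\<mu> / 2) = C + (1 + S) * \<mu> / 2" using pos by (simp add: K_def field_simps)
  ultimately have K: "K > 0" "C \<le> K * (\<mu> / 2)" using S pos by simp_all
  have init: "\<bar>cross n u v\<bar> \<le> K * (norm u * norm v)" if "n \<le> Suc n0" for n u v
  proof -
    have "\<bar>cross n u v\<bar> \<le> E (\<lambda>\<omega>. \<bar>(u \<bullet> mart n \<omega>) * (v \<bullet> iter n \<omega>)\<bar>)" unfolding cross_def by simp
    also have "\<dots> \<le> E (\<lambda>\<omega>. norm u * norm v * (norm (mart n \<omega>) * norm (iter n \<omega>)))"
    proof (rule integral_mono)
      show "integrable M (\<lambda>\<omega>. \<bar>(u \<bullet> mart n \<omega>) * (v \<bullet> iter n \<omega>)\<bar>)"
        by (intro integrable_abs bdd_rv_integrable bdd_rv_intros)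
      show "integrable M (\<lambda>\<omega>. norm u * norm v * (norm (mart n \<omega>) * norm (iter n \<omega>)))"
        by (intro bdd_rv_integrable bdd_rv_intros)
      fix \<omega>
      have "\<bar>(u \<bullet> mart n \<omega>) * (v \<bullet> iter n \<omega>)\<bar> \<le> (norm u * norm (mart n \<omega>)) * (norm v * norm (iter n \<omega>))"
        unfolding abs_mult by (intro mult_mono Cauchy_Schwarz_ineq2) auto
      then show "\<bar>(u \<bullet> mart n \<omega>) * (v \<bullet> iter n \<omega>)\<bar> \<le> norm u * norm v * (norm (mart n \<omega>) * norm (iter n \<omega>))"
        by (simp add: mult_ac)
    qed
    also have "\<dots> = norm u * norm v * \<kappa> n" by (simp add: \<kappa>_def)
    also have "\<dots> \<le> norm u * norm v * K"
    proof (rule mult_left_mono)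
      have "\<kappa> n \<le> S" unfolding S_def using that by (intro member_le_sum \<kappa>) auto
      then show "\<kappa> n \<le> K" using C pos by (simp add: K_def add_increasing)
    qed simp
    finally show ?thesis by (simp add: mult.commute)
  qed
  \<comment> \<open>All vectors at once, since the recursion replaces \<open>v\<close> by
    \<open>v - s *\<^sub>R A v\<close>. Starting at \<open>Suc n0\<close> ensures
    \<open>n \<ge> 1\<close>, as the recursion requires.\<close>
  have "\<forall>u v. \<bar>cross n u v\<bar> \<le> K * (norm u * norm v)" if "Suc n0 \<le> n" for n
    using that
  proof (induction n rule: dec_induct)
    case base
    then show ?case using init by blast
  next
    case (step n)
    show ?case
    proof (intro allI)
      fix u v
      define s where "s = step (Suc n)"
      have s: "0 \<le> s" "s \<le> \<epsilon>" using n0[of n] step.hyps by (auto simp: s_def step_nonneg)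
      have "\<bar>cross (Suc n) u v\<bar> \<le> \<bar>cross n u (v - s *\<^sub>R A v)\<bar> + s * C * (norm u * norm v)"
        using cross_recursion[OF _ K4(2), of n u v] step.hyps K4(1) by (simp add: s_def C_def)
      also have "\<dots> \<le> K * (norm u * ((1 - \<mu> / 2 * s) * norm v)) + s * (K * (\<mu> / 2)) * (norm u * norm v)"
      proof (intro add_mono mult_right_mono mult_left_mono K)
        have "\<bar>cross n u (v - s *\<^sub>R A v)\<bar> \<le> K * (norm u * norm (v - s *\<^sub>R A v))" using step.IH by blast
        also have "\<dots> \<le> K * (norm u * ((1 - \<mu> / 2 * s) * norm v))"
          using K by (intro mult_left_mono \<epsilon> s) auto
        finally show "\<bar>cross n u (v - s *\<^sub>R A v)\<bar> \<le> K * (norm u * ((1 - \<mu> / 2 * s) * norm v))" .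
      qed (use s in auto)
      also have "\<dots> = K * (norm u * norm v)" by (simp add: algebra_simps)
      finally show "\<bar>cross (Suc n) u v\<bar> \<le> K * (norm u * norm v)" .
    qed
  qed
  then have "\<bar>cross n u v\<bar> \<le> K * (norm u * norm v)" for n u v
    using init[of n u v] by (cases "n \<le> Suc n0") auto
  with K that show ?thesis by blast
qed

end

section \<open>Averaging\<close>

text \<open>The defect is exactly |x - y|^2 + |x + z|^2 + |y + z|^2.\<close>

lemma norm_add_diff_square_le:
  fixes x y z :: "'v::real_inner"
  shows "(norm (x + y - z))^2 \<le> 3 * ((norm x)^2 + (norm y)^2 + (norm z)^2)"
proof -
  have "0 \<le> (norm (x - y))^2 + (norm (x + z))^2 + (norm (y + z))^2" by simp
  also have "\<dots> = 3 * ((norm x)^2 + (norm y)^2 + (norm z)^2) - (norm (x + y - z))^2"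
    unfolding power2_norm_eq_inner by (simp add: inner_add_left inner_add_right inner_diff_left inner_diff_right inner_commute)
  finally show ?thesis by simp
qed

context robbins_monro
begin

text \<open>Reciprocal of the step leading from \<open>n\<close> to \<open>Suc n\<close>, hence the
  shift. It multiplies \<open>iter n - iter (Suc n)\<close> when the recursion is solved for
  \<open>A (iter n)\<close>.\<close>

definition inv_step :: "nat \<Rightarrow> real" where
  "inv_step n = 1 / step (Suc n)"

lemma inv_step_eq: "inv_step n = real (Suc n) powr (3 / 4) / \<gamma>"
  by (simp add: inv_step_def step_def powr_minus field_simps del: of_nat_Suc)

lemma inv_step_nonneg: "inv_step n \<ge> 0"
  using step_nonneg by (simp add: inv_step_def)

lemma inv_step_mono: "inv_step n \<le> inv_step (Suc n)"
  unfolding inv_step_eq using pos by (intro divide_right_mono powr_mono2) auto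

lemma inv_step_diff_le:
  assumes "k \<ge> 1"
  shows "inv_step k - inv_step (k - 1) \<le> real k powr - (1 / 4) / \<gamma>"
proof -
  obtain j where j: "k = Suc j" using assms by (cases k) auto
  have "real (Suc k) powr (3 / 4) \<le> real k powr (3 / 4) + 3 / 4 * real k powr (3 / 4 - 1) * (real (Suc k) - real k)"
    using assms by (intro powr_le_tangent) auto
  also have "\<dots> \<le> real k powr (3 / 4) + real k powr - (1 / 4)" by simp
  finally show ?thesis
    unfolding inv_step_eq j using pos by (simp add: divide_right_mono flip: diff_divide_distrib)
qed

lemma inv_step_le:
  assumes "n \<ge> 1"
  shows "inv_step n \<le> 2 / \<gamma> * real n powr (3 / 4)"
proof -
  have "real (Suc n) powr (3 / 4) \<le> (2 * real n) powr (3 / 4)"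
    using assms by (intro powr_mono2) auto
  also have "\<dots> = 2 powr (3 / 4) * real n powr (3 / 4)" by (simp add: powr_mult)
  also have "\<dots> \<le> 2 powr 1 * real n powr (3 / 4)" by (intro mult_right_mono powr_mono) auto
  finally show ?thesis unfolding inv_step_eq using pos by (simp add: divide_right_mono)
qed

text \<open>Besides the two end terms it contains the inner terms that summation by parts leaves,
  weighted by increments of the inverse step. \<open>k - 1\<close> is natural subtraction, harmless
  for k >= 1.\<close>

definition boundary :: "nat \<Rightarrow> 'a \<Rightarrow> 'e" where
  "boundary n \<omega> = inv_step 0 *\<^sub>R iter 1 \<omega> + (\<Sum>k=1..n. (inv_step k - inv_step (k - 1)) *\<^sub>R iter k \<omega>)
     - inv_step n *\<^sub>R iter (Suc n) \<omega>"

text \<open>Summation by parts: the increments of the iterates are weighted by the inverse step sizes.\<close>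

lemma sum_iter_decomposition:
  "A (\<Sum>k=1..n. iter k \<omega>) = mart (Suc n) \<omega> + boundary n \<omega> - (\<Sum>k=1..n. remainder k \<omega>)"
proof (induction n)
  case 0
  then show ?case by (simp add: mart_def boundary_def linear_0[OF A_linear])
next
  case (Suc n)
  define s where "s = step (Suc (Suc n))"
  have s: "s > 0" using pos by (simp add: s_def step_def)
  have inv: "inv_step (Suc n) = 1 / s" by (simp add: inv_step_def s_def)
  have "s *\<^sub>R A (iter (Suc n) \<omega>) = s *\<^sub>R (noise (Suc n) \<omega> - remainder (Suc n) \<omega>) + iter (Suc n) \<omega> - iter (Suc (Suc n)) \<omega>"
    unfolding iter_Suc_noise[of "Suc n"] s_def[symmetric] remainder_def by (simp add: scaleR_diff_right)
  then have "(1 / s) *\<^sub>R (s *\<^sub>R A (iter (Suc n) \<omega>))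
      = (1 / s) *\<^sub>R (s *\<^sub>R (noise (Suc n) \<omega> - remainder (Suc n) \<omega>) + iter (Suc n) \<omega> - iter (Suc (Suc n)) \<omega>)"
    by (rule arg_cong)
  then have "A (iter (Suc n) \<omega>) = noise (Suc n) \<omega> - remainder (Suc n) \<omega>
      + inv_step (Suc n) *\<^sub>R iter (Suc n) \<omega> - inv_step (Suc n) *\<^sub>R iter (Suc (Suc n)) \<omega>"
    using s by (simp add: inv scaleR_add_right scaleR_diff_right del: iter.simps)
  moreover have "boundary (Suc n) \<omega> = boundary n \<omega> + inv_step (Suc n) *\<^sub>R iter (Suc n) \<omega>
      - inv_step (Suc n) *\<^sub>R iter (Suc (Suc n)) \<omega>"
    unfolding boundary_def by (simp add: scaleR_diff_left del: iter.simps)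
  ultimately show ?case
    using Suc mart_Suc[of "Suc n" \<omega>] by (simp add: linear_add[OF A_linear] del: iter.simps)
qed

lemma bdd_rv_boundary [bdd_rv_intros]: "bdd_rv (\<lambda>\<omega>. boundary n \<omega>)"
  unfolding boundary_def by (intro bdd_rv_intros)

text \<open>Noise from time \<open>k\<close> on is orthogonal to \<open>iter k\<close>, so
  \<open>mart n\<close> may be cut back to \<open>mart k\<close>. Expanding in the basis then
  reduces everything to equal-time correlations, where \<open>cross_bound\<close> applies.\<close>

lemma cross_later:
  fixes B :: "'e \<Rightarrow> 'v::euclidean_space"
  assumes B: "linear B" and "1 \<le> k" "k \<le> n"
  shows "E (\<lambda>\<omega>. B (mart n \<omega>) \<bullet> B (iter k \<omega>)) = (\<Sum>b\<in>Basis. cross k b (adjoint B (B b)))"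
proof -
  note [bdd_rv_intros] = bdd_rv_linear[OF B] bdd_rv_linear[OF adjoint_linear[OF B]]
  have "E (\<lambda>\<omega>. B (mart n \<omega>) \<bullet> B (iter k \<omega>)) = E (\<lambda>\<omega>. B (mart k \<omega>) \<bullet> B (iter k \<omega>))"
    using \<open>k \<le> n\<close>
  proof (induction n rule: dec_induct)
    case (step n)
    have [simp]: "integrable M (\<lambda>\<omega>. B (mart n \<omega>) \<bullet> B (iter k \<omega>))"
      "integrable M (\<lambda>\<omega>. adjoint B (B (iter k \<omega>)) \<bullet> noise n \<omega>)"
      by (intro bdd_rv_integrable bdd_rv_intros)+
    have "B (mart (Suc n) \<omega>) \<bullet> B (iter k \<omega>) = B (mart n \<omega>) \<bullet> B (iter k \<omega>) + adjoint B (B (iter k \<omega>)) \<bullet> noise n \<omega>" for \<omega>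
      using step.hyps assms adjoint_works[OF B, of "noise n \<omega>" "B (iter k \<omega>)"]
      by (simp add: mart_Suc linear_add[OF B] inner_add_left inner_add_right inner_commute)
    moreover have "E (\<lambda>\<omega>. adjoint B (B (iter k \<omega>)) \<bullet> noise n \<omega>) = 0"
      using linear_measurable_past[OF linear_compose[OF B adjoint_linear[OF B]] iter_measurable_past[OF step.hyps(1)]]
      by (intro expectation_past_noise bdd_rv_intros) (simp add: comp_def)
    ultimately show ?case using step.IH by simp
  qed simp
  also have "\<dots> = E (\<lambda>\<omega>. \<Sum>b\<in>Basis. (b \<bullet> mart k \<omega>) * (adjoint B (B b) \<bullet> iter k \<omega>))"
  proof (rule arg_cong[where f = E], rule ext)
    fix \<omega>
    have "B (mart k \<omega>) \<bullet> B (iter k \<omega>) = mart k \<omega> \<bullet> adjoint B (B (iter k \<omega>))"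
      by (simp add: adjoint_works[OF B])
    also have "\<dots> = (\<Sum>b\<in>Basis. (mart k \<omega> \<bullet> b) * (adjoint B (B (iter k \<omega>)) \<bullet> b))"
      by (rule euclidean_inner)
    also have "\<dots> = (\<Sum>b\<in>Basis. (b \<bullet> mart k \<omega>) * (adjoint B (B b) \<bullet> iter k \<omega>))"
    proof (rule sum.cong)
      fix b :: 'e
      have "adjoint B (B (iter k \<omega>)) \<bullet> b = B b \<bullet> B (iter k \<omega>)"
        using adjoint_works[OF B, of b "B (iter k \<omega>)"] by (simp add: inner_commute)
      also have "\<dots> = adjoint B (B b) \<bullet> iter k \<omega>"
        using adjoint_works[OF B, of "iter k \<omega>" "B b"] by (simp add: inner_commute)
      finally show "(mart k \<omega> \<bullet> b) * (adjoint B (B (iter k \<omega>)) \<bullet> b) = (b \<bullet> mart k \<omega>) * (adjoint B (B b) \<bullet> iter k \<omega>)"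
        by (simp add: inner_commute)
    qed simp
    finally show "B (mart k \<omega>) \<bullet> B (iter k \<omega>) = (\<Sum>b\<in>Basis. (b \<bullet> mart k \<omega>) * (adjoint B (B b) \<bullet> iter k \<omega>))" .
  qed
  also have "\<dots> = (\<Sum>b\<in>Basis. E (\<lambda>\<omega>. (b \<bullet> mart k \<omega>) * (adjoint B (B b) \<bullet> iter k \<omega>)))"
    by (intro Bochner_Integration.integral_sum bdd_rv_integrable bdd_rv_intros)
  finally show ?thesis by (simp add: cross_def)
qed

text \<open>All correlations involved share one bound, and the weights are nonnegative and
  telescope; the total is of the order of the last inverse step, n^(3/4).\<close>

lemma cross_boundary:
  fixes B :: "'e \<Rightarrow> 'v::euclidean_space"
  assumes B: "linear B"
  obtains K where "K > 0" "\<And>n. n \<ge> 1 \<Longrightarrow> E (\<lambda>\<omega>. B (mart (Suc n) \<omega>) \<bullet> B (boundary n \<omega>)) \<le> K * real n powr (3 / 4)"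
proof -
  obtain K where K: "K > 0" "\<And>n u v. n \<ge> 1 \<Longrightarrow> \<bar>cross n u v\<bar> \<le> K * (norm u * norm v)"
    using cross_bound by blast
  define KB where "KB = (\<Sum>b\<in>Basis. K * (norm b * norm (adjoint B (B (b :: 'e)))))"
  have KB: "KB \<ge> 0" using K by (auto simp: KB_def intro!: sum_nonneg)
  note [bdd_rv_intros] = bdd_rv_linear[OF B]
  define cr where "cr n k = E (\<lambda>\<omega>. B (mart (Suc n) \<omega>) \<bullet> B (iter k \<omega>))" for n k
  have cr: "\<bar>cr n k\<bar> \<le> KB" if "1 \<le> k" "k \<le> Suc n" for n k
  proof -
    have "\<bar>cr n k\<bar> \<le> (\<Sum>b\<in>Basis. \<bar>cross k b (adjoint B (B b))\<bar>)"
      unfolding cr_def cross_later[OF B that] by (rule sum_abs)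
    also have "\<dots> \<le> KB" unfolding KB_def using that by (intro sum_mono K)
    finally show ?thesis .
  qed
  have tele: "(\<Sum>k=1..n. inv_step k - inv_step (k - 1)) = inv_step n - inv_step 0" for n
    by (induction n) auto
  have "E (\<lambda>\<omega>. B (mart (Suc n) \<omega>) \<bullet> B (boundary n \<omega>)) \<le> 4 * (KB + 1) / \<gamma> * real n powr (3 / 4)" if n: "n \<ge> 1" for n
  proof -
    have int [simp]: "integrable M (\<lambda>\<omega>. B (mart (Suc n) \<omega>) \<bullet> B (iter k \<omega>))" for k
      by (intro bdd_rv_integrable bdd_rv_intros)
    have "B (mart (Suc n) \<omega>) \<bullet> B (boundary n \<omega>) = inv_step 0 * (B (mart (Suc n) \<omega>) \<bullet> B (iter 1 \<omega>))
        + (\<Sum>k=1..n. (inv_step k - inv_step (k - 1)) * (B (mart (Suc n) \<omega>) \<bullet> B (iter k \<omega>)))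
        - inv_step n * (B (mart (Suc n) \<omega>) \<bullet> B (iter (Suc n) \<omega>))" for \<omega>
      unfolding boundary_def
      by (simp add: linear_add[OF B] linear_diff[OF B] linear_sum[OF B] linear_scale[OF B] inner_add_right
          inner_diff_right inner_sum_right del: iter.simps)
    then have "E (\<lambda>\<omega>. B (mart (Suc n) \<omega>) \<bullet> B (boundary n \<omega>))
        = inv_step 0 * cr n 1 + (\<Sum>k=1..n. (inv_step k - inv_step (k - 1)) * cr n k) - inv_step n * cr n (Suc n)"
      by (simp add: cr_def del: iter.simps)
    also have "\<dots> \<le> inv_step 0 * KB + (\<Sum>k=1..n. (inv_step k - inv_step (k - 1)) * KB) + inv_step n * KB"
    proof -
      have "inv_step 0 * cr n 1 \<le> inv_step 0 * KB"
        using cr[of 1 n] inv_step_nonneg by (intro mult_left_mono) auto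
      moreover have "(\<Sum>k=1..n. (inv_step k - inv_step (k - 1)) * cr n k) \<le> (\<Sum>k=1..n. (inv_step k - inv_step (k - 1)) * KB)"
      proof (intro sum_mono mult_left_mono)
        fix k assume k: "k \<in> {1..n}"
        then show "cr n k \<le> KB" using cr[of k n] by auto
        show "0 \<le> inv_step k - inv_step (k - 1)" using inv_step_mono[of "k - 1"] k by simp
      qed
      moreover have "inv_step n * (- cr n (Suc n)) \<le> inv_step n * KB"
        using cr[of "Suc n" n] inv_step_nonneg by (intro mult_left_mono) auto
      ultimately show ?thesis by simp
    qed
    also have "\<dots> = 2 * KB * inv_step n"
      unfolding sum_distrib_right[symmetric] tele by (simp add: algebra_simps)
    also have "\<dots> \<le> 2 * (KB + 1) * (2 / \<gamma> * real n powr (3 / 4))"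
      using KB inv_step_le[OF n] inv_step_nonneg by (intro mult_mono) auto
    also have "\<dots> = 4 * (KB + 1) / \<gamma> * real n powr (3 / 4)" by simp
    finally show ?thesis .
  qed
  with that[of "4 * (KB + 1) / \<gamma>"] KB pos show ?thesis by simp
qed

text \<open>A remainder is quadratic in the iterate, so its L^2 norm is controlled by the fourth
  moment and is O(k^(-3/4)); these norms sum to O(n^(1/4)).\<close>

lemma second_moment_remainders:
  obtains K where "K > 0" "\<And>n. E (\<lambda>\<omega>. (norm (\<Sum>k=1..n. remainder k \<omega>))^2) \<le> K * real n powr (1 / 2)"
proof -
  obtain K where K: "K > 0" "\<And>n. E (\<lambda>\<omega>. norm (iter n \<omega>) ^ 4) \<le> K * real (Suc n) powr - (3 / 2)"
    using fourth_moment_bound by blast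
  define w where "w k = L * sqrt K * real k powr - (3 / 4)" for k
  have "E (\<lambda>\<omega>. (norm (\<Sum>k=1..n. remainder k \<omega>))^2) \<le> (\<Sum>k=1..n. w k)^2" for n
  proof (rule expectation_minkowski)
    fix k assume k: "k \<in> {1..n}"
    then show "0 < w k" using pos K by (simp add: w_def)
    show "bdd_rv (remainder k)" by (rule bdd_rv_remainder)
    have "E (\<lambda>\<omega>. (norm (remainder k \<omega>))^2) \<le> E (\<lambda>\<omega>. L^2 * norm (iter k \<omega>) ^ 4)"
    proof (intro integral_mono bdd_rv_integrable bdd_rv_intros)
      fix \<omega>
      have "(norm (remainder k \<omega>))^2 \<le> (L * (norm (iter k \<omega>))^2)^2"
        by (intro power_mono norm_remainder_le) auto
      then show "(norm (remainder k \<omega>))^2 \<le> L^2 * norm (iter k \<omega>) ^ 4" by (simp add: power_mult_distrib)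
    qed
    also have "\<dots> = L^2 * E (\<lambda>\<omega>. norm (iter k \<omega>) ^ 4)" by simp
    also have "\<dots> \<le> L^2 * (K * real (Suc k) powr - (3 / 2))" by (intro mult_left_mono K) auto
    also have "\<dots> \<le> L^2 * (K * real k powr - (3 / 2))"
      using k K by (intro mult_left_mono powr_mono2') auto
    also have "\<dots> = (w k)^2" using K k by (simp add: w_def power_mult_distrib powr_power)
    finally show "E (\<lambda>\<omega>. (norm (remainder k \<omega>))^2) \<le> (w k)^2" .
  qed
  also have "(\<Sum>k=1..n. w k)^2 \<le> (L * sqrt K * (4 * real n powr (1 / 4)))^2" for n
  proof (rule power_mono)
    have "(\<Sum>k=1..n. w k) = L * sqrt K * (\<Sum>k=1..n. real k powr - (3 / 4))"
      by (simp add: w_def sum_distrib_left)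
    also have "\<dots> \<le> L * sqrt K * (4 * real n powr (1 / 4))"
      using sum_powr_le[of "3 / 4" n] pos K by (intro mult_left_mono) auto
    finally show "(\<Sum>k=1..n. w k) \<le> L * sqrt K * (4 * real n powr (1 / 4))" .
  qed (use pos K in \<open>auto simp: w_def intro!: sum_nonneg\<close>)
  also have "(L * sqrt K * (4 * real n powr (1 / 4)))^2 = (16 * L^2 * K) * real n powr (1 / 2)" for n
    using K by (cases "n = 0") (simp_all add: power_mult_distrib powr_power)
  finally show ?thesis using that[of "16 * L^2 * K"] K pos by simp
qed

text \<open>The inner terms have L^2 norm at most of order k^(-1/4) k^(-3/8) = k^(-5/8), with sum
  O(n^(3/8)). The last term has second moment n^(3/2) n^(-3/4), which is the same order
  squared.\<close>

lemma second_moment_boundary: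
  obtains K where "K > 0" "\<And>n. n \<ge> 1 \<Longrightarrow> E (\<lambda>\<omega>. (norm (boundary n \<omega>))^2) \<le> K * real n powr (3 / 4)"
proof -
  obtain K where K: "K > 0" "\<And>n. E (\<lambda>\<omega>. (norm (iter n \<omega>))^2) \<le> K * real (Suc n) powr - (3 / 4)"
    using second_moment_bound by blast
  define x where "x n \<omega> = (\<Sum>k=1..n. (inv_step k - inv_step (k - 1)) *\<^sub>R iter k \<omega>)" for n \<omega>
  have x [bdd_rv_intros]: "bdd_rv (\<lambda>\<omega>. x n \<omega>)" for n unfolding x_def by (intro bdd_rv_intros)
  define w where "w k = sqrt K / \<gamma> * real k powr - (5 / 8)" for k
  have x2: "E (\<lambda>\<omega>. (norm (x n \<omega>))^2) \<le> (64 / 9 * K / \<gamma>^2) * real n powr (3 / 4)" for n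
  proof -
    have "E (\<lambda>\<omega>. (norm (x n \<omega>))^2) \<le> (\<Sum>k=1..n. w k)^2"
      unfolding x_def
    proof (rule expectation_minkowski)
      fix k assume k: "k \<in> {1..n}"
      then show "0 < w k" using pos K by (simp add: w_def)
      show "bdd_rv (\<lambda>\<omega>. (inv_step k - inv_step (k - 1)) *\<^sub>R iter k \<omega>)" by (intro bdd_rv_intros)
      have d: "0 \<le> inv_step k - inv_step (k - 1)" "inv_step k - inv_step (k - 1) \<le> real k powr - (1 / 4) / \<gamma>"
        using inv_step_mono[of "k - 1"] inv_step_diff_le[of k] k by auto
      have "E (\<lambda>\<omega>. (norm ((inv_step k - inv_step (k - 1)) *\<^sub>R iter k \<omega>))^2)
          = (inv_step k - inv_step (k - 1))^2 * E (\<lambda>\<omega>. (norm (iter k \<omega>))^2)"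
        by (simp add: power_mult_distrib)
      also have "\<dots> \<le> (real k powr - (1 / 4) / \<gamma>)^2 * (K * real (Suc k) powr - (3 / 4))"
        using d by (intro mult_mono K power_mono) (auto intro!: Bochner_Integration.integral_nonneg)
      also have "\<dots> \<le> (real k powr - (1 / 4) / \<gamma>)^2 * (K * real k powr - (3 / 4))"
        using k K by (intro mult_left_mono powr_mono2') auto
      also have "\<dots> = K / \<gamma>^2 * (real k powr - (1 / 2) * real k powr - (3 / 4))"
        using k by (simp add: power_divide powr_power)
      also have "real k powr - (1 / 2) * real k powr - (3 / 4) = (real k powr - (5 / 8))^2"
        using k by (simp add: powr_power flip: powr_add)
      also have "K / \<gamma>^2 * (real k powr - (5 / 8))^2 = (w k)^2"
        using K by (simp add: w_def power_mult_distrib power_divide)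
      finally show "E (\<lambda>\<omega>. (norm ((inv_step k - inv_step (k - 1)) *\<^sub>R iter k \<omega>))^2) \<le> (w k)^2" .
    qed
    also have "(\<Sum>k=1..n. w k)^2 \<le> (sqrt K / \<gamma> * (8 / 3 * real n powr (3 / 8)))^2"
    proof (rule power_mono)
      have "(\<Sum>k=1..n. w k) = sqrt K / \<gamma> * (\<Sum>k=1..n. real k powr - (5 / 8))"
        by (simp add: w_def sum_distrib_left)
      also have "\<dots> \<le> sqrt K / \<gamma> * (8 / 3 * real n powr (3 / 8))"
        using sum_powr_le[of "5 / 8" n] pos K by (intro mult_left_mono) auto
      finally show "(\<Sum>k=1..n. w k) \<le> sqrt K / \<gamma> * (8 / 3 * real n powr (3 / 8))" .
    qed (use pos K in \<open>auto simp: w_def intro!: sum_nonneg\<close>)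
    also have "\<dots> = (64 / 9 * K / \<gamma>^2) * real n powr (3 / 4)"
      using K by (cases "n = 0") (simp_all add: power_mult_distrib power_divide powr_power)
    finally show ?thesis .
  qed
  define C where "C = 3 * ((inv_step 0)^2 * K + 64 / 9 * K / \<gamma>^2 + 4 / \<gamma>^2 * K)"
  have "E (\<lambda>\<omega>. (norm (boundary n \<omega>))^2) \<le> C * real n powr (3 / 4)" if n: "n \<ge> 1" for n
  proof -
    have n1: "real n powr (3 / 4) \<ge> 1" using n by (simp add: ge_one_powr_ge_zero)
    have [simp]: "integrable M (\<lambda>\<omega>. (norm (x n \<omega>))^2)" "integrable M (\<lambda>\<omega>. (norm (iter k \<omega>))^2)" for k
      by (intro bdd_rv_integrable bdd_rv_intros)+
    have "E (\<lambda>\<omega>. (norm (boundary n \<omega>))^2)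
        \<le> E (\<lambda>\<omega>. 3 * ((inv_step 0)^2 * (norm (iter 1 \<omega>))^2 + (norm (x n \<omega>))^2 + (inv_step n)^2 * (norm (iter (Suc n) \<omega>))^2))"
    proof (intro integral_mono bdd_rv_integrable bdd_rv_intros)
      fix \<omega>
      show "(norm (boundary n \<omega>))^2 \<le> 3 * ((inv_step 0)^2 * (norm (iter 1 \<omega>))^2 + (norm (x n \<omega>))^2 + (inv_step n)^2 * (norm (iter (Suc n) \<omega>))^2)"
        using norm_add_diff_square_le[of "inv_step 0 *\<^sub>R iter 1 \<omega>" "x n \<omega>" "inv_step n *\<^sub>R iter (Suc n) \<omega>"]
        by (simp add: boundary_def x_def power_mult_distrib del: iter.simps)
    qed
    also have "\<dots> = 3 * ((inv_step 0)^2 * E (\<lambda>\<omega>. (norm (iter 1 \<omega>))^2) + E (\<lambda>\<omega>. (norm (x n \<omega>))^2)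
        + (inv_step n)^2 * E (\<lambda>\<omega>. (norm (iter (Suc n) \<omega>))^2))"
      by (simp del: iter.simps)
    also have "\<dots> \<le> 3 * ((inv_step 0)^2 * (K * real n powr (3 / 4)) + (64 / 9 * K / \<gamma>^2) * real n powr (3 / 4)
        + 4 / \<gamma>^2 * K * real n powr (3 / 4))"
    proof (intro mult_left_mono add_mono x2)
      have "E (\<lambda>\<omega>. (norm (iter 1 \<omega>))^2) \<le> K * real (Suc 1) powr - (3 / 4)" by (rule K)
      also have "\<dots> \<le> K * real n powr (3 / 4)"
      proof (rule mult_left_mono)
        have "real (Suc 1) powr - (3 / 4) \<le> real (Suc 1) powr 0" by (intro powr_mono) auto
        then show "real (Suc 1) powr - (3 / 4) \<le> real n powr (3 / 4)" using n1 by simp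
      qed (use K in simp)
      finally show "E (\<lambda>\<omega>. (norm (iter 1 \<omega>))^2) \<le> K * real n powr (3 / 4)" .
      have "(inv_step n)^2 \<le> (2 / \<gamma> * real n powr (3 / 4))^2"
        using n by (intro power_mono inv_step_le inv_step_nonneg)
      also have "\<dots> = 4 / \<gamma>^2 * (real n powr (3 / 4) * real n powr (3 / 4))"
        by (simp add: power_mult_distrib power_divide power2_eq_square)
      finally have a: "(inv_step n)^2 \<le> 4 / \<gamma>^2 * (real n powr (3 / 4) * real n powr (3 / 4))" .
      have "E (\<lambda>\<omega>. (norm (iter (Suc n) \<omega>))^2) \<le> K * real (Suc (Suc n)) powr - (3 / 4)" by (rule K)
      also have "\<dots> \<le> K * real n powr - (3 / 4)"
        using K n by (intro mult_left_mono powr_mono2') auto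
      finally have "(inv_step n)^2 * E (\<lambda>\<omega>. (norm (iter (Suc n) \<omega>))^2)
          \<le> (4 / \<gamma>^2 * (real n powr (3 / 4) * real n powr (3 / 4))) * (K * real n powr - (3 / 4))"
        by (intro mult_mono a) (auto intro!: Bochner_Integration.integral_nonneg)
      also have "\<dots> = 4 / \<gamma>^2 * K * real n powr (3 / 4) * (real n powr (3 / 4) * real n powr - (3 / 4))"
        by (simp add: mult_ac)
      also have "real n powr (3 / 4) * real n powr - (3 / 4) = 1"
        using n by (simp flip: powr_add)
      finally show "(inv_step n)^2 * E (\<lambda>\<omega>. (norm (iter (Suc n) \<omega>))^2) \<le> 4 / \<gamma>^2 * K * real n powr (3 / 4)"
        by simp
    qed simp_all
    also have "\<dots> = C * real n powr (3 / 4)" by (simp add: C_def algebra_simps)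
    finally show ?thesis .
  qed
  moreover have "C > 0" using K pos unfolding C_def by (intro mult_pos_pos add_nonneg_pos) auto
  ultimately show ?thesis using that by blast
qed

text \<open>Replacing each noise by the noise at the root costs O(E|iter k|) = O(k^(-3/8)). The
  costs add up to n^(5/8), within the allowed n^(3/4).\<close>

lemma second_moment_mart_asymptotic:
  fixes B :: "'e \<Rightarrow> 'v::euclidean_space"
  assumes B: "linear B"
  obtains K where "K > 0" "\<And>n. n \<ge> 1 \<Longrightarrow> E (\<lambda>\<omega>. (norm (B (mart (Suc n) \<omega>)))^2)
    \<le> real n * (\<integral>z. (norm (B (g z 0)))^2 \<partial>\<nu>) + K * real n powr (3 / 4)"
proof -
  obtain K where K: "K > 0" "\<And>n. E (\<lambda>\<omega>. norm (iter n \<omega>)) \<le> K * real (Suc n) powr - (3 / 8)"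
    using first_moment_bound by blast
  obtain \<beta> where \<beta>: "\<beta> > 0" "\<And>v. norm (B v) \<le> \<beta> * norm v"
    using linear_bounded_pos[OF B] by blast
  define \<sigma> where "\<sigma> = (\<integral>z. (norm (B (g z 0)))^2 \<partial>\<nu>)"
  define C where "C = 10 * \<beta>^2 * R * L * K"
  have C: "C > 0" using pos K \<beta> by (simp add: C_def)
  have "E (\<lambda>\<omega>. (norm (B (mart (Suc n) \<omega>)))^2) \<le> real n * \<sigma> + 8 / 5 * C * real n powr (3 / 4)" if n: "n \<ge> 1" for n
  proof -
    have "E (\<lambda>\<omega>. (norm (B (mart (Suc n) \<omega>)))^2) = (\<Sum>k=1..n. E (\<lambda>\<omega>. (norm (B (noise k \<omega>)))^2))"
      using second_moment_mart[OF B, of "Suc n"] by (simp add: atLeastLessThanSuc_atLeastAtMost)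
    also have "\<dots> \<le> (\<Sum>k=1..n. \<sigma> + C * real k powr - (3 / 8))"
    proof (rule sum_mono)
      fix k assume k: "k \<in> {1..n}"
      have "E (\<lambda>\<omega>. (norm (B (noise k \<omega>)))^2) \<le> \<sigma> + 10 * \<beta>^2 * R * L * E (\<lambda>\<omega>. norm (iter k \<omega>))"
        unfolding \<sigma>_def using \<beta> by (intro second_moment_noise_near_root B) auto
      also have "\<dots> \<le> \<sigma> + 10 * \<beta>^2 * R * L * (K * real (Suc k) powr - (3 / 8))"
        using pos \<beta> by (intro add_left_mono mult_left_mono K) auto
      also have "\<dots> \<le> \<sigma> + 10 * \<beta>^2 * R * L * (K * real k powr - (3 / 8))"
        using pos \<beta> K k by (intro add_left_mono mult_left_mono powr_mono2') auto
      finally show "E (\<lambda>\<omega>. (norm (B (noise k \<omega>)))^2) \<le> \<sigma> + C * real k powr - (3 / 8)"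
        by (simp add: C_def)
    qed
    also have "\<dots> = real n * \<sigma> + C * (\<Sum>k=1..n. real k powr - (3 / 8))"
      by (simp add: sum.distrib sum_distrib_left)
    also have "\<dots> \<le> real n * \<sigma> + C * (8 / 5 * real n powr (5 / 8))"
      using sum_powr_le[of "3 / 8" n] C by (intro add_left_mono mult_left_mono) auto
    also have "\<dots> \<le> real n * \<sigma> + C * (8 / 5 * real n powr (3 / 4))"
      using C n by (intro add_left_mono mult_left_mono powr_mono) auto
    finally show ?thesis by simp
  qed
  with that[of "8 / 5 * C"] C show ?thesis unfolding \<sigma>_def by simp
qed

text \<open>Applying the inverse \<open>B\<close> to the decomposition of the summed iterates leaves
  martingale, boundary and remainder parts. Only the martingale has order n; its product with the
  boundary part must be kept exact, all other products may be split crudely.\<close>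

lemma averaging_bound:
  assumes B: "linear B" and BA: "\<And>v. B (A v) = v"
  obtains C where "C > 0" "\<And>n. n \<ge> 1 \<Longrightarrow> E (\<lambda>\<omega>. (norm ((1 / real n) *\<^sub>R (\<Sum>k=1..n. iter k \<omega>)))^2)
    \<le> (\<integral>z. (norm (B (g z 0)))^2 \<partial>\<nu>) / real n + C * real n powr (- 5 / 4)"
proof -
  define \<sigma> where "\<sigma> = (\<integral>z. (norm (B (g z 0)))^2 \<partial>\<nu>)"
  obtain \<beta> where \<beta>: "\<beta> > 0" "\<And>v. norm (B v) \<le> \<beta> * norm v"
    using linear_bounded_pos[OF B] by blast
  obtain K1 where K1: "K1 > 0" "\<And>n. n \<ge> 1 \<Longrightarrow> E (\<lambda>\<omega>. (norm (B (mart (Suc n) \<omega>)))^2) \<le> real n * \<sigma> + K1 * real n powr (3 / 4)"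
    using second_moment_mart_asymptotic[OF B] unfolding \<sigma>_def by blast
  obtain K2 where K2: "K2 > 0" "\<And>n. n \<ge> 1 \<Longrightarrow> E (\<lambda>\<omega>. B (mart (Suc n) \<omega>) \<bullet> B (boundary n \<omega>)) \<le> K2 * real n powr (3 / 4)"
    using cross_boundary[OF B] by blast
  obtain K3 where K3: "K3 > 0" "\<And>n. E (\<lambda>\<omega>. (norm (\<Sum>k=1..n. remainder k \<omega>))^2) \<le> K3 * real n powr (1 / 2)"
    using second_moment_remainders by blast
  obtain K4 where K4: "K4 > 0" "\<And>n. n \<ge> 1 \<Longrightarrow> E (\<lambda>\<omega>. (norm (boundary n \<omega>))^2) \<le> K4 * real n powr (3 / 4)"
    using second_moment_boundary by blast
  note [bdd_rv_intros] = bdd_rv_linear[OF B]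
  have sq: "E (\<lambda>\<omega>. (norm (B (P \<omega>)))^2) \<le> \<beta>^2 * E (\<lambda>\<omega>. (norm (P \<omega>))^2)" if P: "bdd_rv P" for P
  proof -
    have "E (\<lambda>\<omega>. (norm (B (P \<omega>)))^2) \<le> E (\<lambda>\<omega>. \<beta>^2 * (norm (P \<omega>))^2)"
    proof (intro integral_mono bdd_rv_integrable bdd_rv_intros P)
      fix \<omega>
      have "(norm (B (P \<omega>)))^2 \<le> (\<beta> * norm (P \<omega>))^2" by (intro power_mono \<beta>) auto
      then show "(norm (B (P \<omega>)))^2 \<le> \<beta>^2 * (norm (P \<omega>))^2" by (simp add: power_mult_distrib)
    qed
    then show ?thesis by simp
  qed
  define C where "C = K1 + 2 * K2 + 8 * \<beta>^2 * R^2 + 3 * \<beta>^2 * K3 + 2 * \<beta>^2 * K4"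
  have main: "E (\<lambda>\<omega>. (norm (\<Sum>k=1..n. iter k \<omega>))^2) \<le> real n * \<sigma> + C * real n powr (3 / 4)" if n: "n \<ge> 1" for n
  proof -
    \<comment> \<open>Balances the product of martingale and remainder: \<eta> n and n^(1/2) /
      \<eta> are both n^(3/4).\<close>
    define \<eta> where "\<eta> = real n powr - (1 / 4)"
    have \<eta>: "\<eta> > 0" "inverse \<eta> = real n powr (1 / 4)" "\<eta> \<le> 1"
      using n powr_mono[of "- (1 / 4)" 0 "real n"] by (auto simp: \<eta>_def powr_minus)
    define \<rho> where "\<rho> \<omega> = (\<Sum>k=1..n. remainder k \<omega>)" for \<omega>
    have \<rho> [bdd_rv_intros]: "bdd_rv (\<lambda>\<omega>. \<rho> \<omega>)" unfolding \<rho>_def by (intro bdd_rv_intros)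
    have [simp]: "integrable M (\<lambda>\<omega>. (norm (B (mart (Suc n) \<omega>)))^2)" "integrable M (\<lambda>\<omega>. (norm (B (\<rho> \<omega>)))^2)"
      "integrable M (\<lambda>\<omega>. (norm (B (boundary n \<omega>)))^2)" "integrable M (\<lambda>\<omega>. B (mart (Suc n) \<omega>) \<bullet> B (boundary n \<omega>))"
      by (intro bdd_rv_integrable bdd_rv_intros)+
    have "E (\<lambda>\<omega>. (norm (\<Sum>k=1..n. iter k \<omega>))^2)
      \<le> E (\<lambda>\<omega>. (1 + \<eta>) * (norm (B (mart (Suc n) \<omega>)))^2 + 2 * (B (mart (Suc n) \<omega>) \<bullet> B (boundary n \<omega>))
          + (inverse \<eta> + 2) * (norm (B (\<rho> \<omega>)))^2 + 2 * (norm (B (boundary n \<omega>)))^2)"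
    proof (intro integral_mono bdd_rv_integrable bdd_rv_intros)
      fix \<omega>
      define m where "m = B (mart (Suc n) \<omega>)"
      define t where "t = B (boundary n \<omega>)"
      define r where "r = B (\<rho> \<omega>)"
      have "(\<Sum>k=1..n. iter k \<omega>) = B (A (\<Sum>k=1..n. iter k \<omega>))" by (simp add: BA)
      also have "\<dots> = m + t - r"
        unfolding sum_iter_decomposition m_def t_def r_def \<rho>_def by (simp add: linear_add[OF B] linear_diff[OF B])
      finally have "(norm (\<Sum>k=1..n. iter k \<omega>))^2 = (norm (m + t - r))^2" by simp
      \<comment> \<open>The added squares are chosen to cancel the products m . r and t . r, while m
        . t survives untouched.\<close>
      also have "\<dots> \<le> (norm (m + t - r))^2 + \<eta> * (norm (m + inverse \<eta> *\<^sub>R r))^2 + (norm (t + r))^2"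
        using \<eta> by simp
      also have "\<dots> = (1 + \<eta>) * (norm m)^2 + 2 * (m \<bullet> t) + (inverse \<eta> + 2) * (norm r)^2 + 2 * (norm t)^2"
        unfolding power2_norm_eq_inner using \<eta>(1)
        by (simp add: inner_add_left inner_add_right inner_diff_left inner_diff_right inner_commute field_simps)
      finally show "(norm (\<Sum>k=1..n. iter k \<omega>))^2 \<le> (1 + \<eta>) * (norm (B (mart (Suc n) \<omega>)))^2
          + 2 * (B (mart (Suc n) \<omega>) \<bullet> B (boundary n \<omega>)) + (inverse \<eta> + 2) * (norm (B (\<rho> \<omega>)))^2 + 2 * (norm (B (boundary n \<omega>)))^2"
        by (simp add: m_def t_def r_def)
    qed
    also have "\<dots> = E (\<lambda>\<omega>. (norm (B (mart (Suc n) \<omega>)))^2) + \<eta> * E (\<lambda>\<omega>. (norm (B (mart (Suc n) \<omega>)))^2)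
        + 2 * E (\<lambda>\<omega>. B (mart (Suc n) \<omega>) \<bullet> B (boundary n \<omega>))
        + (inverse \<eta> + 2) * E (\<lambda>\<omega>. (norm (B (\<rho> \<omega>)))^2) + 2 * E (\<lambda>\<omega>. (norm (B (boundary n \<omega>)))^2)"
      by (simp add: algebra_simps)
    also have "\<dots> \<le> (real n * \<sigma> + K1 * real n powr (3 / 4)) + 8 * \<beta>^2 * R^2 * real n powr (3 / 4)
        + 2 * (K2 * real n powr (3 / 4)) + 3 * \<beta>^2 * K3 * real n powr (3 / 4) + 2 * (\<beta>^2 * (K4 * real n powr (3 / 4)))"
    proof (intro add_mono mult_left_mono K1 K2 n)
      have "\<eta> * E (\<lambda>\<omega>. (norm (B (mart (Suc n) \<omega>)))^2) \<le> \<eta> * (\<beta>^2 * (4 * R^2 * real (Suc n)))"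
        using \<eta> sq[OF bdd_rv_mart, of "Suc n"] mult_left_mono[OF second_moment_mart_le[of "Suc n"], of "\<beta>^2"]
        by (intro mult_left_mono) auto
      also have "\<dots> \<le> \<eta> * (\<beta>^2 * (4 * R^2 * (2 * real n)))"
        using \<eta> n by (intro mult_left_mono) auto
      also have "\<dots> = 8 * \<beta>^2 * R^2 * (real n * real n powr - (1 / 4))" by (simp add: \<eta>_def)
      also have "real n * real n powr - (1 / 4) = real n powr (3 / 4)"
        using n by (simp add: powr_mult_base)
      finally show "\<eta> * E (\<lambda>\<omega>. (norm (B (mart (Suc n) \<omega>)))^2) \<le> 8 * \<beta>^2 * R^2 * real n powr (3 / 4)" .
      have "(inverse \<eta> + 2) * E (\<lambda>\<omega>. (norm (B (\<rho> \<omega>)))^2) \<le> (3 * real n powr (1 / 4)) * (\<beta>^2 * (K3 * real n powr (1 / 2)))"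
      proof (rule mult_mono)
        have "1 \<le> inverse \<eta>" using \<eta> by (intro one_le_inverse) auto
        then show "inverse \<eta> + 2 \<le> 3 * real n powr (1 / 4)" using \<eta> by simp
        show "E (\<lambda>\<omega>. (norm (B (\<rho> \<omega>)))^2) \<le> \<beta>^2 * (K3 * real n powr (1 / 2))"
          using sq[OF \<rho>] mult_left_mono[OF K3(2)[of n], of "\<beta>^2"] by (simp add: \<rho>_def)
      qed (auto intro!: Bochner_Integration.integral_nonneg)
      also have "\<dots> = 3 * \<beta>^2 * K3 * (real n powr (1 / 4) * real n powr (1 / 2))" by simp
      also have "real n powr (1 / 4) * real n powr (1 / 2) = real n powr (3 / 4)" by (simp flip: powr_add)
      finally show "(inverse \<eta> + 2) * E (\<lambda>\<omega>. (norm (B (\<rho> \<omega>)))^2) \<le> 3 * \<beta>^2 * K3 * real n powr (3 / 4)" .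
      show "E (\<lambda>\<omega>. (norm (B (boundary n \<omega>)))^2) \<le> \<beta>^2 * (K4 * real n powr (3 / 4))"
        using sq[OF bdd_rv_boundary, of n] mult_left_mono[OF K4(2)[OF n], of "\<beta>^2"] by simp
    qed simp_all
    also have "\<dots> = real n * \<sigma> + C * real n powr (3 / 4)" by (simp add: C_def algebra_simps)
    finally show ?thesis .
  qed
  have "E (\<lambda>\<omega>. (norm ((1 / real n) *\<^sub>R (\<Sum>k=1..n. iter k \<omega>)))^2) \<le> \<sigma> / real n + C * real n powr (- 5 / 4)" if n: "n \<ge> 1" for n
  proof -
    have "E (\<lambda>\<omega>. (norm ((1 / real n) *\<^sub>R (\<Sum>k=1..n. iter k \<omega>)))^2)
        = E (\<lambda>\<omega>. (norm (\<Sum>k=1..n. iter k \<omega>))^2) / (real n)^2"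
      by (simp add: power_divide)
    also have "\<dots> \<le> (real n * \<sigma> + C * real n powr (3 / 4)) / (real n)^2"
      by (intro divide_right_mono main n) auto
    also have "\<dots> = \<sigma> / real n + C * (real n powr (3 / 4) / (real n)^2)"
      using n by (simp add: field_simps power2_eq_square)
    also have "real n powr (3 / 4) / (real n)^2 = real n powr (3 / 4) / real n powr 2"
      using n by (simp add: powr_numeral)
    also have "\<dots> = real n powr (- 5 / 4)" by (subst powr_diff[symmetric]) simp
    finally show ?thesis .
  qed
  moreover have "C > 0" using K1 K2 K3 K4 by (simp add: C_def add_pos_nonneg)
  ultimately show ?thesis using that unfolding \<sigma>_def by blast
qed

end

section \<open>The logistic risk\<close>

definition softplus :: "real \<Rightarrow> real" where
  "softplus t = ln (1 + exp t)"

definition sigmoid :: "real \<Rightarrow> real" where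
  "sigmoid t = 1 / (1 + exp (- t))"

definition sigmoid' :: "real \<Rightarrow> real" where
  "sigmoid' t = sigmoid t * (1 - sigmoid t)"

lemma sigmoid_bounds: "0 < sigmoid t" "sigmoid t < 1"
  by (simp_all add: sigmoid_def add_pos_pos)

lemma sigmoid_minus: "sigmoid (- t) = 1 - sigmoid t"
proof -
  have "1 + exp t > 0" "1 + exp (- t) > 0" by (simp_all add: add_pos_pos)
  moreover have "exp t * exp (- t) = 1" by (simp flip: exp_add)
  ultimately show ?thesis by (simp add: sigmoid_def field_simps)
qed

lemma sigmoid'_bounds: "0 < sigmoid' t" "sigmoid' t \<le> 1"
  using sigmoid_bounds[of t] mult_mono[of "sigmoid t" 1 "1 - sigmoid t" 1] by (auto simp: sigmoid'_def)

text \<open>By symmetry the derivative equals sigmoid |t| * sigmoid (-|t|); the first factor is at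
  least 1/2, the second at least exp (-|t|) / 2.\<close>

lemma sigmoid'_ge: "exp (- \<bar>t\<bar>) / 4 \<le> sigmoid' t"
proof -
  have *: "sigmoid' t = sigmoid t * sigmoid (- t)" by (simp add: sigmoid'_def sigmoid_minus)
  have "sigmoid' t = sigmoid \<bar>t\<bar> * sigmoid (- \<bar>t\<bar>)"
    unfolding * by (cases "t \<ge> 0") auto
  moreover have "sigmoid \<bar>t\<bar> \<ge> 1 / 2"
    unfolding sigmoid_def by (intro divide_left_mono) (auto simp: add_pos_pos)
  moreover have "sigmoid (- \<bar>t\<bar>) \<ge> exp (- \<bar>t\<bar>) / 2"
  proof -
    have "sigmoid (- \<bar>t\<bar>) = exp (- \<bar>t\<bar>) / (exp (- \<bar>t\<bar>) * (1 + exp \<bar>t\<bar>))"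
      by (simp add: sigmoid_def)
    also have "exp (- \<bar>t\<bar>) * (1 + exp \<bar>t\<bar>) = exp (- \<bar>t\<bar>) + 1"
      by (simp add: distrib_left flip: exp_add)
    also have "exp (- \<bar>t\<bar>) / (exp (- \<bar>t\<bar>) + 1) \<ge> exp (- \<bar>t\<bar>) / 2"
      by (intro divide_left_mono) (auto simp: add_pos_pos)
    finally show ?thesis .
  qed
  ultimately have "1 / 2 * (exp (- \<bar>t\<bar>) / 2) \<le> sigmoid' t"
    using mult_mono[of "1/2" "sigmoid \<bar>t\<bar>" "exp (- \<bar>t\<bar>) / 2" "sigmoid (- \<bar>t\<bar>)"] sigmoid_bounds[of "\<bar>t\<bar>"] by simp
  then show ?thesis by simp
qed

lemma DERIV_softplus: "(softplus has_real_derivative sigmoid t) (at t)"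
proof -
  have "1 + exp t > 0" by (simp add: add_pos_pos)
  then have "(softplus has_real_derivative exp t / (1 + exp t)) (at t)"
    unfolding softplus_def[abs_def] by (auto intro!: derivative_eq_intros)
  moreover have "exp t / (1 + exp t) = sigmoid t"
    using \<open>1 + exp t > 0\<close> by (simp add: sigmoid_def exp_minus field_simps)
  ultimately show ?thesis by simp
qed

lemma DERIV_sigmoid: "(sigmoid has_real_derivative sigmoid' t) (at t)"
proof -
  have p: "1 + exp (- t) > 0" by (simp add: add_pos_pos)
  then have "(sigmoid has_real_derivative exp (- t) / (1 + exp (- t))^2) (at t)"
    unfolding sigmoid_def[abs_def] by (auto intro!: derivative_eq_intros simp: power2_eq_square)
  moreover have "exp (- t) / (1 + exp (- t))^2 = sigmoid' t"
    using p by (simp add: sigmoid_def sigmoid'_def field_simps power2_eq_square)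
  ultimately show ?thesis by simp
qed

lemma DERIV_sigmoid': "(sigmoid' has_real_derivative sigmoid' t * (1 - 2 * sigmoid t)) (at t)"
  unfolding sigmoid'_def[abs_def] by (auto intro!: derivative_eq_intros DERIV_sigmoid simp: sigmoid'_def algebra_simps)

lemma abs_diff_le_of_DERIV:
  fixes f f' :: "real \<Rightarrow> real"
  assumes "\<And>t. (f has_real_derivative f' t) (at t)" "\<And>t. \<bar>f' t\<bar> \<le> 1"
  shows "\<bar>f s - f t\<bar> \<le> \<bar>s - t\<bar>"
  using field_differentiable_bound[of UNIV f f' 1 s t] assms by simp

text \<open>The mean value bound applied to f minus its linear part on the interval of radius |h|,
  where the derivative of this difference is at most |h|.\<close>

lemma abs_taylor_le_of_DERIV:
  fixes f f' :: "real \<Rightarrow> real"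
  assumes "\<And>t. (f has_real_derivative f' t) (at t)" "\<And>s t. \<bar>f' s - f' t\<bar> \<le> \<bar>s - t\<bar>"
  shows "\<bar>f (t + h) - f t - f' t * h\<bar> \<le> h^2"
proof -
  have "norm ((f (t + h) - f' t * (t + h)) - (f t - f' t * t)) \<le> \<bar>h\<bar> * norm ((t + h) - t)"
  proof (rule field_differentiable_bound[of "cball t \<bar>h\<bar>" _ "\<lambda>s. f' s - f' t"])
    fix s assume "s \<in> cball t \<bar>h\<bar>"
    then show "norm (f' s - f' t) \<le> \<bar>h\<bar>"
      using assms(2)[of s t] by (simp add: dist_real_def)
    show "((\<lambda>x. f x - f' t * x) has_real_derivative f' s - f' t) (at s within cball t \<bar>h\<bar>)"
      by (rule has_field_derivative_at_within) (auto intro!: derivative_eq_intros assms(1))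
  qed (auto simp: dist_real_def)
  then show ?thesis by (simp add: algebra_simps power2_eq_square)
qed

lemma abs_sigmoid_diff_le: "\<bar>sigmoid s - sigmoid t\<bar> \<le> \<bar>s - t\<bar>"
  by (rule abs_diff_le_of_DERIV[OF DERIV_sigmoid]) (use sigmoid'_bounds in \<open>simp add: less_imp_le\<close>)

lemma abs_sigmoid'_diff_le: "\<bar>sigmoid' s - sigmoid' t\<bar> \<le> \<bar>s - t\<bar>"
proof (rule abs_diff_le_of_DERIV[OF DERIV_sigmoid'])
  fix t
  have "\<bar>sigmoid' t\<bar> * \<bar>1 - 2 * sigmoid t\<bar> \<le> 1 * 1"
    using sigmoid'_bounds[of t] sigmoid_bounds[of t] by (intro mult_mono) auto
  then show "\<bar>sigmoid' t * (1 - 2 * sigmoid t)\<bar> \<le> 1" by (simp add: abs_mult)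
qed

lemma softplus_taylor: "\<bar>softplus (t + h) - softplus t - sigmoid t * h\<bar> \<le> h^2"
  by (rule abs_taylor_le_of_DERIV[OF DERIV_softplus abs_sigmoid_diff_le])

lemma sigmoid_taylor: "\<bar>sigmoid (t + h) - sigmoid t - sigmoid' t * h\<bar> \<le> h^2"
  by (rule abs_taylor_le_of_DERIV[OF DERIV_sigmoid abs_sigmoid'_diff_le])

lemma softplus_convex: "convex_on UNIV softplus"
  by (rule f''_ge0_imp_convex[OF _ DERIV_softplus DERIV_sigmoid]) (auto intro: less_imp_le sigmoid'_bounds)

text \<open>With a = exp (-s) and q = exp (-\<tau>) the increment is a(1-q) / ((1+aq)(1+a)), at
  least a(1-q) / (1+a)^2, and 1 - q >= \<tau>/(1+\<tau>). The saturating factor is what makes the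
  final drift only linear at infinity.\<close>

lemma sigmoid_increment_nonneg:
  assumes "\<tau> \<ge> 0"
  shows "sigmoid' s * (\<tau> / (1 + \<tau>)) \<le> sigmoid (s + \<tau>) - sigmoid s"
proof -
  define a where "a = exp (- s)"
  define q where "q = exp (- \<tau>)"
  have a: "a > 0" and q: "q > 0" "q \<le> 1" using assms by (auto simp: a_def q_def)
  have "1 + \<tau> \<le> exp \<tau>" by (rule exp_ge_add_one_self)
  then have "q \<le> 1 / (1 + \<tau>)" using assms by (simp add: q_def exp_minus field_simps)
  then have q': "\<tau> / (1 + \<tau>) \<le> 1 - q" using assms by (simp add: field_simps)
  have "sigmoid' s = a / (1 + a)^2"
    using a by (simp add: sigmoid'_def sigmoid_def a_def[symmetric] field_simps power2_eq_square)
  then have "sigmoid' s * (\<tau> / (1 + \<tau>)) \<le> a / (1 + a)^2 * (1 - q)"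
    using q' a by (simp only:) (intro mult_left_mono, auto)
  also have "\<dots> = a * (1 - q) / ((1 + a) * (1 + a))" by (simp add: power2_eq_square)
  also have "\<dots> \<le> a * (1 - q) / ((1 + a * q) * (1 + a))"
  proof (intro divide_left_mono mult_right_mono)
    show "1 + a * q \<le> 1 + a" using a q mult_left_mono[of q 1 a] by simp
    show "0 < (1 + a) * (1 + a) * ((1 + a * q) * (1 + a))"
      using a q by (intro mult_pos_pos add_pos_pos) auto
  qed (use a q in auto)
  also have "\<dots> = 1 / (1 + a * q) - 1 / (1 + a)"
  proof -
    have "1 + a * q \<noteq> 0" "1 + a \<noteq> 0" using a q mult_pos_pos[OF a q(1)] by linarith+
    then show ?thesis by (simp add: diff_frac_eq algebra_simps)
  qed
  also have "\<dots> = sigmoid (s + \<tau>) - sigmoid s"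
    by (simp add: sigmoid_def a_def q_def flip: exp_add)
  finally show ?thesis .
qed

lemma sigmoid_increment:
  "sigmoid' s * (\<tau>^2 / (1 + \<bar>\<tau>\<bar>)) \<le> (sigmoid (s + \<tau>) - sigmoid s) * \<tau>"
proof (cases "\<tau> \<ge> 0")
  case True
  then show ?thesis
    using mult_right_mono[OF sigmoid_increment_nonneg[of \<tau> s] True] by (simp add: power2_eq_square mult_ac)
next
  case False
  then have "- \<tau> \<ge> 0" by simp
  \<comment> \<open>The reflection sigmoid (-t) = 1 - sigmoid t reduces negative increments to the
    nonnegative case at -s.\<close>
  have "sigmoid' (- s) = sigmoid' s" by (simp add: sigmoid'_def sigmoid_minus)
  moreover have "sigmoid (- s + - \<tau>) - sigmoid (- s) = sigmoid s - sigmoid (s + \<tau>)"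
    using sigmoid_minus[of "s + \<tau>"] by (simp add: sigmoid_minus)
  ultimately have "sigmoid' s * (- \<tau> / (1 + - \<tau>)) \<le> sigmoid s - sigmoid (s + \<tau>)"
    using sigmoid_increment_nonneg[OF \<open>- \<tau> \<ge> 0\<close>, of "- s"] by simp
  then have "sigmoid' s * (- \<tau> / (1 + - \<tau>)) * - \<tau> \<le> (sigmoid s - sigmoid (s + \<tau>)) * - \<tau>"
    using \<open>- \<tau> \<ge> 0\<close> by (rule mult_right_mono)
  also have "\<dots> = (sigmoid (s + \<tau>) - sigmoid s) * \<tau>" by (simp add: algebra_simps)
  also have "sigmoid' s * (- \<tau> / (1 + - \<tau>)) * - \<tau> = sigmoid' s * (\<tau>^2 / (1 + \<bar>\<tau>\<bar>))"
    using False by (simp add: power2_eq_square)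
  finally show ?thesis .
qed

text \<open>Recoding the label to (y + 1) / 2 in {0, 1} confines it to a term linear in
  \<open>t\<close>. All curvature then comes from \<open>softplus\<close>, and taking conditional
  expectations affects a linear term only.\<close>

lemma ln_logistic_loss:
  assumes "y \<in> {- 1, 1}"
  shows "ln (1 + exp (- (y * t))) = softplus t - (y + 1) / 2 * t"
proof -
  have "1 + exp (- t) = (1 + exp t) * exp (- t)" by (simp add: algebra_simps flip: exp_add)
  moreover have "1 + exp t > 0" by (simp add: add_pos_pos)
  ultimately have "ln (1 + exp (- t)) = softplus t - t" by (simp add: softplus_def ln_mult)
  then show ?thesis using assms by (auto simp: softplus_def)
qed

lemma logistic_step_eq:
  assumes "y \<in> {- 1, 1}"
  shows "logistic_step x y \<theta> = - ((sigmoid (x \<bullet> \<theta>) - (y + 1) / 2) *\<^sub>R x)"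
proof -
  have "y / (1 + exp (y * (x \<bullet> \<theta>))) = - (sigmoid (x \<bullet> \<theta>) - (y + 1) / 2)"
    using assms sigmoid_minus[of "x \<bullet> \<theta>"] by (auto simp: sigmoid_def)
  then show ?thesis unfolding logistic_step_def inner_commute[of \<theta> x] by (metis scaleR_minus_left)
qed

text \<open>Taylor estimates with a uniform quadratic error survive taking expectations, so this
  criterion stands in for differentiation under the integral sign.\<close>

lemma has_derivative_of_quadratic_remainder:
  fixes f :: "'v::real_normed_vector \<Rightarrow> 'w::real_normed_vector"
  assumes "bounded_linear D" and le: "\<And>h. norm (f (x + h) - f x - D h) \<le> C * (norm h)^2"
  shows "(f has_derivative D) (at x)"
  unfolding has_derivative_at
proof (intro conjI assms(1))
  have "((\<lambda>h::'v. C * norm h) \<longlongrightarrow> C * norm (0::'v)) (at 0)"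
    by (intro tendsto_intros)
  then have lim: "((\<lambda>h::'v. C * norm h) \<longlongrightarrow> 0) (at 0)" by simp
  show "(\<lambda>h. norm (f (x + h) - f x - D h) / norm h) \<midarrow>0\<rightarrow> 0"
  proof (rule Lim_null_comparison[OF _ lim], rule eventuallyI)
    fix h :: 'v
    show "norm (norm (f (x + h) - f x - D h) / norm h) \<le> C * norm h"
      using le[of h] by (cases "h = 0") (simp_all add: pos_divide_le_eq power2_eq_square mult.assoc)
  qed
qed

lemma grad_eqI: "GDERIV f \<theta> :> D \<Longrightarrow> grad f \<theta> = D"
  unfolding grad_def
proof (rule the_equality)
  fix D' assume "GDERIV f \<theta> :> D" "GDERIV f \<theta> :> D'"
  then have "(\<lambda>h. h \<bullet> D) = (\<lambda>h. h \<bullet> D')"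
    unfolding gderiv_def by (rule has_derivative_unique)
  then show "D' = D" by (metis vector_eq_ldot)
qed

lemma norm_matrix_le_sum:
  fixes A :: "real ^ 'm ^ 'n"
  shows "norm A \<le> (\<Sum>i\<in>UNIV. \<Sum>j\<in>UNIV. \<bar>A $ i $ j\<bar>)"
proof -
  have "norm A \<le> (\<Sum>i\<in>UNIV. norm (A $ i))" unfolding norm_vec_def by (rule L2_set_le_sum) simp
  also have "\<dots> \<le> (\<Sum>i\<in>UNIV. \<Sum>j\<in>UNIV. \<bar>A $ i $ j\<bar>)" by (intro sum_mono norm_le_l1_cart)
  finally show ?thesis .
qed

lemma softplus_bound: "\<bar>softplus t\<bar> \<le> 1 + \<bar>t\<bar>"
proof -
  have "\<bar>softplus t - softplus 0\<bar> \<le> \<bar>t - 0\<bar>"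
    by (rule abs_diff_le_of_DERIV[OF DERIV_softplus]) (use sigmoid_bounds in \<open>simp add: less_imp_le\<close>)
  moreover have "0 \<le> softplus 0" "softplus 0 \<le> 1"
    using ln_le_minus_one[of 2] by (simp_all add: softplus_def)
  ultimately show ?thesis by linarith
qed

lemma sigmoid_measurable [measurable]: "sigmoid \<in> borel_measurable borel" "sigmoid' \<in> borel_measurable borel"
  and softplus_measurable [measurable]: "softplus \<in> borel_measurable borel"
  unfolding sigmoid'_def[abs_def] sigmoid_def[abs_def] softplus_def[abs_def] by measurable

section \<open>Expectations and weighted second moments under the logistic model\<close>

locale logistic_model = prob_space M
  for M :: "'a measure" +
  fixes X :: "'a \<Rightarrow> real ^ 'd" and Y :: "'a \<Rightarrow> real" and R :: real and \<theta>s :: "real ^ 'd"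
  assumes X_measurable [measurable]: "X \<in> borel_measurable M"
    and Y_measurable [measurable]: "Y \<in> borel_measurable M"
    and R_pos: "R > 0"
    and X_bounded: "AE \<omega> in M. norm (X \<omega>) \<le> R"
    and elliptic: "\<And>e. norm e = 1 \<Longrightarrow> variance (\<lambda>\<omega>. X \<omega> \<bullet> e) > 0"
    and Y_values: "\<And>\<omega>. \<omega> \<in> space M \<Longrightarrow> Y \<omega> \<in> {-1, 1}"
    and cond: "AE \<omega> in M.
          real_cond_exp M (vimage_algebra (space M) X borel) (indicator {\<omega> \<in> space M. Y \<omega> = 1}) \<omega>
            = sigmoid (X \<omega> \<bullet> \<theta>s)"
begin

abbreviation label :: "'a \<Rightarrow> real" where
  "label \<omega> \<equiv> (Y \<omega> + 1) / 2"

lemma label_values: "\<omega> \<in> space M \<Longrightarrow> label \<omega> \<in> {0, 1}"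
  using Y_values[of \<omega>] by auto

lemma integrable_bounded:
  fixes P :: "'a \<Rightarrow> 'v::{banach, second_countable_topology}"
  assumes "P \<in> borel_measurable M" "\<And>\<omega>. \<omega> \<in> space M \<Longrightarrow> norm (X \<omega>) \<le> R \<Longrightarrow> norm (P \<omega>) \<le> K"
  shows "integrable M P"
  using assms X_bounded by (intro integrable_const_bound[of _ K]) (auto elim: eventually_elim2[OF AE_space])

lemma expectation_mono_bounded:
  fixes P Q :: "'a \<Rightarrow> real"
  assumes "integrable M P" "integrable M Q" "\<And>\<omega>. \<omega> \<in> space M \<Longrightarrow> norm (X \<omega>) \<le> R \<Longrightarrow> P \<omega> \<le> Q \<omega>"
  shows "expectation P \<le> expectation Q"
  using assms X_bounded by (intro integral_mono_AE) (auto elim: eventually_elim2[OF AE_space])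

lemma norm_expectation_le:
  fixes P :: "'a \<Rightarrow> 'v::{banach, second_countable_topology}"
  assumes "P \<in> borel_measurable M" "\<And>\<omega>. \<omega> \<in> space M \<Longrightarrow> norm (X \<omega>) \<le> R \<Longrightarrow> norm (P \<omega>) \<le> K"
  shows "norm (expectation P) \<le> K"
proof -
  have int: "integrable M P" by (rule integrable_bounded[OF assms])
  have "norm (expectation P) \<le> expectation (\<lambda>\<omega>. norm (P \<omega>))" by (rule integral_norm_bound)
  also have "\<dots> \<le> expectation (\<lambda>\<omega>. K)" using int assms by (intro expectation_mono_bounded) auto
  finally show ?thesis by (simp add: prob_space)
qed

lemma abs_inner_X_le: "norm (X \<omega>) \<le> R \<Longrightarrow> \<bar>X \<omega> \<bullet> v\<bar> \<le> R * norm v"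
  using Cauchy_Schwarz_ineq2[of "X \<omega>" v] mult_right_mono[of "norm (X \<omega>)" R "norm v"] by simp

lemma inner_X_square_le: "norm (X \<omega>) \<le> R \<Longrightarrow> (X \<omega> \<bullet> v)^2 \<le> (R * norm v)^2"
  using abs_inner_X_le[of \<omega> v] power_mono[of "\<bar>X \<omega> \<bullet> v\<bar>" "R * norm v" 2] by simp

definition weight_fun :: "('a \<Rightarrow> real) \<Rightarrow> bool" where
  "weight_fun a \<longleftrightarrow> a \<in> borel_measurable M \<and> (\<forall>\<omega>\<in>space M. \<bar>a \<omega>\<bar> \<le> 1)"

text \<open>The operator of the matrix E[a X X^T]: weight 1 gives the plain second moment of
  \<open>X\<close>, weight \<open>sigmoid' (X \<omega> \<bullet> \<theta>)\<close> the Hessian of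
  the risk at \<open>\<theta>\<close>.\<close>

definition second_moment :: "('a \<Rightarrow> real) \<Rightarrow> real ^ 'd \<Rightarrow> real ^ 'd" where
  "second_moment a v = expectation (\<lambda>\<omega>. (a \<omega> * (X \<omega> \<bullet> v)) *\<^sub>R X \<omega>)"

lemma integrable_weight_X:
  assumes a: "weight_fun a"
  shows "integrable M (\<lambda>\<omega>. a \<omega> *\<^sub>R X \<omega>)"
proof (rule integrable_bounded[of _ R])
  have [measurable]: "a \<in> borel_measurable M" using a by (simp add: weight_fun_def)
  show "(\<lambda>\<omega>. a \<omega> *\<^sub>R X \<omega>) \<in> borel_measurable M" by measurable
  show "norm (a \<omega> *\<^sub>R X \<omega>) \<le> R" if "\<omega> \<in> space M" "norm (X \<omega>) \<le> R" for \<omega>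
    using a that mult_mono[of "\<bar>a \<omega>\<bar>" 1 "norm (X \<omega>)" R] by (auto simp: weight_fun_def)
qed

lemma integrable_weight_second:
  assumes a: "weight_fun a"
  shows "integrable M (\<lambda>\<omega>. (a \<omega> * (X \<omega> \<bullet> v)) *\<^sub>R X \<omega>)"
proof (rule integrable_bounded[of _ "1 * (R * norm v) * R"])
  have [measurable]: "a \<in> borel_measurable M" using a by (simp add: weight_fun_def)
  show "(\<lambda>\<omega>. (a \<omega> * (X \<omega> \<bullet> v)) *\<^sub>R X \<omega>) \<in> borel_measurable M" by measurable
  show "norm ((a \<omega> * (X \<omega> \<bullet> v)) *\<^sub>R X \<omega>) \<le> 1 * (R * norm v) * R" if "\<omega> \<in> space M" "norm (X \<omega>) \<le> R" for \<omega>
    unfolding norm_scaleR abs_mult using a that abs_inner_X_le[of \<omega> v] R_pos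
    by (intro mult_mono) (auto simp: weight_fun_def)
qed

lemma linear_second_moment: "weight_fun a \<Longrightarrow> linear (second_moment a)"
  unfolding second_moment_def[abs_def]
  by (rule linearI) (simp_all add: inner_add_right distrib_left scaleR_add_left integrable_weight_second
      mult.left_commute flip: Bochner_Integration.integral_add integral_scaleR_right)

lemma inner_second_moment:
  "weight_fun a \<Longrightarrow> w \<bullet> second_moment a v = expectation (\<lambda>\<omega>. a \<omega> * (X \<omega> \<bullet> v) * (X \<omega> \<bullet> w))"
  using integral_inner_right[OF integrable_weight_second, of w a v] by (simp add: second_moment_def inner_commute)

lemma second_moment_symmetric: "weight_fun a \<Longrightarrow> second_moment a v \<bullet> w = v \<bullet> second_moment a w"
  using inner_second_moment[of a w v] inner_second_moment[of a v w] by (simp add: inner_commute mult_ac)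

lemma weight_fun_1: "weight_fun (\<lambda>_. 1)"
  by (simp add: weight_fun_def)

lemma weight_fun_sigmoid': "weight_fun (\<lambda>\<omega>. sigmoid' (X \<omega> \<bullet> \<theta>))"
  using sigmoid'_bounds by (auto simp: weight_fun_def less_imp_le)

lemma integrable_inner_square: "integrable M (\<lambda>\<omega>. (X \<omega> \<bullet> v)^2)"
proof (rule integrable_bounded[of _ "(R * norm v)^2"])
  show "norm ((X \<omega> \<bullet> v)^2) \<le> (R * norm v)^2" if "norm (X \<omega>) \<le> R" for \<omega>
    using inner_X_square_le[OF that] by simp
qed measurable

text \<open>The quadratic form attains its minimum on the compact unit sphere, and there it
  dominates the variance, which ellipticity makes positive. Homogeneity carries the bound to all
  vectors.\<close>

lemma second_moment_coercive:
  obtains l where "l > 0" "\<And>v. l * (norm v)^2 \<le> expectation (\<lambda>\<omega>. (X \<omega> \<bullet> v)^2)"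
proof -
  define q where "q v = v \<bullet> second_moment (\<lambda>_. 1) v" for v
  have q: "q v = expectation (\<lambda>\<omega>. (X \<omega> \<bullet> v)^2)" for v
    by (simp add: q_def inner_second_moment[OF weight_fun_1] power2_eq_square)
  have lin: "linear (second_moment (\<lambda>_. 1))" by (rule linear_second_moment[OF weight_fun_1])
  have "continuous_on (sphere 0 1) q"
    unfolding q_def using lin by (intro continuous_intros linear_continuous_on) (simp add: linear_conv_bounded_linear)
  moreover have "sphere (0 :: real ^ 'd) 1 \<noteq> {}" by simp
  ultimately obtain e where e: "e \<in> sphere 0 1" "\<And>v. v \<in> sphere 0 1 \<Longrightarrow> q e \<le> q v"
    using continuous_attains_inf[OF compact_sphere, of 0 1 q] by blast
  have int: "integrable M (\<lambda>\<omega>. X \<omega> \<bullet> e)"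
    using abs_inner_X_le[of _ e] by (intro integrable_bounded[of _ "R * norm e"]) auto
  have "0 < variance (\<lambda>\<omega>. X \<omega> \<bullet> e)" using e by (intro elliptic) simp
  also have "\<dots> \<le> q e"
    using variance_eq[OF int integrable_inner_square[of e]] by (simp add: q)
  finally have "q e > 0" .
  moreover have "q e * (norm v)^2 \<le> expectation (\<lambda>\<omega>. (X \<omega> \<bullet> v)^2)" for v
  proof (cases "v = 0")
    case False
    have "q e \<le> q (inverse (norm v) *\<^sub>R v)" using False by (intro e) simp
    also have "\<dots> = inverse (norm v) * inverse (norm v) * q v"
      by (simp add: q_def linear_scale[OF lin])
    finally have "q e * (norm v)^2 \<le> inverse (norm v) * inverse (norm v) * q v * (norm v)^2"
      by (intro mult_right_mono) auto
    also have "\<dots> = q v" using False by (simp add: field_simps power2_eq_square)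
    finally show ?thesis by (simp add: q)
  qed simp
  ultimately show ?thesis using that by blast
qed

section \<open>Gradient, Hessian and convexity of the risk\<close>

definition risk_grad :: "real ^ 'd \<Rightarrow> real ^ 'd" where
  "risk_grad \<theta> = expectation (\<lambda>\<omega>. (sigmoid (X \<omega> \<bullet> \<theta>) - label \<omega>) *\<^sub>R X \<omega>)"

definition risk_hess :: "real ^ 'd \<Rightarrow> real ^ 'd \<Rightarrow> real ^ 'd" where
  "risk_hess \<theta> = second_moment (\<lambda>\<omega>. sigmoid' (X \<omega> \<bullet> \<theta>))"

lemma weight_fun_residual: "weight_fun (\<lambda>\<omega>. sigmoid (X \<omega> \<bullet> \<theta>) - label \<omega>)"
proof -
  have "\<bar>sigmoid (X \<omega> \<bullet> \<theta>) - label \<omega>\<bar> \<le> 1" if "\<omega> \<in> space M" for \<omega>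
    using label_values[OF that] sigmoid_bounds[of "X \<omega> \<bullet> \<theta>"] by auto
  then show ?thesis by (simp add: weight_fun_def)
qed

lemma inner_risk_grad: "v \<bullet> risk_grad \<theta> = expectation (\<lambda>\<omega>. (sigmoid (X \<omega> \<bullet> \<theta>) - label \<omega>) * (X \<omega> \<bullet> v))"
  using integral_inner_right[OF integrable_weight_X[OF weight_fun_residual], of v \<theta>]
  by (simp add: risk_grad_def inner_commute)

abbreviation risk :: "real ^ 'd \<Rightarrow> real" where
  "risk \<equiv> logistic_risk M X Y"

lemma integrable_loss: "integrable M (\<lambda>\<omega>. softplus (X \<omega> \<bullet> \<theta>) - label \<omega> * (X \<omega> \<bullet> \<theta>))"
proof (rule integrable_bounded[of _ "(1 + R * norm \<theta>) + 1 * (R * norm \<theta>)"])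
  fix \<omega> assume \<omega>: "\<omega> \<in> space M" "norm (X \<omega>) \<le> R"
  have "\<bar>softplus (X \<omega> \<bullet> \<theta>)\<bar> \<le> 1 + R * norm \<theta>"
    using softplus_bound[of "X \<omega> \<bullet> \<theta>"] abs_inner_X_le[OF \<omega>(2), of \<theta>] by linarith
  moreover have "\<bar>label \<omega> * (X \<omega> \<bullet> \<theta>)\<bar> \<le> 1 * (R * norm \<theta>)"
    unfolding abs_mult using label_values[OF \<omega>(1)] abs_inner_X_le[OF \<omega>(2), of \<theta>] by (intro mult_mono) auto
  ultimately show "norm (softplus (X \<omega> \<bullet> \<theta>) - label \<omega> * (X \<omega> \<bullet> \<theta>)) \<le> (1 + R * norm \<theta>) + 1 * (R * norm \<theta>)"
    by simp
qed measurable

lemma logistic_risk_eq: "risk \<theta> = expectation (\<lambda>\<omega>. softplus (X \<omega> \<bullet> \<theta>) - label \<omega> * (X \<omega> \<bullet> \<theta>))"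
  unfolding logistic_risk_def by (intro Bochner_Integration.integral_cong refl ln_logistic_loss Y_values)

text \<open>The label enters linearly and cancels, which leaves the expectation of the scalar Taylor
  error of \<open>softplus\<close>, at most (X . h)^2.\<close>

lemma logistic_risk_taylor:
  "\<bar>risk (\<theta> + h) - risk \<theta> - h \<bullet> risk_grad \<theta>\<bar> \<le> R^2 * (norm h)^2"
proof -
  have int: "integrable M (\<lambda>\<omega>. (sigmoid (X \<omega> \<bullet> \<theta>) - label \<omega>) * (X \<omega> \<bullet> h))"
    using integrable_inner_right[OF integrable_weight_X[OF weight_fun_residual], of h \<theta>] by (simp add: inner_commute)
  have "risk (\<theta> + h) - risk \<theta> - h \<bullet> risk_grad \<theta>
    = expectation (\<lambda>\<omega>. (softplus (X \<omega> \<bullet> (\<theta> + h)) - label \<omega> * (X \<omega> \<bullet> (\<theta> + h)))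
        - (softplus (X \<omega> \<bullet> \<theta>) - label \<omega> * (X \<omega> \<bullet> \<theta>)) - (sigmoid (X \<omega> \<bullet> \<theta>) - label \<omega>) * (X \<omega> \<bullet> h))"
    unfolding logistic_risk_eq inner_risk_grad
    by (simp only: Bochner_Integration.integral_diff Bochner_Integration.integrable_diff integrable_loss int)
  also have "norm \<dots> \<le> R^2 * (norm h)^2"
  proof (rule norm_expectation_le)
    fix \<omega> assume \<omega>: "\<omega> \<in> space M" "norm (X \<omega>) \<le> R"
    have "(softplus (X \<omega> \<bullet> (\<theta> + h)) - label \<omega> * (X \<omega> \<bullet> (\<theta> + h)))
        - (softplus (X \<omega> \<bullet> \<theta>) - label \<omega> * (X \<omega> \<bullet> \<theta>)) - (sigmoid (X \<omega> \<bullet> \<theta>) - label \<omega>) * (X \<omega> \<bullet> h)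
      = softplus (X \<omega> \<bullet> \<theta> + X \<omega> \<bullet> h) - softplus (X \<omega> \<bullet> \<theta>) - sigmoid (X \<omega> \<bullet> \<theta>) * (X \<omega> \<bullet> h)"
      by (simp add: inner_add_right algebra_simps add_divide_distrib)
    also have "norm \<dots> \<le> (X \<omega> \<bullet> h)^2" using softplus_taylor by simp
    also have "\<dots> \<le> (R * norm h)^2"
      by (rule inner_X_square_le[OF \<omega>(2)])
    finally show "norm ((softplus (X \<omega> \<bullet> (\<theta> + h)) - label \<omega> * (X \<omega> \<bullet> (\<theta> + h)))
        - (softplus (X \<omega> \<bullet> \<theta>) - label \<omega> * (X \<omega> \<bullet> \<theta>)) - (sigmoid (X \<omega> \<bullet> \<theta>) - label \<omega>) * (X \<omega> \<bullet> h)) \<le> R^2 * (norm h)^2"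
      by (simp add: power_mult_distrib)
  qed measurable
  finally show ?thesis by simp
qed

text \<open>Two factors R come from the scalar error (X . h)^2 of \<open>sigmoid\<close> and the
  third from the vector X itself.\<close>

lemma risk_grad_taylor: "norm (risk_grad (\<theta> + h) - risk_grad \<theta> - risk_hess \<theta> h) \<le> R ^ 3 * (norm h)^2"
proof -
  have "risk_grad (\<theta> + h) - risk_grad \<theta> - risk_hess \<theta> h
    = expectation (\<lambda>\<omega>. (sigmoid (X \<omega> \<bullet> (\<theta> + h)) - label \<omega>) *\<^sub>R X \<omega> - (sigmoid (X \<omega> \<bullet> \<theta>) - label \<omega>) *\<^sub>R X \<omega>
        - (sigmoid' (X \<omega> \<bullet> \<theta>) * (X \<omega> \<bullet> h)) *\<^sub>R X \<omega>)"
    unfolding risk_grad_def risk_hess_def second_moment_def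
    by (simp only: Bochner_Integration.integral_diff Bochner_Integration.integrable_diff
        integrable_weight_X[OF weight_fun_residual] integrable_weight_second[OF weight_fun_sigmoid'])
  also have "norm \<dots> \<le> R ^ 3 * (norm h)^2"
  proof (rule norm_expectation_le)
    fix \<omega> assume \<omega>: "\<omega> \<in> space M" "norm (X \<omega>) \<le> R"
    have "(sigmoid (X \<omega> \<bullet> (\<theta> + h)) - label \<omega>) *\<^sub>R X \<omega> - (sigmoid (X \<omega> \<bullet> \<theta>) - label \<omega>) *\<^sub>R X \<omega>
        - (sigmoid' (X \<omega> \<bullet> \<theta>) * (X \<omega> \<bullet> h)) *\<^sub>R X \<omega>
      = (sigmoid (X \<omega> \<bullet> \<theta> + X \<omega> \<bullet> h) - sigmoid (X \<omega> \<bullet> \<theta>) - sigmoid' (X \<omega> \<bullet> \<theta>) * (X \<omega> \<bullet> h)) *\<^sub>R X \<omega>"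
      by (simp add: inner_add_right scaleR_diff_left)
    also have "norm \<dots> \<le> (R * norm h)^2 * R"
      unfolding norm_scaleR
    proof (intro mult_mono \<omega>)
      have "\<bar>sigmoid (X \<omega> \<bullet> \<theta> + X \<omega> \<bullet> h) - sigmoid (X \<omega> \<bullet> \<theta>) - sigmoid' (X \<omega> \<bullet> \<theta>) * (X \<omega> \<bullet> h)\<bar> \<le> (X \<omega> \<bullet> h)^2"
        by (rule sigmoid_taylor)
      also have "\<dots> \<le> (R * norm h)^2"
        by (rule inner_X_square_le[OF \<omega>(2)])
      finally show "\<bar>sigmoid (X \<omega> \<bullet> \<theta> + X \<omega> \<bullet> h) - sigmoid (X \<omega> \<bullet> \<theta>) - sigmoid' (X \<omega> \<bullet> \<theta>) * (X \<omega> \<bullet> h)\<bar> \<le> (R * norm h)^2" .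
    qed auto
    finally show "norm ((sigmoid (X \<omega> \<bullet> (\<theta> + h)) - label \<omega>) *\<^sub>R X \<omega> - (sigmoid (X \<omega> \<bullet> \<theta>) - label \<omega>) *\<^sub>R X \<omega>
        - (sigmoid' (X \<omega> \<bullet> \<theta>) * (X \<omega> \<bullet> h)) *\<^sub>R X \<omega>) \<le> R ^ 3 * (norm h)^2"
      by (simp add: power_mult_distrib power2_eq_square power3_eq_cube mult_ac)
  qed measurable
  finally show ?thesis .
qed

lemma linear_risk_hess: "linear (risk_hess \<theta>)"
  unfolding risk_hess_def by (rule linear_second_moment[OF weight_fun_sigmoid'])

lemma GDERIV_logistic_risk: "GDERIV (risk) \<theta> :> risk_grad \<theta>"
  unfolding gderiv_def
  by (rule has_derivative_of_quadratic_remainder[where C = "R^2"])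
    (use logistic_risk_taylor in \<open>auto intro: bounded_linear_inner_left\<close>)

lemma grad_logistic_risk: "grad (risk) = risk_grad"
  by (rule ext) (rule grad_eqI[OF GDERIV_logistic_risk])

lemma risk_grad_has_derivative: "(risk_grad has_derivative risk_hess \<theta>) (at \<theta>)"
  by (rule has_derivative_of_quadratic_remainder[where C = "R ^ 3"])
    (use risk_grad_taylor linear_risk_hess in \<open>auto simp: linear_conv_bounded_linear\<close>)

lemma hess_logistic_risk: "hess (risk) \<theta> = matrix (risk_hess \<theta>)"
  unfolding hess_def grad_logistic_risk jacobian_def
  using frechet_derivative_at[OF risk_grad_has_derivative, of \<theta>] by simp

lemma hess_mult: "hess (risk) \<theta> *v v = risk_hess \<theta> v"
  unfolding hess_logistic_risk using linear_risk_hess[of \<theta>] by (metis matrix_vector_mul(2))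

lemma X_component_measurable [measurable]: "(\<lambda>\<omega>. X \<omega> $ i) \<in> borel_measurable M"
  unfolding cart_eq_inner_axis by measurable

lemma hess_entry:
  "hess (risk) \<theta> $ i $ j = expectation (\<lambda>\<omega>. sigmoid' (X \<omega> \<bullet> \<theta>) * (X \<omega> $ j) * (X \<omega> $ i))"
proof -
  have "hess (risk) \<theta> $ i $ j = axis i 1 \<bullet> risk_hess \<theta> (axis j 1)"
    by (simp add: hess_logistic_risk matrix_def inner_axis')
  then show ?thesis
    unfolding risk_hess_def by (simp add: inner_second_moment[OF weight_fun_sigmoid'] inner_axis)
qed

lemma hess_entry_bound:
  assumes "norm (X \<omega>) \<le> R"
  shows "norm (sigmoid' (X \<omega> \<bullet> \<theta>) * (X \<omega> $ j) * (X \<omega> $ i)) \<le> 1 * R * R"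
proof -
  have "\<bar>X \<omega> $ k\<bar> \<le> R" for k using component_le_norm_cart[of "X \<omega>" k] assms by simp
  then show ?thesis
    unfolding norm_mult using sigmoid'_bounds[of "X \<omega> \<bullet> \<theta>"] R_pos by (intro mult_mono) auto
qed

lemma bounded_hess: "bounded (range (hess (risk)))"
  unfolding bounded_iff
proof (intro exI ballI)
  fix H assume "H \<in> range (hess (risk))"
  then obtain \<theta> where H: "H = hess (risk) \<theta>" by auto
  have "norm H \<le> (\<Sum>i\<in>UNIV. \<Sum>j\<in>UNIV. \<bar>H $ i $ j\<bar>)" by (rule norm_matrix_le_sum)
  also have "\<dots> \<le> (\<Sum>i\<in>(UNIV::'d set). \<Sum>j\<in>(UNIV::'d set). 1 * R * R)"
  proof (intro sum_mono)
    fix i j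
    have "norm (expectation (\<lambda>\<omega>. sigmoid' (X \<omega> \<bullet> \<theta>) * (X \<omega> $ j) * (X \<omega> $ i))) \<le> 1 * R * R"
      by (intro norm_expectation_le hess_entry_bound) measurable
    then show "\<bar>H $ i $ j\<bar> \<le> 1 * R * R" by (simp add: H hess_entry)
  qed
  finally show "norm H \<le> (\<Sum>i\<in>(UNIV::'d set). \<Sum>j\<in>(UNIV::'d set). 1 * R * R)" .
qed

lemma lipschitz_hess: "\<exists>L. L-lipschitz_on UNIV (hess (risk))"
proof (intro exI lipschitz_onI)
  define K where "K = (\<Sum>i\<in>(UNIV::'d set). \<Sum>j\<in>(UNIV::'d set). R ^ 3)"
  show "0 \<le> K" using R_pos by (auto simp: K_def intro!: sum_nonneg)
  fix \<theta> \<theta>' :: "real ^ 'd"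
  let ?H = "hess (risk)"
  have "norm (?H \<theta> - ?H \<theta>') \<le> (\<Sum>i\<in>UNIV. \<Sum>j\<in>UNIV. \<bar>(?H \<theta> - ?H \<theta>') $ i $ j\<bar>)" by (rule norm_matrix_le_sum)
  also have "\<dots> \<le> (\<Sum>i\<in>(UNIV::'d set). \<Sum>j\<in>(UNIV::'d set). R ^ 3 * norm (\<theta> - \<theta>'))"
  proof (intro sum_mono)
    fix i j
    have int: "integrable M (\<lambda>\<omega>. sigmoid' (X \<omega> \<bullet> \<theta>) * (X \<omega> $ j) * (X \<omega> $ i))" for \<theta>
      by (intro integrable_bounded[where K = "1 * R * R"] hess_entry_bound) measurable
    have "(?H \<theta> - ?H \<theta>') $ i $ j = expectation (\<lambda>\<omega>. sigmoid' (X \<omega> \<bullet> \<theta>) * (X \<omega> $ j) * (X \<omega> $ i)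
        - sigmoid' (X \<omega> \<bullet> \<theta>') * (X \<omega> $ j) * (X \<omega> $ i))"
      using int by (simp add: hess_entry)
    also have "norm \<dots> \<le> (R * norm (\<theta> - \<theta>')) * R * R"
    proof (rule norm_expectation_le)
      fix \<omega> assume \<omega>: "norm (X \<omega>) \<le> R"
      then have k: "\<bar>X \<omega> $ k\<bar> \<le> R" for k using component_le_norm_cart[of "X \<omega>" k] by simp
      have "\<bar>sigmoid' (X \<omega> \<bullet> \<theta>) - sigmoid' (X \<omega> \<bullet> \<theta>')\<bar> \<le> \<bar>X \<omega> \<bullet> (\<theta> - \<theta>')\<bar>"
        using abs_sigmoid'_diff_le by (simp add: inner_diff_right)
      also have "\<dots> \<le> R * norm (\<theta> - \<theta>')" by (rule abs_inner_X_le[OF \<omega>])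
      finally have "\<bar>sigmoid' (X \<omega> \<bullet> \<theta>) - sigmoid' (X \<omega> \<bullet> \<theta>')\<bar> * \<bar>X \<omega> $ j\<bar> * \<bar>X \<omega> $ i\<bar> \<le> (R * norm (\<theta> - \<theta>')) * R * R"
        using k R_pos by (intro mult_mono) auto
      then show "norm (sigmoid' (X \<omega> \<bullet> \<theta>) * (X \<omega> $ j) * (X \<omega> $ i)
        - sigmoid' (X \<omega> \<bullet> \<theta>') * (X \<omega> $ j) * (X \<omega> $ i)) \<le> (R * norm (\<theta> - \<theta>')) * R * R"
        by (simp add: left_diff_distrib flip: abs_mult)
    qed measurable
    finally show "\<bar>(?H \<theta> - ?H \<theta>') $ i $ j\<bar> \<le> R ^ 3 * norm (\<theta> - \<theta>')"
      by (simp add: power3_eq_cube mult_ac)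
  qed
  also have "\<dots> = K * norm (\<theta> - \<theta>')" by (simp add: K_def sum_distrib_right)
  finally show "dist (?H \<theta>) (?H \<theta>') \<le> K * dist \<theta> \<theta>'" by (simp add: dist_norm)
qed

lemma convex_logistic_risk: "convex_on UNIV (risk)"
proof (rule convex_onI)
  fix t :: real and x y :: "real ^ 'd"
  assume t: "0 < t" "t < 1"
  let ?l = "\<lambda>\<theta> \<omega>. softplus (X \<omega> \<bullet> \<theta>) - label \<omega> * (X \<omega> \<bullet> \<theta>)"
  have "risk ((1 - t) *\<^sub>R x + t *\<^sub>R y) \<le> expectation (\<lambda>\<omega>. (1 - t) * ?l x \<omega> + t * ?l y \<omega>)"
    unfolding logistic_risk_eq
  proof (rule expectation_mono_bounded)
    fix \<omega>
    have "softplus ((1 - t) *\<^sub>R (X \<omega> \<bullet> x) + t *\<^sub>R (X \<omega> \<bullet> y)) \<le> (1 - t) * softplus (X \<omega> \<bullet> x) + t * softplus (X \<omega> \<bullet> y)"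
      using t by (intro convex_onD[OF softplus_convex]) auto
    moreover define p where "p = label \<omega>"
    ultimately show "?l ((1 - t) *\<^sub>R x + t *\<^sub>R y) \<omega> \<le> (1 - t) * ?l x \<omega> + t * ?l y \<omega>"
      unfolding p_def[symmetric] inner_add_right inner_scaleR_right by (simp add: algebra_simps)
  qed (intro integrable_loss Bochner_Integration.integrable_add integrable_mult_right)+
  also have "\<dots> = (1 - t) * risk x + t * risk y"
    unfolding logistic_risk_eq using integrable_loss by simp
  finally show "risk ((1 - t) *\<^sub>R x + t *\<^sub>R y) \<le> (1 - t) * risk x + t * risk y" .
qed simp

text \<open>Tower property: \<open>X \<omega> \<bullet> v\<close> is measurable for the
  sigma-algebra of \<open>X\<close>, so the label may be replaced by its conditional probability.
  This is where the logistic law of \<open>Y\<close> given \<open>X\<close> enters.\<close>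

lemma expectation_label:
  "expectation (\<lambda>\<omega>. label \<omega> * (X \<omega> \<bullet> v)) = expectation (\<lambda>\<omega>. sigmoid (X \<omega> \<bullet> \<theta>s) * (X \<omega> \<bullet> v))"
proof -
  let ?F = "vimage_algebra (space M) X borel" and ?I = "indicator {\<omega> \<in> space M. Y \<omega> = 1} :: 'a \<Rightarrow> real"
  have "subalgebra M ?F"
    unfolding subalgebra_def using sets_image_in_sets[OF refl X_measurable] by auto
  then interpret finite_measure_subalgebra M ?F by unfold_locales
  have XF: "X \<in> ?F \<rightarrow>\<^sub>M borel" by (rule measurable_vimage_algebra1) auto
  have m: "(\<lambda>\<omega>. X \<omega> \<bullet> v) \<in> borel_measurable ?F"
    by (rule measurable_compose[OF XF]) measurable
  have I: "?I \<omega> = label \<omega>" if "\<omega> \<in> space M" for \<omega>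
    using Y_values[OF that] that by auto
  have [measurable]: "?I \<in> borel_measurable M" by measurable
  have int: "integrable M (\<lambda>\<omega>. (X \<omega> \<bullet> v) * ?I \<omega>)"
  proof (rule integrable_bounded[of _ "R * norm v * 1"])
    fix \<omega> assume "\<omega> \<in> space M" "norm (X \<omega>) \<le> R"
    then show "norm ((X \<omega> \<bullet> v) * ?I \<omega>) \<le> R * norm v * 1"
      unfolding norm_mult using abs_inner_X_le[of \<omega> v] R_pos by (intro mult_mono) auto
  qed measurable
  have "expectation (\<lambda>\<omega>. label \<omega> * (X \<omega> \<bullet> v)) = expectation (\<lambda>\<omega>. (X \<omega> \<bullet> v) * ?I \<omega>)"
    by (rule Bochner_Integration.integral_cong) (simp_all only: I mult.commute)
  also have "\<dots> = expectation (\<lambda>\<omega>. (X \<omega> \<bullet> v) * real_cond_exp M ?F ?I \<omega>)"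
    by (rule real_cond_exp_intg(2)[OF int m, symmetric]) measurable
  also have "\<dots> = expectation (\<lambda>\<omega>. sigmoid (X \<omega> \<bullet> \<theta>s) * (X \<omega> \<bullet> v))"
    using cond by (intro integral_cong_AE) (auto simp: mult.commute)
  finally show ?thesis .
qed

lemma integrable_sigmoid_inner: "integrable M (\<lambda>\<omega>. sigmoid (X \<omega> \<bullet> \<theta>) * (X \<omega> \<bullet> v))"
proof (rule integrable_bounded[of _ "1 * (R * norm v)"])
  fix \<omega> assume "norm (X \<omega>) \<le> R"
  then show "norm (sigmoid (X \<omega> \<bullet> \<theta>) * (X \<omega> \<bullet> v)) \<le> 1 * (R * norm v)"
    unfolding norm_mult using abs_inner_X_le[of \<omega> v] sigmoid_bounds[of "X \<omega> \<bullet> \<theta>"] by (intro mult_mono) auto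
qed measurable

text \<open>In this form the gradient visibly vanishes at \<theta>s, and monotonicity of
  \<open>sigmoid\<close> gives the sign of the drift.\<close>

lemma inner_risk_grad_centered:
  "v \<bullet> risk_grad \<theta> = expectation (\<lambda>\<omega>. (sigmoid (X \<omega> \<bullet> \<theta>) - sigmoid (X \<omega> \<bullet> \<theta>s)) * (X \<omega> \<bullet> v))"
proof -
  have int: "integrable M (\<lambda>\<omega>. label \<omega> * (X \<omega> \<bullet> v))"
  proof (rule integrable_bounded[of _ "1 * (R * norm v)"])
    fix \<omega> assume "\<omega> \<in> space M" "norm (X \<omega>) \<le> R"
    then show "norm (label \<omega> * (X \<omega> \<bullet> v)) \<le> 1 * (R * norm v)"
      unfolding norm_mult using abs_inner_X_le[of \<omega> v] label_values[of \<omega>] by (intro mult_mono) auto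
  qed measurable
  have "v \<bullet> risk_grad \<theta> = expectation (\<lambda>\<omega>. sigmoid (X \<omega> \<bullet> \<theta>) * (X \<omega> \<bullet> v)) - expectation (\<lambda>\<omega>. label \<omega> * (X \<omega> \<bullet> v))"
    unfolding inner_risk_grad left_diff_distrib by (rule Bochner_Integration.integral_diff[OF integrable_sigmoid_inner int])
  then show ?thesis unfolding expectation_label left_diff_distrib
    by (simp add: Bochner_Integration.integral_diff[OF integrable_sigmoid_inner integrable_sigmoid_inner])
qed

lemma risk_grad_root: "risk_grad \<theta>s = 0"
  using inner_risk_grad_centered[of "risk_grad \<theta>s" \<theta>s] by simp

text \<open>The lower bound of \<open>sigmoid'_ge\<close> at the largest possible |X . \<theta>s|,
  hence uniform over the support of \<open>X\<close>.\<close>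

definition curvature :: real where
  "curvature = exp (- (R * norm \<theta>s)) / 4"

lemma curvature_pos: "curvature > 0"
  by (simp add: curvature_def)

lemma curvature_le:
  assumes "norm (X \<omega>) \<le> R"
  shows "curvature \<le> sigmoid' (X \<omega> \<bullet> \<theta>s)"
proof -
  have "curvature \<le> exp (- \<bar>X \<omega> \<bullet> \<theta>s\<bar>) / 4"
    using abs_inner_X_le[OF assms, of \<theta>s] by (simp add: curvature_def)
  also have "\<dots> \<le> sigmoid' (X \<omega> \<bullet> \<theta>s)" by (rule sigmoid'_ge)
  finally show ?thesis .
qed

lemma risk_hess_coercive:
  obtains \<mu> where "\<mu> > 0" "\<And>v. \<mu> * (norm v)^2 \<le> v \<bullet> risk_hess \<theta>s v"
proof -
  obtain l where l: "l > 0" "\<And>v. l * (norm v)^2 \<le> expectation (\<lambda>\<omega>. (X \<omega> \<bullet> v)^2)"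
    using second_moment_coercive by blast
  have "curvature * l * (norm v)^2 \<le> v \<bullet> risk_hess \<theta>s v" for v
  proof -
    have "curvature * l * (norm v)^2 \<le> curvature * expectation (\<lambda>\<omega>. (X \<omega> \<bullet> v)^2)"
      using mult_left_mono[OF l(2)[of v], of curvature] curvature_pos by simp
    also have "\<dots> = expectation (\<lambda>\<omega>. curvature * (X \<omega> \<bullet> v)^2)" by simp
    also have "\<dots> \<le> expectation (\<lambda>\<omega>. sigmoid' (X \<omega> \<bullet> \<theta>s) * (X \<omega> \<bullet> v) * (X \<omega> \<bullet> v))"
    proof (rule expectation_mono_bounded)
      show "integrable M (\<lambda>\<omega>. sigmoid' (X \<omega> \<bullet> \<theta>s) * (X \<omega> \<bullet> v) * (X \<omega> \<bullet> v))"
        using integrable_inner_right[OF integrable_weight_second[OF weight_fun_sigmoid'], of v \<theta>s v]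
        by (simp add: inner_commute)
      show "curvature * (X \<omega> \<bullet> v)^2 \<le> sigmoid' (X \<omega> \<bullet> \<theta>s) * (X \<omega> \<bullet> v) * (X \<omega> \<bullet> v)" if "norm (X \<omega>) \<le> R" for \<omega>
        using mult_right_mono[OF curvature_le[OF that], of "(X \<omega> \<bullet> v)^2"] by (simp add: power2_eq_square mult.assoc)
    qed (intro integrable_mult_right integrable_inner_square)
    also have "\<dots> = v \<bullet> risk_hess \<theta>s v" by (simp add: risk_hess_def inner_second_moment[OF weight_fun_sigmoid'])
    finally show ?thesis .
  qed
  with that[of "curvature * l"] curvature_pos l show ?thesis by simp
qed

lemma invertible_hess: "invertible (hess (risk) \<theta>s)"
proof -
  obtain \<mu> where \<mu>: "\<mu> > 0" "\<And>v. \<mu> * (norm v)^2 \<le> v \<bullet> risk_hess \<theta>s v"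
    using risk_hess_coercive by blast
  have "v = 0" if "hess (risk) \<theta>s *v v = 0" for v
  proof -
    have "\<mu> * (norm v)^2 \<le> 0" using \<mu>(2)[of v] that by (simp add: hess_mult)
    then show "v = 0" using \<mu>(1) by (simp add: mult_le_0_iff)
  qed
  then show ?thesis unfolding invertible_left_inverse matrix_left_invertible_ker by blast
qed

text \<open>Apply \<open>sigmoid_increment\<close> with increment \<tau> = X . v. Since |\<tau>| <=
  R |v|, the denominator can be made deterministic and leaves the expectation, where the coercive
  second moment remains.\<close>

lemma risk_grad_drift_sublinear:
  obtains l where "l > 0" "\<And>v. l * ((norm v)^2 / (1 + R * norm v)) \<le> v \<bullet> risk_grad (\<theta>s + v)"
proof -
  obtain l where l: "l > 0" "\<And>v. l * (norm v)^2 \<le> expectation (\<lambda>\<omega>. (X \<omega> \<bullet> v)^2)"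
    using second_moment_coercive by blast
  have "curvature * l * ((norm v)^2 / (1 + R * norm v)) \<le> v \<bullet> risk_grad (\<theta>s + v)" for v
  proof -
    define a where "a = curvature / (1 + R * norm v)"
    have r: "1 + R * norm v \<ge> 1" using R_pos by simp
    then have a: "a \<ge> 0" using curvature_pos by (simp add: a_def)
    have "curvature * l * ((norm v)^2 / (1 + R * norm v)) = a * (l * (norm v)^2)" by (simp add: a_def)
    also have "\<dots> \<le> a * expectation (\<lambda>\<omega>. (X \<omega> \<bullet> v)^2)" by (intro mult_left_mono l a)
    also have "\<dots> = expectation (\<lambda>\<omega>. a * (X \<omega> \<bullet> v)^2)" by simp
    also have "\<dots> \<le> expectation (\<lambda>\<omega>. (sigmoid (X \<omega> \<bullet> (\<theta>s + v)) - sigmoid (X \<omega> \<bullet> \<theta>s)) * (X \<omega> \<bullet> v))"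
    proof (rule expectation_mono_bounded)
      show "integrable M (\<lambda>\<omega>. (sigmoid (X \<omega> \<bullet> (\<theta>s + v)) - sigmoid (X \<omega> \<bullet> \<theta>s)) * (X \<omega> \<bullet> v))"
        unfolding left_diff_distrib by (intro Bochner_Integration.integrable_diff integrable_sigmoid_inner)
      fix \<omega> assume \<omega>: "norm (X \<omega>) \<le> R"
      define \<tau> where "\<tau> = X \<omega> \<bullet> v"
      have \<tau>: "1 + \<bar>\<tau>\<bar> \<le> 1 + R * norm v" using abs_inner_X_le[OF \<omega>, of v] by (simp add: \<tau>_def)
      have "a * \<tau>^2 = curvature * (\<tau>^2 / (1 + R * norm v))" by (simp add: a_def)
      also have "\<dots> \<le> sigmoid' (X \<omega> \<bullet> \<theta>s) * (\<tau>^2 / (1 + \<bar>\<tau>\<bar>))"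
        using \<tau> r sigmoid'_bounds[of "X \<omega> \<bullet> \<theta>s"]
        by (intro mult_mono curvature_le[OF \<omega>] divide_left_mono mult_pos_pos) (auto simp: add_pos_nonneg)
      also have "\<dots> \<le> (sigmoid (X \<omega> \<bullet> \<theta>s + \<tau>) - sigmoid (X \<omega> \<bullet> \<theta>s)) * \<tau>" by (rule sigmoid_increment)
      finally show "a * (X \<omega> \<bullet> v)^2 \<le> (sigmoid (X \<omega> \<bullet> (\<theta>s + v)) - sigmoid (X \<omega> \<bullet> \<theta>s)) * (X \<omega> \<bullet> v)"
        by (simp add: \<tau>_def inner_add_right)
    qed (intro integrable_mult_right integrable_inner_square)
    also have "\<dots> = v \<bullet> risk_grad (\<theta>s + v)" by (simp add: inner_risk_grad_centered)
    finally show ?thesis .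
  qed
  with that[of "curvature * l"] curvature_pos l show ?thesis by simp
qed

lemma norm_risk_grad_le: "norm (risk_grad \<theta>) \<le> R"
  unfolding risk_grad_def
proof (rule norm_expectation_le)
  show "norm ((sigmoid (X \<omega> \<bullet> \<theta>) - label \<omega>) *\<^sub>R X \<omega>) \<le> R" if "\<omega> \<in> space M" "norm (X \<omega>) \<le> R" for \<omega>
    using weight_fun_residual[of \<theta>] that mult_mono[of "\<bar>sigmoid (X \<omega> \<bullet> \<theta>) - label \<omega>\<bar>" 1 "norm (X \<omega>)" R]
    by (auto simp: weight_fun_def)
qed measurable

text \<open>Cauchy-Schwarz turns the drift into |grad| >= l |v| / (1 + R |v|). The right side
  increases with |v|, so l / (1 + R) is a lower bound as soon as |v| >= 1, where v is the distance
  vector from \<theta>s.\<close>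

lemma Liminf_risk_grad: "Liminf at_infinity (\<lambda>\<theta>. ereal (norm (risk_grad \<theta>))) > 0"
proof -
  obtain l where l: "l > 0" "\<And>v. l * ((norm v)^2 / (1 + R * norm v)) \<le> v \<bullet> risk_grad (\<theta>s + v)"
    using risk_grad_drift_sublinear by blast
  have "l / (1 + R) \<le> norm (risk_grad \<theta>)" if "1 + norm \<theta>s \<le> norm \<theta>" for \<theta>
  proof -
    define v where "v = \<theta> - \<theta>s"
    have v: "norm v \<ge> 1" using that norm_triangle_ineq2[of \<theta> \<theta>s] by (simp add: v_def)
    have "l * (norm v / (1 + R * norm v)) * norm v = l * ((norm v)^2 / (1 + R * norm v))"
      by (simp add: power2_eq_square)
    also have "\<dots> \<le> v \<bullet> risk_grad (\<theta>s + v)" by (rule l)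
    also have "\<dots> \<le> norm v * norm (risk_grad (\<theta>s + v))" by (rule norm_cauchy_schwarz)
    finally have "l * (norm v / (1 + R * norm v)) * norm v \<le> norm (risk_grad \<theta>) * norm v"
      by (simp add: v_def mult.commute)
    then have *: "l * (norm v / (1 + R * norm v)) \<le> norm (risk_grad \<theta>)"
      by (rule mult_right_le_imp_le) (use v in linarith)
    have "1 / (1 + R) \<le> norm v / (1 + R * norm v)"
    proof -
      have p: "0 < 1 + R" "0 < 1 + R * norm v" using R_pos v by (auto intro: add_pos_nonneg)
      have "1 * (1 + R * norm v) \<le> norm v * (1 + R)" using v by (simp add: algebra_simps)
      then show ?thesis using p by (simp add: divide_le_eq le_divide_eq mult.commute)
    qed
    then have "l * (1 / (1 + R)) \<le> l * (norm v / (1 + R * norm v))"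
      using l(1) by (intro mult_left_mono) auto
    with * show ?thesis by simp
  qed
  then have "eventually (\<lambda>\<theta>. ereal (l / (1 + R)) \<le> ereal (norm (risk_grad \<theta>))) at_infinity"
    unfolding eventually_at_infinity by auto
  then have "ereal (l / (1 + R)) \<le> Liminf at_infinity (\<lambda>\<theta>. ereal (norm (risk_grad \<theta>)))"
    by (rule Liminf_bounded)
  moreover have "0 < ereal (l / (1 + R))" using l R_pos by simp
  ultimately show ?thesis by (rule less_le_trans[rotated])
qed

lemma Limsup_risk_grad: "Limsup at_infinity (\<lambda>\<theta>. ereal (norm (risk_grad \<theta>))) < \<infinity>"
proof -
  have "Limsup at_infinity (\<lambda>\<theta>. ereal (norm (risk_grad \<theta>))) \<le> ereal R"
    using norm_risk_grad_le by (intro Limsup_bounded always_eventually) auto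
  then show ?thesis by (rule order.strict_trans1) simp
qed

end

section \<open>Logistic regression by averaged stochastic gradient\<close>

text \<open>Symmetry puts both copies of \<open>B\<close> in row form, so that the sum agrees term
  by term with the expansion in \<open>norm_matrix_vector_mult_square\<close>.\<close>

lemma trace_sandwich:
  fixes B S :: "real ^ 'n ^ 'n"
  assumes "transpose B = B"
  shows "trace (B ** S ** B) = (\<Sum>i\<in>UNIV. \<Sum>k\<in>UNIV. \<Sum>j\<in>UNIV. B $ i $ j * S $ j $ k * B $ i $ k)"
proof -
  have B: "B $ k $ i = B $ i $ k" for i k
    using assms by (metis transpose_def vec_lambda_beta)
  show ?thesis
    by (simp add: trace_def matrix_matrix_mult_def sum_distrib_right B)
qed

lemma norm_matrix_vector_mult_square:
  fixes B :: "real ^ 'n ^ 'n"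
  shows "(norm (B *v z))^2 = (\<Sum>i\<in>UNIV. \<Sum>k\<in>UNIV. \<Sum>j\<in>UNIV. B $ i $ j * (z $ j * z $ k) * B $ i $ k)"
  unfolding power2_norm_eq_inner inner_vec_def
  by (simp add: matrix_vector_mult_def sum_product sum_distrib_left mult_ac)

lemma invertible_matrix_inv:
  fixes A :: "real ^ 'n ^ 'n"
  assumes "invertible A"
  shows "A ** matrix_inv A = mat 1 \<and> matrix_inv A ** A = mat 1"
  using assms unfolding invertible_def matrix_inv_def by (rule someI_ex)

lemma transpose_matrix_inv:
  fixes A :: "real ^ 'n ^ 'n"
  assumes A: "invertible A" and sym: "transpose A = A"
  shows "transpose (matrix_inv A) = matrix_inv A"
proof -
  let ?B = "matrix_inv A"
  have AB: "A ** ?B = mat 1" using invertible_matrix_inv[OF A] by blast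
  then have "transpose (A ** ?B) = mat 1" by (simp add: transpose_mat)
  then have "transpose ?B ** A = mat 1" by (simp add: matrix_transpose_mul sym)
  then have "transpose ?B ** A ** ?B = ?B" by simp
  then show ?thesis by (simp add: AB flip: matrix_mul_assoc)
qed

context logistic_model
begin

lemma transpose_hess: "transpose (hess (risk) \<theta>) = hess (risk) \<theta>"
  by (simp add: transpose_def vec_eq_iff hess_entry mult_ac)

lemma step_measurable [measurable]: "(\<lambda>\<omega>. logistic_step (X \<omega>) (Y \<omega>) \<theta>) \<in> borel_measurable M"
  unfolding logistic_step_def by measurable

lemma norm_logistic_step_le:
  assumes "y \<in> {- 1, 1}" "norm x \<le> R"
  shows "norm (logistic_step x y \<theta>) \<le> R"
proof -
  have "\<bar>sigmoid (x \<bullet> \<theta>) - (y + 1) / 2\<bar> \<le> 1"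
    using assms(1) sigmoid_bounds[of "x \<bullet> \<theta>"] by auto
  then have "\<bar>sigmoid (x \<bullet> \<theta>) - (y + 1) / 2\<bar> * norm x \<le> 1 * R"
    using assms(2) by (intro mult_mono) auto
  then show ?thesis unfolding logistic_step_eq[OF assms(1)] by simp
qed

lemma expectation_step: "expectation (\<lambda>\<omega>. logistic_step (X \<omega>) (Y \<omega>) \<theta>) = - risk_grad \<theta>"
proof -
  have "expectation (\<lambda>\<omega>. logistic_step (X \<omega>) (Y \<omega>) \<theta>) = expectation (\<lambda>\<omega>. - ((sigmoid (X \<omega> \<bullet> \<theta>) - label \<omega>) *\<^sub>R X \<omega>))"
    by (intro Bochner_Integration.integral_cong refl logistic_step_eq Y_values)
  then show ?thesis by (simp add: risk_grad_def)
qed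

text \<open>The mean of the step is minus the gradient, which is zero at \<theta>s, so the
  covariance is the raw second moment.\<close>

lemma noise_cov_root:
  "noise_cov M X Y \<theta>s $ i $ j
    = expectation (\<lambda>\<omega>. logistic_step (X \<omega>) (Y \<omega>) \<theta>s $ i * logistic_step (X \<omega>) (Y \<omega>) \<theta>s $ j)"
proof -
  have int: "integrable M (\<lambda>\<omega>. logistic_step (X \<omega>) (Y \<omega>) \<theta>s)"
    using norm_logistic_step_le Y_values by (intro integrable_bounded[of _ R]) auto
  have "expectation (\<lambda>\<omega>. logistic_step (X \<omega>) (Y \<omega>) \<theta>s $ i) = 0" for i
    unfolding cart_eq_inner_axis using integral_inner_left[OF int, of "axis i 1"]
    by (simp add: expectation_step risk_grad_root)
  then show ?thesis by (simp add: noise_cov_def cov_matrix_def)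
qed

text \<open>Tr(B S B) = E|B z|^2 for symmetric B and S = E[z z^T]. This identifies the leading
  constant of \<open>averaging_bound\<close>.\<close>

lemma trace_asymptotic_cov:
  "trace (asymptotic_cov M X Y \<theta>s)
    = expectation (\<lambda>\<omega>. (norm (matrix_inv (hess (risk) \<theta>s) *v logistic_step (X \<omega>) (Y \<omega>) \<theta>s))^2)"
proof -
  let ?B = "matrix_inv (hess (risk) \<theta>s)"
  have int: "integrable M (\<lambda>\<omega>. logistic_step (X \<omega>) (Y \<omega>) \<theta>s $ j * logistic_step (X \<omega>) (Y \<omega>) \<theta>s $ k)" for j k
  proof (rule integrable_bounded[of _ "R * R"])
    show "(\<lambda>\<omega>. logistic_step (X \<omega>) (Y \<omega>) \<theta>s $ j * logistic_step (X \<omega>) (Y \<omega>) \<theta>s $ k) \<in> borel_measurable M"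
      unfolding cart_eq_inner_axis by measurable
    fix \<omega> assume "\<omega> \<in> space M" "norm (X \<omega>) \<le> R"
    then have "norm (logistic_step (X \<omega>) (Y \<omega>) \<theta>s) \<le> R" by (intro norm_logistic_step_le Y_values)
    then have "\<bar>logistic_step (X \<omega>) (Y \<omega>) \<theta>s $ i\<bar> \<le> R" for i
      using component_le_norm_cart[of "logistic_step (X \<omega>) (Y \<omega>) \<theta>s" i] by simp
    then show "norm (logistic_step (X \<omega>) (Y \<omega>) \<theta>s $ j * logistic_step (X \<omega>) (Y \<omega>) \<theta>s $ k) \<le> R * R"
      unfolding norm_mult using R_pos by (intro mult_mono) auto
  qed
  show ?thesis
    unfolding asymptotic_cov_def trace_sandwich[OF transpose_matrix_inv[OF invertible_hess transpose_hess]]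
      norm_matrix_vector_mult_square noise_cov_root
    using int by (simp add: Bochner_Integration.integral_sum)
qed

lemma logistic_step_lipschitz:
  assumes "y \<in> {- 1, 1}" "norm x \<le> R"
  shows "norm (logistic_step x y \<theta> - logistic_step x y \<theta>') \<le> R^2 * norm (\<theta> - \<theta>')"
proof -
  have "logistic_step x y \<theta> - logistic_step x y \<theta>' = (sigmoid (x \<bullet> \<theta>') - sigmoid (x \<bullet> \<theta>)) *\<^sub>R x"
    unfolding logistic_step_eq[OF assms(1)] by (simp add: algebra_simps)
  also have "norm \<dots> \<le> (R * norm (\<theta> - \<theta>')) * R"
    unfolding norm_scaleR
  proof (intro mult_mono assms)
    have "\<bar>sigmoid (x \<bullet> \<theta>') - sigmoid (x \<bullet> \<theta>)\<bar> \<le> \<bar>x \<bullet> (\<theta> - \<theta>')\<bar>"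
      using abs_sigmoid_diff_le[of "x \<bullet> \<theta>'" "x \<bullet> \<theta>"] by (simp add: inner_diff_right abs_minus_commute)
    also have "\<dots> \<le> norm x * norm (\<theta> - \<theta>')" by (rule Cauchy_Schwarz_ineq2)
    also have "\<dots> \<le> R * norm (\<theta> - \<theta>')" using assms by (intro mult_right_mono) auto
    finally show "\<bar>sigmoid (x \<bullet> \<theta>') - sigmoid (x \<bullet> \<theta>)\<bar> \<le> R * norm (\<theta> - \<theta>')" .
  qed (use R_pos in auto)
  finally show ?thesis by (simp add: power2_eq_square mult_ac)
qed

text \<open>Brings the drift into the form with the smooth radius r, using 1 + R |v| <= (1 + R)
  r.\<close>

lemma risk_grad_drift:
  obtains c where "c > 0" "\<And>v. c * ((norm v)^2 / sqrt (1 + (norm v)^2)) \<le> v \<bullet> risk_grad (\<theta>s + v)"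
proof -
  obtain l where l: "l > 0" "\<And>v. l * ((norm v)^2 / (1 + R * norm v)) \<le> v \<bullet> risk_grad (\<theta>s + v)"
    using risk_grad_drift_sublinear by blast
  have "l / (1 + R) * ((norm v)^2 / sqrt (1 + (norm v)^2)) \<le> v \<bullet> risk_grad (\<theta>s + v)" for v
  proof -
    define r where "r = sqrt (1 + (norm v)^2)"
    have r: "r \<ge> 1" "norm v \<le> r"
      using radius_ge_1[of v] norm_le_radius[of v] by (simp_all add: r_def radius_def)
    have "R * norm v \<le> R * r" using R_pos by (intro mult_left_mono r) auto
    then have "1 + R * norm v \<le> (1 + R) * r" using r by (simp add: distrib_right)
    then have "(norm v)^2 / ((1 + R) * r) \<le> (norm v)^2 / (1 + R * norm v)"
      using R_pos r by (intro divide_left_mono mult_pos_pos) (auto simp: add_pos_nonneg)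
    then have "l * ((norm v)^2 / ((1 + R) * r)) \<le> l * ((norm v)^2 / (1 + R * norm v))"
      using l(1) by (intro mult_left_mono) auto
    also have "\<dots> \<le> v \<bullet> risk_grad (\<theta>s + v)" by (rule l)
    finally show ?thesis by (simp add: r_def mult_ac)
  qed
  with that[of "l / (1 + R)"] l(1) R_pos show ?thesis by simp
qed

lemma continuous_on_risk_grad: "continuous_on UNIV risk_grad"
  using risk_grad_has_derivative by (intro has_derivative_continuous_on) (blast intro: has_derivative_at_withinI)

lemma averaged_sgd_bound:
  assumes iid: "iid_copies M (\<lambda>n \<omega>. (Xs n \<omega>, Ys n \<omega>)) (\<lambda>\<omega>. (X \<omega>, Y \<omega>))" and \<gamma>: "\<gamma> > 0"
  shows "\<exists>C>0. \<forall>n\<ge>1.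
    expectation (\<lambda>\<omega>. (norm (averaged_sgd (\<lambda>k. \<gamma> * real k powr (-3/4)) \<theta>0 (\<lambda>k. Xs k \<omega>) (\<lambda>k. Ys k \<omega>) n - \<theta>s))^2)
    \<le> trace (asymptotic_cov M X Y \<theta>s) / real n + C * real n powr (-5/4)"
proof -
  obtain \<mu> where \<mu>: "\<mu> > 0" "\<And>v. \<mu> * (norm v)^2 \<le> v \<bullet> risk_hess \<theta>s v"
    using risk_hess_coercive by blast
  obtain c where c: "c > 0" "\<And>v. c * ((norm v)^2 / sqrt (1 + (norm v)^2)) \<le> v \<bullet> risk_grad (\<theta>s + v)"
    using risk_grad_drift by blast
  define Z where "Z n \<omega> = (Xs n \<omega>, Ys n \<omega>)" for n \<omega>
  define \<nu> where "\<nu> = distr M borel (\<lambda>\<omega>. (X \<omega>, Y \<omega>))"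
  define g where "g z v = logistic_step (fst z) (snd z) (\<theta>s + v)" for z :: "(real ^ 'd) \<times> real" and v
  have XY [measurable]: "(\<lambda>\<omega>. (X \<omega>, Y \<omega>)) \<in> borel_measurable M" by (rule borel_measurable_Pair) measurable
  have fst_snd [measurable]: "fst \<in> borel_measurable (borel :: ((real ^ 'd) \<times> real) measure)"
    "snd \<in> borel_measurable (borel :: ((real ^ 'd) \<times> real) measure)"
    by (auto intro!: borel_measurable_continuous_onI continuous_on_fst continuous_on_snd continuous_on_id)
  \<comment> \<open>Stated for the observation itself, so that the bounds on \<open>g\<close> hold
    off one null set simultaneously for all parameters.\<close>
  have support: "AE z in \<nu>. norm (fst z) \<le> R \<and> snd z \<in> {- 1, 1}"
    unfolding \<nu>_def
  proof (subst AE_distr_iff)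
    show "AE \<omega> in M. norm (fst (X \<omega>, Y \<omega>)) \<le> R \<and> snd (X \<omega>, Y \<omega>) \<in> {- 1, 1}"
      using X_bounded AE_space by eventually_elim (use Y_values in auto)
    show "{z \<in> space borel. norm (fst z) \<le> R \<and> snd z \<in> {- 1, 1 :: real}} \<in> sets (borel :: ((real ^ 'd) \<times> real) measure)"
      by (simp add: insert_iff) measurable
  qed (rule XY)
  have g_meas: "(\<lambda>(z, v). g z v) \<in> borel_measurable (borel \<Otimes>\<^sub>M borel)"
    unfolding g_def logistic_step_def by (simp add: case_prod_beta) measurable
  have gz: "(\<lambda>z. g z v) \<in> borel_measurable borel" for v
    unfolding g_def logistic_step_def by measurable
  \<comment> \<open>The state is the deviation from \<theta>s. One constant must serve both roles of
    \<open>L\<close>: R^2 is the Lipschitz constant of the step, R^3 the Taylor constant of the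
    gradient.\<close>
  interpret rm: robbins_monro M borel Z \<nu> g "\<lambda>v. risk_grad (\<theta>s + v)" "risk_hess \<theta>s" "\<theta>0 - \<theta>s" \<gamma> R "R^2 + R ^ 3" c \<mu>
  proof
    show "indep_vars (\<lambda>_. borel) Z UNIV" using iid by (simp add: iid_copies_def Z_def[abs_def])
    show "distr M borel (Z n) = \<nu>" for n using iid by (simp add: iid_copies_def Z_def[abs_def] \<nu>_def)
    show "(\<lambda>(z, v). g z v) \<in> borel_measurable (borel \<Otimes>\<^sub>M borel)" by (rule g_meas)
    show "AE z in \<nu>. \<forall>v. norm (g z v) \<le> R"
      using support by eventually_elim (auto simp: g_def intro!: norm_logistic_step_le)
    show "AE z in \<nu>. \<forall>v. norm (g z v - g z 0) \<le> (R^2 + R ^ 3) * norm v"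
      using support
    proof eventually_elim
      case (elim z)
      show ?case
      proof
        fix v
        have "norm (g z v - g z 0) \<le> R^2 * norm v"
          using logistic_step_lipschitz[of "snd z" "fst z" "\<theta>s + v" "\<theta>s + 0"] elim by (simp add: g_def)
        also have "\<dots> \<le> (R^2 + R ^ 3) * norm v" using R_pos by (intro mult_right_mono) auto
        finally show "norm (g z v - g z 0) \<le> (R^2 + R ^ 3) * norm v" .
      qed
    qed
    show "risk_grad (\<theta>s + v) = - (\<integral>z. g z v \<partial>\<nu>)" for v
      unfolding \<nu>_def by (subst integral_distr[OF XY gz]) (simp add: g_def expectation_step)
    show "continuous_on UNIV (\<lambda>v. risk_grad (\<theta>s + v))"
      by (intro continuous_on_compose2[OF continuous_on_risk_grad] continuous_intros) auto
    show "norm (risk_grad (\<theta>s + v) - risk_hess \<theta>s v) \<le> (R^2 + R ^ 3) * (norm v)^2" for v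
    proof -
      have "norm (risk_grad (\<theta>s + v) - risk_hess \<theta>s v) \<le> R ^ 3 * (norm v)^2"
        using risk_grad_taylor[of \<theta>s v] by (simp add: risk_grad_root)
      also have "\<dots> \<le> (R^2 + R ^ 3) * (norm v)^2" by (intro mult_right_mono) auto
      finally show ?thesis .
    qed
    show "risk_hess \<theta>s v \<bullet> w = v \<bullet> risk_hess \<theta>s w" for v w
      unfolding risk_hess_def by (rule second_moment_symmetric[OF weight_fun_sigmoid'])
    show "R^2 + R ^ 3 > 0" using R_pos by (simp add: add_pos_pos)
  qed (fact c(2) linear_add[OF linear_risk_hess] linear_scale[OF linear_risk_hess] \<mu>(2) \<gamma> R_pos c(1) \<mu>(1))+
  let ?B = "matrix_inv (hess (risk) \<theta>s)"
  have BA: "?B *v risk_hess \<theta>s v = v" for v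
    using invertible_matrix_inv[OF invertible_hess] by (simp add: matrix_vector_mul_assoc flip: hess_mult)
  obtain C where C: "C > 0" "\<And>n. n \<ge> 1 \<Longrightarrow> expectation (\<lambda>\<omega>. (norm ((1 / real n) *\<^sub>R (\<Sum>k=1..n. rm.iter k \<omega>)))^2)
    \<le> (\<integral>z. (norm (?B *v g z 0))^2 \<partial>\<nu>) / real n + C * real n powr (- 5 / 4)"
    using rm.averaging_bound[OF matrix_vector_mul_linear BA] by blast
  have Bm: "(\<lambda>z. (norm (?B *v g z 0))^2) \<in> borel_measurable borel"
  proof -
    have "(\<lambda>z. ?B *v g z 0) \<in> borel_measurable borel"
      by (rule borel_measurable_continuous_on[OF _ gz]) (intro continuous_intros matrix_vector_mult_linear_continuous_on)
    then show ?thesis by measurable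
  qed
  have tr: "(\<integral>z. (norm (?B *v g z 0))^2 \<partial>\<nu>) = trace (asymptotic_cov M X Y \<theta>s)"
    unfolding \<nu>_def trace_asymptotic_cov by (subst integral_distr[OF XY Bm]) (simp add: g_def)
  have iter: "rm.iter n \<omega> = logistic_sgd (\<lambda>k. \<gamma> * real k powr (-3/4)) \<theta>0 (\<lambda>k. Xs k \<omega>) (\<lambda>k. Ys k \<omega>) n - \<theta>s" for n \<omega>
  proof (induction n)
    case (Suc n)
    have "g (Z n \<omega>) v = logistic_step (Xs n \<omega>) (Ys n \<omega>) (\<theta>s + v)" for v
      by (simp add: g_def Z_def)
    then show ?case by (simp add: Suc rm.step_def)
  qed simp
  \<comment> \<open>For n >= 1 averaging the constant \<theta>s returns \<theta>s, so the averaged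
    error is the error of the average.\<close>
  have avg: "(1 / real n) *\<^sub>R (\<Sum>k=1..n. rm.iter k \<omega>)
      = averaged_sgd (\<lambda>k. \<gamma> * real k powr (-3/4)) \<theta>0 (\<lambda>k. Xs k \<omega>) (\<lambda>k. Ys k \<omega>) n - \<theta>s" if "n \<ge> 1" for n \<omega>
    using that unfolding averaged_sgd_def iter by (simp add: sum_subtractf scaleR_diff_right sum_constant_scaleR del: sum_constant)
  show ?thesis
    using C(2) by (intro exI[of _ C] conjI allI impI C(1)) (simp only: avg tr)
qed

end

theorem proposition1p3:
  fixes M :: "'a measure"
    and X :: "'a \<Rightarrow> real ^ 'd"
    and Y :: "'a \<Rightarrow> real"
    and R :: real
    and \<theta>s :: "real ^ 'd"
  assumes "prob_space M"
    and "X \<in> borel_measurable M"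
    and "Y \<in> borel_measurable M"
    and "R > 0"
    and supp: "\<exists>K. compact K \<and> K \<subseteq> cball 0 R \<and> (AE \<omega> in M. X \<omega> \<in> K)"
    and elliptic: "\<And>e. norm e = 1 \<Longrightarrow> prob_space.variance M (\<lambda>\<omega>. X \<omega> \<bullet> e) > 0"
    and "\<And>\<omega>. \<omega> \<in> space M \<Longrightarrow> Y \<omega> \<in> {-1, 1}"
    and cond: "AE \<omega> in M.
          real_cond_exp M (vimage_algebra (space M) X borel) (indicator {\<omega> \<in> space M. Y \<omega> = 1}) \<omega>
            = 1 / (1 + exp (- (X \<omega> \<bullet> \<theta>s)))"
  shows
    "(convex_on UNIV (logistic_risk M X Y) \<and>
      (\<forall>\<theta>. logistic_risk M X Y differentiable (at \<theta>)) \<and>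
      (\<forall>\<theta>. grad (logistic_risk M X Y) differentiable (at \<theta>)) \<and>
      bounded (range (hess (logistic_risk M X Y))) \<and>
      (\<exists>L. L-lipschitz_on UNIV (hess (logistic_risk M X Y))) \<and>
      invertible (hess (logistic_risk M X Y) \<theta>s) \<and>
      Liminf at_infinity (\<lambda>\<theta>. ereal (norm (grad (logistic_risk M X Y) \<theta>))) > 0 \<and>
      Limsup at_infinity (\<lambda>\<theta>. ereal (norm (grad (logistic_risk M X Y) \<theta>))) < \<infinity>)
     \<and>
     (\<forall>(Xs :: nat \<Rightarrow> 'a \<Rightarrow> real ^ 'd) (Ys :: nat \<Rightarrow> 'a \<Rightarrow> real) (\<gamma> :: real) (\<theta>0 :: real ^ 'd).
        iid_copies M (\<lambda>n \<omega>. (Xs n \<omega>, Ys n \<omega>)) (\<lambda>\<omega>. (X \<omega>, Y \<omega>)) \<and> \<gamma> > 0 \<longrightarrow>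
        (\<exists>C>0. \<forall>n\<ge>1.
           prob_space.expectation M
             (\<lambda>\<omega>. (norm (averaged_sgd (\<lambda>k. \<gamma> * real k powr (-3/4)) \<theta>0
                            (\<lambda>k. Xs k \<omega>) (\<lambda>k. Ys k \<omega>) n - \<theta>s))\<^sup>2)
           \<le> trace (asymptotic_cov M X Y \<theta>s) / real n + C * real n powr (-5/4)))"
proof -
  interpret prob_space M by fact
  interpret logistic_model M X Y R \<theta>s
  proof
    show "AE \<omega> in M. norm (X \<omega>) \<le> R"
    proof -
      obtain K where "K \<subseteq> cball 0 R" "AE \<omega> in M. X \<omega> \<in> K" using supp by blast
      from this(2) show ?thesis by eventually_elim (use \<open>K \<subseteq> cball 0 R\<close> in auto)
    qed
    show "AE \<omega> in M. real_cond_exp M (vimage_algebra (space M) X borel) (indicator {\<omega> \<in> space M. Y \<omega> = 1}) \<omega>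
        = sigmoid (X \<omega> \<bullet> \<theta>s)"
      using cond by (simp add: sigmoid_def)
  qed (fact assms)+
  have "logistic_risk M X Y differentiable (at \<theta>)" for \<theta>
    using GDERIV_logistic_risk[of \<theta>] unfolding gderiv_def differentiable_def by blast
  moreover have "risk_grad differentiable (at \<theta>)" for \<theta>
    using risk_grad_has_derivative[of \<theta>] unfolding differentiable_def by blast
  ultimately show ?thesis
    using convex_logistic_risk bounded_hess lipschitz_hess invertible_hess Liminf_risk_grad Limsup_risk_grad
      averaged_sgd_bound
    unfolding grad_logistic_risk by blast
qed

end
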